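(* Let $A(n)$ denote the number of subgroup classes of abelian groups of order $n$, and let $Z(s)=\sum_{n=1}^\infty A(n)n^{-s}$ denote the corresponding zeta function. Then $$Z(s)=\zeta^2(s)\,\zeta^3(2s)\,\zeta^3(3s)\,G_3(s),$$ where $G_3(s)$ is a Dirichlet series without real zeroes and absolutely convergent for $\Re(s)>1/4$. Furthermore $Z(s)$ is a meromorphic function for $\Re(s)>0$, and the imaginary axis is the natural boundary for $Z(s)$.
   Context: $\zeta$ is the Riemann zeta function. For a finite abelian group $G$, the number of subgroup classes of $G$ is the number of isomorphism classes of groups $H$ that are isomorphic to a subgroup of $G$. $A(n)$ is the sum, over isomorphism classes of abelian groups $G$ of order $n$ (of arbitrary rank), of the number of subgroup classes of $G$. The factorisation of $Z(s)$ holds for $\Re(s)>1$ and gives its meromorphic continuation to $\Re(s)>1/4$; "without real zeroes" refers to real $s>1/4$. "The second statement: $Z(s)$ is meromorphic for $\Re(s)>0$" means that $Z$ has a meromorphic continuation to that half-plane, and the imaginary axis being the natural boundary means that this function cannot be continued meromorphically beyond the line $\Re(s)=0$ (across any point of it). *)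

theory Defs
  imports "HOL-Complex_Analysis.Complex_Analysis" "HOL-Algebra.Coset"
begin

text \<open>
  Every finite group has an isomorphic copy on a set of natural numbers, so the isomorphism
  classes of finite groups are represented by structures of type \<^typ>\<open>nat monoid\<close>.
\<close>

definition iso_classes :: "nat monoid set \<Rightarrow> nat monoid set set" where
  "iso_classes X = X // {(G, H). G \<in> X \<and> H \<in> X \<and> G \<cong> H}"

definition num_subgroup_classes :: "nat monoid \<Rightarrow> nat" where
  "num_subgroup_classes G =
     card (iso_classes {H. group H \<and> (\<exists>K. subgroup K G \<and> H \<cong> G\<lparr>carrier := K\<rparr>)})"

definition abelian_groups_of_order :: "nat \<Rightarrow> nat monoid set" where
  "abelian_groups_of_order n =
     {G. comm_group G \<and> finite (carrier G) \<and> Coset.order G = n}"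

text \<open>
  The number of subgroup classes is an isomorphism invariant, so its image of an isomorphism
  class \<open>C\<close> is a singleton.
\<close>

definition subgroup_class_sum :: "nat \<Rightarrow> nat" where
  "subgroup_class_sum n =
     (\<Sum>C\<in>iso_classes (abelian_groups_of_order n). the_elem (num_subgroup_classes ` C))"

text \<open>Index \<open>n\<close> carries the term for \<open>Suc n\<close>; the value of \<open>a\<close> at \<open>0\<close> is ignored.\<close>

definition dirichlet_term :: "(nat \<Rightarrow> complex) \<Rightarrow> complex \<Rightarrow> nat \<Rightarrow> complex" where
  "dirichlet_term a s n = a (Suc n) * of_nat (Suc n) powr (- s)"

definition dirichlet_series :: "(nat \<Rightarrow> complex) \<Rightarrow> complex \<Rightarrow> complex" where
  "dirichlet_series a s = (\<Sum>n. dirichlet_term a s n)"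

text \<open>
  The analytic continuation of \<open>\<Sum> n powr (-s)\<close> to the punctured plane is unique; the value at
  the pole \<open>1\<close> is fixed to \<open>0\<close> by convention.
\<close>

definition riemann_zeta :: "complex \<Rightarrow> complex" where
  "riemann_zeta = (THE f. f holomorphic_on - {1} \<and> f 1 = 0 \<and>
     (\<forall>s. Re s > 1 \<longrightarrow> f s = dirichlet_series (\<lambda>_. 1) s))"

text \<open>
  \<open>B\<close> is (part of) the boundary of the domain \<open>D\<close> of the meromorphic function \<open>f\<close>. Since
  meromorphic functions are determined only up to their values on a sparse set, a continuation
  of \<open>f\<close> has to agree with \<open>f\<close> only outside such a set.
\<close>

definition natural_boundary :: "(complex \<Rightarrow> complex) \<Rightarrow> complex set \<Rightarrow> complex set \<Rightarrow> bool" where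
  "natural_boundary f D B \<longleftrightarrow> f meromorphic_on D \<and> B \<subseteq> frontier D \<and>
     (\<forall>z\<in>B. \<not> (\<exists>U h. open U \<and> z \<in> U \<and> h meromorphic_on U \<and> (\<forall>\<^sub>\<approx>w\<in>U \<inter> D. h w = f w)))"

end

theory Submission
  imports Defs
    "HOL-Algebra.Multiplicative_Group"
    "HOL-Number_Theory.Number_Theory"
    "HOL-Computational_Algebra.Computational_Algebra"
begin

text \<open>
  By the classification of finite abelian groups, a group of order \<open>p ^ k\<close> together with a class of
  its subgroups amounts to a pair of partitions \<open>\<mu> \<subseteq> \<lambda>\<close> with \<open>\<lambda>\<close> a partition of \<open>k\<close>. Hence \<open>A\<close> is multiplicative,
  \<open>A (p ^ k)\<close> is the number \<open>N k\<close> of these pairs, and \<open>Z s\<close> is the product of \<open>F (p powr - s)\<close> over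
  the primes, with \<open>F x = (\<Sum>k. N k * x ^ k) = 1 + 2 x + 6 x\<^sup>2 + 13 x\<^sup>3 + \<dots>\<close>. Multiplying \<open>F\<close> by
  \<open>(1 - x)\<^sup>2 (1 - x\<^sup>2)\<^sup>3 (1 - x\<^sup>3)\<^sup>3\<close> and then by suitable integer powers of \<open>1 - x ^ n\<close> for \<open>n \<ge> 4\<close> removes
  one coefficient after another; each step splits off a power of \<open>riemann_zeta (n * s)\<close> and moves the abscissa
  of absolute convergence of the remaining Euler product to \<open>1 / (n + 1)\<close>. As \<open>F\<close> is positive
  on \<open>(0, 1)\<close>, no factor vanishes at a real point.

  The natural boundary comes from a zero \<open>x\<^sub>0\<close> of \<open>F\<close> in the punctured unit disc. If \<open>F\<close> had no zero,
  then \<open>ln F\<close> would be holomorphic on the disc, and a bound \<open>ln F r = O(1 / (1 - r))\<close> would bound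
  the Taylor coefficients of \<open>x F' / F\<close> by the Borel-Caratheodory inequality; the coefficient
  of \<open>x ^ 39\<close>, which is \<open>-89858\<close>, violates this bound. The solutions of \<open>p powr - s = x\<^sub>0\<close>
  accumulate at every point of the imaginary axis as \<open>p\<close> grows. They are zeros of \<open>Z\<close> unless they
  are cancelled by zeros of some \<open>riemann_zeta (n * s)\<close>, and by Jensen's inequality zeta has too few zeros for that.
\<close>

subsection \<open>Finite abelian groups and their subgroups\<close>

text \<open>The zero of \<open>F\<close> is never located. If \<open>F\<close> had no zero, the
  coefficients of \<open>x F' / F\<close> would grow at most quadratically, whereas a zero in the
  disc allows exponential growth; index 39 is far enough out for the exact value to exceed the
  explicit quadratic bound. The margin is only a few per cent, so the constants in the bound for
  \<open>ln F\<close> matter.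

  The exponents of the zeta factors with \<open>n \<ge> 4\<close> are integers about which nothing
  else is known. A zero of \<open>riemann_zeta (n * s)\<close> may thus produce a zero or a pole of
  \<open>Z\<close>, and the solutions \<open>s\<close> have to avoid all of these zeros; being
  nonreal, they also avoid the poles \<open>1 / n\<close>.

  No single formula covers \<open>Re s > 0\<close>, since every level of the factorisation stops at
  a positive abscissa. \<open>Z\<close> is glued from the levels. They agree because each zeta power
  is split off only where its own Euler product converges.

  Near a boundary point a meromorphic function either vanishes identically or has no zeros in a
  punctured neighbourhood. The zeros of \<open>Z\<close> rule out the second case, the identity
  theorem the first.\<close>

lemma (in comm_group) ord_dvd_max_ord:
  assumes fin: "finite (carrier G)" and x: "x \<in> carrier G"
    and max: "\<And>z. z \<in> carrier G \<Longrightarrow> ord z \<le> ord x" and y: "y \<in> carrier G"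
  shows "ord y dvd ord x"
proof (rule ccontr)
  define m n where "m = ord x" and "n = ord y"
  have pos: "m > 0" "n > 0"
    using ord_ge_1[OF fin x] ord_ge_1[OF fin y] by (auto simp: m_def n_def)
  assume ndvd: "\<not> ord y dvd ord x"
  have "\<exists>p. prime p \<and> multiplicity p n > multiplicity p m"
  proof (rule ccontr)
    assume "\<not> ?thesis"
    hence "n dvd m" using pos by (intro multiplicity_le_imp_dvd) (auto simp: not_less)
    thus False using ndvd by (simp add: m_def n_def)
  qed
  then obtain p where p: "prime p" "multiplicity p n > multiplicity p m" by blast
  define a b where "a = multiplicity p m" and "b = multiplicity p n"
  have pa: "p ^ a dvd m" and pb: "p ^ b dvd n"
    by (auto simp: a_def b_def multiplicity_dvd)
  have p0: "p > 0" using p(1) prime_gt_0_nat by blast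
  \<comment> \<open>Removing the p-part from \<open>x\<close> and keeping only the p-part of
    \<open>y\<close> gives coprime orders. The order of the product is then at least the product of
    the orders, which exceeds \<open>m\<close> since \<open>b > a\<close>.\<close>
  define x' where "x' = x [^] (p ^ a)"
  define y' where "y' = y [^] (n div p ^ b)"
  have x': "x' \<in> carrier G" and y': "y' \<in> carrier G" using x y by (auto simp: x'_def y'_def)
  have ox: "ord x' = m div p ^ a"
    unfolding x'_def m_def by (rule ord_pow) (use x pa p0 m_def in auto)
  have nb: "n div p ^ b dvd n" "n div p ^ b \<noteq> 0"
    using pb pos by (auto simp: dvd_div_eq_0_iff)
  have oy: "ord y' = p ^ b"
  proof -
    have "ord y' = n div (n div p ^ b)"
      unfolding y'_def n_def by (rule ord_pow) (use y nb n_def in auto)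
    also obtain c where c: "n = p ^ b * c" using pb by blast
    have "n div (n div p ^ b) = p ^ b" using pos p0 by (simp add: c)
    finally show ?thesis .
  qed
  have "\<not> p dvd m div p ^ a"
    unfolding a_def by (rule multiplicity_decompose) (use pos p(1) in auto)
  hence cop: "coprime (ord x') (ord y')"
    unfolding ox oy using p(1) by (metis coprime_commute coprime_power_left_iff prime_imp_coprime)
  define z where "z = x' \<otimes> y'"
  have z: "z \<in> carrier G" using x' y' by (simp add: z_def)
  define k where "k = ord z"
  have k0: "k > 0" using ord_ge_1[OF fin z] by (simp add: k_def)
  have zz: "x' [^] (k * j) \<otimes> y' [^] (k * j) = \<one>" for j
  proof -
    have "z [^] (k * j) = \<one>" using z by (simp add: k_def pow_eq_id)
    thus ?thesis using x' y' by (simp add: z_def nat_pow_distrib)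
  qed
  have "y' [^] (k * ord y') = \<one>" using y' by (simp add: pow_eq_id)
  hence "x' [^] (k * ord y') = \<one>" using zz[of "ord y'"] x' by simp
  hence "ord x' dvd k * ord y'" using x' by (simp add: pow_eq_id)
  hence u: "ord x' dvd k" using cop by (simp add: coprime_dvd_mult_left_iff)
  have "x' [^] (k * ord x') = \<one>" using x' by (simp add: pow_eq_id)
  hence "y' [^] (k * ord x') = \<one>" using zz[of "ord x'"] y' by simp
  hence "ord y' dvd k * ord x'" using y' by (simp add: pow_eq_id)
  hence v: "ord y' dvd k" using cop by (simp add: coprime_dvd_mult_left_iff coprime_commute)
  have "ord x' * ord y' dvd k" using u v cop by (simp add: divides_mult)
  hence le: "(m div p ^ a) * p ^ b \<le> k" using k0 ox oy by (auto dest: dvd_imp_le)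
  have "m = (m div p ^ a) * p ^ a" using pa by simp
  also have "\<dots> < (m div p ^ a) * p ^ b"
    using p pos pa prime_gt_1_nat[OF p(1)] by (intro mult_strict_left_mono power_strict_increasing) (auto simp: a_def b_def div_greater_zero_iff dvd_imp_le)
  finally have "m < k" using le by simp
  thus False using max[OF z] by (simp add: m_def k_def)
qed

lemma (in group) coprime_int_pow_mem_subgroup:
  assumes H: "subgroup H G" and y: "y \<in> carrier G" and "y [^] (i::int) \<in> H" "y [^] (j::int) \<in> H" "coprime i j"
  shows "y \<in> H"
proof -
  obtain u v where uv: "u * i + v * j = 1" using bezout_int[of i j] assms(5) by (auto simp: coprime_iff_gcd_eq_1)
  have "y = y [^] (u * i + v * j)" using y by (simp add: uv)
  also have "\<dots> = (y [^] i) [^] u \<otimes> (y [^] j) [^] v"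
    using y by (simp add: int_pow_mult int_pow_pow mult.commute)
  also have "\<dots> \<in> H" using assms(3,4) H
    by (meson subgroup.m_closed subgroup_int_pow_closed)
  finally show ?thesis .
qed

lemma (in group) subgroup_int_powers:
  assumes "x \<in> carrier G" shows "subgroup (range (\<lambda>i::int. x [^] i)) G"
  using assms
  by (intro subgroupI) (auto simp: int_pow_neg[symmetric] int_pow_mult[symmetric])

text \<open>A subgroup \<open>K\<close> that is maximal among those meeting the cyclic group
  \<open>C\<close> trivially is already a complement. If \<open>K <#> C\<close> missed an element,
  some \<open>y0\<close> outside it would have a p-th power inside. As \<open>ord x\<close>
  annihilates the whole group, the component of that power in \<open>C\<close> is itself a p-th
  power and can be divided out; adjoining the corrected element to \<open>K\<close> contradicts
  maximality.\<close>

lemma (in comm_group) complement_of_max_ord: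
  assumes fin: "finite (carrier G)" and x: "x \<in> carrier G"
    and exp: "\<And>y. y \<in> carrier G \<Longrightarrow> y [^] ord x = \<one>"
  defines "C \<equiv> range (\<lambda>i::int. x [^] i)"
  obtains K where "subgroup K G" "K \<inter> C = {\<one>}" "K <#> C = carrier G"
proof -
  have C: "subgroup C G" unfolding C_def by (rule subgroup_int_powers[OF x])
  define P where "P = (\<lambda>K. subgroup K G \<and> K \<inter> C = {\<one>})"
  have "P {\<one>}" unfolding P_def using C by (auto simp: triv_subgroup subgroup.one_closed)
  moreover have bound: "\<forall>K. P K \<longrightarrow> card K \<le> card (carrier G)"
    unfolding P_def using fin by (auto intro!: card_mono dest: subgroup.subset)
  ultimately obtain K where K: "P K" and Kmax: "\<And>K'. P K' \<Longrightarrow> card K' \<le> card K"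
    using ex_has_greatest_nat[of P "{\<one>}" card "Suc (card (carrier G))"] by (auto simp: le_imp_less_Suc)
  have Ks: "subgroup K G" and KC: "K \<inter> C = {\<one>}" using K by (auto simp: P_def)
  define M where "M = K <#> C"
  have M: "subgroup M G" unfolding M_def by (rule mult_subgroups[OF Ks C])
  have KM: "K \<subseteq> M" 
    unfolding M_def set_mult_def using subgroup.one_closed[OF C] subgroup.mem_carrier[OF Ks] by fastforce
  have CM: "C \<subseteq> M" 
    unfolding M_def set_mult_def using subgroup.one_closed[OF Ks] subgroup.mem_carrier[OF C] by fastforce
  have "carrier G \<subseteq> M"
  proof (rule ccontr)
    assume "\<not> carrier G \<subseteq> M"
    then obtain y where y: "y \<in> carrier G" "y \<notin> M" by auto
    \<comment> \<open>The least positive power of \<open>y\<close> that falls into \<open>M\<close>;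
      a prime divisor \<open>p\<close> of \<open>q\<close> yields \<open>y0\<close> outside
      \<open>M\<close> with \<open>y0 [^] p\<close> inside.\<close>
    define q where "q = (LEAST q. q > 0 \<and> y [^] (q::nat) \<in> M)"
    have "ord y > 0 \<and> y [^] ord y \<in> M" using y ord_ge_1[OF fin y(1)] subgroup.one_closed[OF M] by auto
    hence q: "q > 0" "y [^] q \<in> M" and qmin: "\<And>j. j > 0 \<Longrightarrow> y [^] j \<in> M \<Longrightarrow> q \<le> j"
      unfolding q_def by (rule LeastI2_ex[where P="\<lambda>q. q > 0 \<and> y [^] (q::nat) \<in> M", OF exI], simp)+ (auto intro: Least_le)
    have "q \<noteq> 1" using q y by auto
    then obtain p where p: "prime p" "p dvd q" using prime_factor_nat by blast
    define y0 where "y0 = y [^] (q div p)"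
    have y0: "y0 \<in> carrier G" using y by (simp add: y0_def)
    have "q div p > 0" "q div p < q" using p q prime_gt_1_nat[OF p(1)] by (auto simp: div_greater_zero_iff dvd_imp_le)
    hence y0M: "y0 \<notin> M" unfolding y0_def using qmin by (meson leD)
    have "y0 [^] p = y [^] q" unfolding y0_def using y p by (simp add: nat_pow_pow)
    hence y0p: "y0 [^] p \<in> M" using q by simp
    define e where "e = ord x"
    have e0: "e > 0" using ord_ge_1[OF fin x] by (simp add: e_def)
    have pe: "p dvd e"
    proof (rule ccontr)
      assume "\<not> p dvd e"
      hence "coprime (int p) (int e)" using p(1) prime_imp_coprime by auto
      moreover have "y0 [^] int e \<in> M" using exp[OF y0] subgroup.one_closed[OF M] by (simp add: e_def int_pow_int)
      moreover have "y0 [^] int p \<in> M" using y0p by (simp add: int_pow_int)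
      ultimately show False using coprime_int_pow_mem_subgroup[OF M y0] y0M by blast
    qed
    obtain k m where km: "k \<in> K" "y0 [^] p = k \<otimes> x [^] (m::int)"
      using y0p unfolding M_def set_mult_def C_def by auto
    have k: "k \<in> carrier G" using km subgroup.mem_carrier[OF Ks] by blast
    \<comment> \<open>Raising \<open>y0 [^] p = k \<otimes> x [^] m\<close> to the power
      \<open>e div p\<close> puts \<open>x [^] (m * (e div p))\<close> into
      \<open>K \<inter> C\<close>. Hence \<open>e\<close> divides \<open>m * (e div p)\<close>, that
      is, \<open>p\<close> divides \<open>m\<close>.\<close>
    have "\<one> = y0 [^] e" using exp[OF y0] by (simp add: e_def)
    also have "\<dots> = (y0 [^] p) [^] (e div p)" using y0 pe by (simp add: nat_pow_pow)
    also have "\<dots> = k [^] (e div p) \<otimes> (x [^] m) [^] (e div p)"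
      unfolding km by (rule nat_pow_distrib) (use k x in auto)
    also have "(x [^] m) [^] (e div p) = x [^] (m * int (e div p))"
      using x by (simp add: int_pow_pow[symmetric] int_pow_int)
    finally have eq: "k [^] (e div p) \<otimes> x [^] (m * int (e div p)) = \<one>" by simp
    have "x [^] (m * int (e div p)) = inv (k [^] (e div p))"
      using eq k x by (metis inv_equality inv_inv int_pow_closed nat_pow_closed inv_closed)
    also have "\<dots> \<in> K" using km(1) Ks by (metis subgroup.m_inv_closed subgroup_int_pow_closed int_pow_int)
    finally have "x [^] (m * int (e div p)) \<in> K \<inter> C" by (auto simp: C_def)
    hence "x [^] (m * int (e div p)) = \<one>" using KC by auto
    hence "int e dvd m * int (e div p)" using x int_pow_eq_id by (simp add: e_def)
    moreover have "int e = int p * int (e div p)" using pe by (metis dvd_mult_div_cancel of_nat_mult)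
    ultimately have "int p dvd m" using pe e0 by auto
    then obtain m' where m': "m = m' * int p" by (metis dvd_def mult.commute)
    define y' where "y' = y0 \<otimes> x [^] (- m')"
    have y': "y' \<in> carrier G" using y0 x by (simp add: y'_def)
    have "y' [^] p = y0 [^] p \<otimes> (x [^] (- m')) [^] p"
      unfolding y'_def by (rule nat_pow_distrib) (use y0 x in auto)
    also have "(x [^] (- m')) [^] p = x [^] (- m)"
      using x by (simp add: m' int_pow_pow[symmetric] int_pow_int int_pow_neg nat_pow_inv)
    also have "y0 [^] p \<otimes> x [^] (- m) = k"
      unfolding km using x k by (simp add: int_pow_neg m_assoc)
    finally have y'p: "y' [^] int p \<in> K" using km by (simp add: int_pow_int)
    have y'M: "y' \<notin> M"
    proof
      assume "y' \<in> M"
      moreover have "x [^] m' \<in> M" using CM by (auto simp: C_def)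
      ultimately have "y' \<otimes> x [^] m' \<in> M" using M by (simp add: subgroup.m_closed)
      moreover have "y' \<otimes> x [^] m' = y0" unfolding y'_def using y0 x by (simp add: m_assoc int_pow_neg)
      ultimately show False using y0M by simp
    qed
    define K' where "K' = K <#> range (\<lambda>i::int. y' [^] i)"
    have K's: "subgroup K' G" unfolding K'_def by (rule mult_subgroups[OF Ks subgroup_int_powers[OF y']])
    have "K' \<inter> C \<subseteq> {\<one>}"
    proof
      fix w assume w: "w \<in> K' \<inter> C"
      then obtain k2 i where w1: "k2 \<in> K" "w = k2 \<otimes> y' [^] (i::int)"
        by (auto simp: K'_def set_mult_def)
      have k2: "k2 \<in> carrier G" using w1 subgroup.mem_carrier[OF Ks] by blast
      \<comment> \<open>If \<open>p\<close> divides \<open>i\<close>, the power of \<open>y'\<close>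
        already lies in \<open>K\<close>. Otherwise \<open>M\<close> contains the powers of
        \<open>y'\<close> with the coprime exponents \<open>i\<close> and \<open>p\<close>, and
        hence \<open>y'\<close> itself.\<close>
      show "w \<in> {\<one>}"
      proof (cases "int p dvd i")
        case True
        then obtain j where "i = int p * j" by (auto simp: dvd_def)
        hence "y' [^] i = (y' [^] int p) [^] j" using y' by (simp add: int_pow_pow)
        hence "y' [^] i \<in> K" using y'p Ks subgroup_int_pow_closed by simp
        hence "w \<in> K" using w1 Ks by (simp add: subgroup.m_closed)
        thus ?thesis using w KC by auto
      next
        case False
        hence cop: "coprime (int p) i" using p(1) prime_imp_coprime[of "int p" i] by simp
        have "y' [^] i = inv k2 \<otimes> w" using w1 k2 y' by (simp add: m_assoc[symmetric])
        also have "\<dots> \<in> M"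
            using w w1(1) KM CM by (intro subgroup.m_closed[OF M] subgroup.m_inv_closed[OF M]) auto
        finally have "y' [^] i \<in> M" .
        hence "y' \<in> M" using coprime_int_pow_mem_subgroup[OF M y' _ _ cop] y'p KM by blast
        thus ?thesis using y'M by simp
      qed
    qed
    hence "P K'" unfolding P_def using K's subgroup.one_closed[OF C] subgroup.one_closed[OF K's] by auto
    moreover have "K \<subset> K'"
    proof
      show "K \<subseteq> K'"
      proof
        fix u assume "u \<in> K"
        moreover have "u = u \<otimes> y' [^] (0::int)" using \<open>u \<in> K\<close> subgroup.mem_carrier[OF Ks] by simp
        ultimately show "u \<in> K'" unfolding K'_def set_mult_def by blast
      qed
      have "y' = \<one> \<otimes> y' [^] (1::int)" using y' by simp
      hence "y' \<in> K'" unfolding K'_def set_mult_def using subgroup.one_closed[OF Ks] by blast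
      thus "K \<noteq> K'" using y'M KM by auto
    qed
    moreover have "finite K'" using K's fin by (meson finite_subset subgroup.subset)
    ultimately show False using Kmax psubset_card_mono by (meson leD)
  qed
  hence "K <#> C = carrier G" using M subgroup.subset unfolding M_def by blast
  thus ?thesis using that Ks KC by blast
qed

section \<open>Invariant factors and sums of cyclic groups\<close>

definition divisor_chain :: "(nat \<Rightarrow> nat) \<Rightarrow> bool" where
  "divisor_chain d \<longleftrightarrow> (\<forall>i. d i > 0 \<and> d (Suc i) dvd d i) \<and> finite {i. d i \<noteq> 1}"

text \<open>Chains of invariant factors are infinite sequences ending in 1, so groups of different
  rank are compared entry by entry; an entry 1 confines its coordinate to 0. Choosing
  representatives of the residues makes equality of elements equality of functions.\<close>

definition cyclic_sum :: "(nat \<Rightarrow> nat) \<Rightarrow> (nat \<Rightarrow> int) monoid" where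
  "cyclic_sum d = \<lparr>carrier = {f. \<forall>i. 0 \<le> f i \<and> f i < int (d i)},
     monoid.mult = (\<lambda>x y i. (x i + y i) mod int (d i)), one = (\<lambda>_. 0)\<rparr>"

lemma divisor_chain_pos: "divisor_chain d \<Longrightarrow> d i > 0"
  by (simp add: divisor_chain_def)

lemma divisor_chain_dvd:
  assumes "divisor_chain d" "i \<le> j" shows "d j dvd d i"
  using assms(2) by (induction rule: dec_induct) (use assms(1) in \<open>auto simp: divisor_chain_def intro: dvd_trans\<close>)

lemma comm_group_cyclic_sum:
  assumes "\<And>i. d i > 0" shows "comm_group (cyclic_sum d)"
proof -
  have "\<exists>y. (\<forall>i. 0 \<le> y i \<and> y i < int (d i)) \<and> (\<lambda>i. (y i + x i) mod int (d i)) = (\<lambda>_. 0)"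
    if "\<forall>i. 0 \<le> x i \<and> x i < int (d i)" for x
    by (rule exI[of _ "\<lambda>i. (- x i) mod int (d i)"]) (use assms in \<open>simp add: mod_add_left_eq\<close>)
  hence inv: "\<exists>y\<in>carrier (cyclic_sum d). y \<otimes>\<^bsub>cyclic_sum d\<^esub> x = \<one>\<^bsub>cyclic_sum d\<^esub>"
    if "x \<in> carrier (cyclic_sum d)" for x using that by (simp add: cyclic_sum_def)
  have "group (cyclic_sum d)"
  proof (rule groupI)
    show "(x \<otimes>\<^bsub>cyclic_sum d\<^esub> y) \<otimes>\<^bsub>cyclic_sum d\<^esub> z = x \<otimes>\<^bsub>cyclic_sum d\<^esub> (y \<otimes>\<^bsub>cyclic_sum d\<^esub> z)" for x y z
      by (simp add: cyclic_sum_def mod_add_left_eq mod_add_right_eq add.assoc)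
    show "x \<otimes>\<^bsub>cyclic_sum d\<^esub> y \<in> carrier (cyclic_sum d)" for x y
      using assms by (simp add: cyclic_sum_def)
    show "\<one>\<^bsub>cyclic_sum d\<^esub> \<in> carrier (cyclic_sum d)"
      using assms by (simp add: cyclic_sum_def)
    show "\<one>\<^bsub>cyclic_sum d\<^esub> \<otimes>\<^bsub>cyclic_sum d\<^esub> x = x" if "x \<in> carrier (cyclic_sum d)" for x
      using that by (simp add: cyclic_sum_def)
  qed (rule inv)
  moreover have "x \<otimes>\<^bsub>cyclic_sum d\<^esub> y = y \<otimes>\<^bsub>cyclic_sum d\<^esub> x" for x y
    by (simp add: cyclic_sum_def add.commute)
  ultimately show ?thesis by (simp add: group.group_comm_groupI)
qed

lemma nat_pow_cyclic_sum:
  shows "x [^]\<^bsub>cyclic_sum d\<^esub> (n::nat) = (\<lambda>i. (int n * x i) mod int (d i))"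
proof (induction n)
  case (Suc n)
  have "x [^]\<^bsub>cyclic_sum d\<^esub> Suc n = x [^]\<^bsub>cyclic_sum d\<^esub> n \<otimes>\<^bsub>cyclic_sum d\<^esub> x" by (simp add: nat_pow_def)
  thus ?case by (simp add: Suc.IH) (simp add: cyclic_sum_def mod_add_left_eq mod_add_right_eq distrib_right add.commute)
qed (simp add: cyclic_sum_def nat_pow_def)

text \<open>Only finitely many coordinates are free, the others being confined to \<open>{0}\<close>.\<close>

lemma card_Pi_eventually_singleton:
  fixes A :: "nat \<Rightarrow> int set"
  assumes "\<And>i. finite (A i)" "\<And>i. i \<ge> J \<Longrightarrow> A i = {0}"
  shows "finite {f. \<forall>i. f i \<in> A i}" "card {f. \<forall>i. f i \<in> A i} = (\<Prod>i<J. card (A i))"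
proof -
  have "bij_betw (\<lambda>f. restrict f {..<J}) {f. \<forall>i. f i \<in> A i} (Pi\<^sub>E {..<J} A)"
  proof (rule bij_betwI[where g = "\<lambda>f i. if i < J then f i else 0"])
    show "(\<lambda>f i. if i < J then f i else 0) \<in> Pi\<^sub>E {..<J} A \<rightarrow> {f. \<forall>i. f i \<in> A i}"
    proof safe
      fix f i assume "f \<in> Pi\<^sub>E {..<J} A"
      thus "(if i < J then f i else 0) \<in> A i" using assms(2)[of i] by (cases "i < J") (auto dest: PiE_mem)
    qed
    show "(\<lambda>i. if i < J then restrict f {..<J} i else 0) = f" if "f \<in> {f. \<forall>i. f i \<in> A i}" for f
    proof
      fix i
      have "f i \<in> A i" using that by blast
      thus "(if i < J then restrict f {..<J} i else 0) = f i" using assms(2)[of i] by (cases "i < J") auto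
    qed
    show "restrict (\<lambda>i. if i < J then f i else 0) {..<J} = f" if "f \<in> Pi\<^sub>E {..<J} A" for f
    proof
      fix i
      show "restrict (\<lambda>i. if i < J then f i else 0) {..<J} i = f i"
        using PiE_arb[OF that, of i] by (cases "i < J") auto
    qed
  qed auto
  note bij = this
  have fc: "finite (Pi\<^sub>E {..<J} A)" "card (Pi\<^sub>E {..<J} A) = (\<Prod>i<J. card (A i))"
    using assms(1) by (auto intro: finite_PiE simp: card_PiE)
  show "finite {f. \<forall>i. f i \<in> A i}" using bij_betw_finite[OF bij] fc by simp
  show "card {f. \<forall>i. f i \<in> A i} = (\<Prod>i<J. card (A i))" using bij_betw_same_card[OF bij] fc by simp
qed

lemma divisor_chain_eventually_1:
  assumes "divisor_chain d" obtains J where "\<And>i. i \<ge> J \<Longrightarrow> d i = 1"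
proof -
  have "finite {i. d i \<noteq> 1}" using assms by (simp add: divisor_chain_def)
  then obtain J where J: "\<forall>i\<in>{i. d i \<noteq> 1}. i < J" unfolding finite_nat_set_iff_bounded by blast
  have "d i = 1" if "i \<ge> J" for i using J that not_less by blast
  thus ?thesis by (rule that)
qed

lemma prod_divisor_chain:
  fixes d :: "nat \<Rightarrow> nat"
  assumes "\<And>i. i \<ge> J \<Longrightarrow> d i = 1" shows "(\<Prod>i<J. d i) = (\<Prod>i | d i \<noteq> 1. d i)"
proof (rule prod.mono_neutral_right)
  show "{i. d i \<noteq> 1} \<subseteq> {..<J}"
  proof safe
    fix i assume i: "d i \<noteq> 1"
    show "i < J" by (rule ccontr) (use assms[of i] i in \<open>simp add: not_less\<close>)
  qed
qed auto

lemma card_cyclic_sum: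
  assumes "divisor_chain d"
  shows "finite (carrier (cyclic_sum d))" "order (cyclic_sum d) = (\<Prod>i | d i \<noteq> 1. d i)"
proof -
  obtain J where J: "\<And>i. i \<ge> J \<Longrightarrow> d i = 1" using divisor_chain_eventually_1[OF assms] by blast
  have eq: "carrier (cyclic_sum d) = {f. \<forall>i. f i \<in> {0..<int (d i)}}"
    by (simp add: cyclic_sum_def)
  have J0: "{0..<int (d i)} = {0}" if "i \<ge> J" for i unfolding J[OF that] by auto
  show "finite (carrier (cyclic_sum d))"
    unfolding eq by (rule card_Pi_eventually_singleton(1)[OF _ J0]) auto
  have "card {f. \<forall>i. f i \<in> {0..<int (d i)}} = (\<Prod>i<J. card {0..<int (d i)})"
    by (rule card_Pi_eventually_singleton(2)[OF _ J0]) auto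
  also have "\<dots> = (\<Prod>i | d i \<noteq> 1. d i)" using prod_divisor_chain[OF J] by simp
  finally show "order (cyclic_sum d) = (\<Prod>i | d i \<noteq> 1. d i)"
    unfolding order_def eq .
qed

text \<open>For prime \<open>p\<close> and a sum of cyclic groups this is \<open>p\<close> to the
  number of summands whose order is divisible by \<open>p ^ Suc k\<close>. Embeddings cannot
  decrease it, and together these numbers decide which groups embed.\<close>

definition torsion_count :: "nat \<Rightarrow> nat \<Rightarrow> ('a, 'b) monoid_scheme \<Rightarrow> nat" where
  "torsion_count p k G = card {x \<in> carrier G. x [^]\<^bsub>G\<^esub> p = \<one>\<^bsub>G\<^esub> \<and> (\<exists>y\<in>carrier G. x = y [^]\<^bsub>G\<^esub> (p ^ k))}"

text \<open>If \<open>p ^ Suc k\<close> divides \<open>d\<close>, the residues killed by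
  \<open>p\<close> are the \<open>p\<close> multiples of \<open>d div p\<close>, and each is
  divisible by \<open>p ^ k\<close>. Otherwise the p-part of \<open>d\<close> divides
  \<open>p ^ k\<close>, so a multiple of \<open>p ^ k\<close> that is killed by \<open>p\<close> is
  0.\<close>

lemma card_torsion_mod:
  fixes d :: nat
  assumes p: "prime p" and d: "d > 0"
  shows "card {a \<in> {0..<int d}. (int p * a) mod int d = 0 \<and> (\<exists>b\<in>{0..<int d}. a = (int (p ^ k) * b) mod int d)}
       = (if p ^ Suc k dvd d then p else 1)"
proof (cases "p ^ Suc k dvd d")
  case True
  then obtain c where c: "d = p ^ Suc k * c" by (rule dvdE)
  have pos: "p > 0" "c > 0" using d c by (auto intro: Nat.gr0I)
  have "{a \<in> {0..<int d}. (int p * a) mod int d = 0 \<and> (\<exists>b\<in>{0..<int d}. a = (int (p ^ k) * b) mod int d)}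
      = (\<lambda>j. int j * int (p ^ k * c)) ` {..<p}" (is "?L = ?R")
  proof (intro equalityI subsetI)
    fix a assume a: "a \<in> ?L"
    hence "int d dvd int p * a" by auto
    hence "int (p ^ k * c) dvd a" using pos by (simp add: c mult.assoc)
    then obtain j where j: "a = int (p ^ k * c) * j" by (rule dvdE)
    have P: "int (p ^ k * c) > 0" using pos by simp
    moreover have "int (p ^ k * c) * j \<ge> 0" using a j by simp
    ultimately have "j \<ge> 0" by (meson not_less mult_pos_neg)
    moreover have "int (p ^ k * c) * j < int (p ^ k * c) * int p" using a by (simp add: j c mult_ac)
    hence "j < int p" using pos by (simp add: mult_less_cancel_left_pos)
    ultimately have "nat j < p" "a = int (nat j) * int (p ^ k * c)" using j by auto
    thus "a \<in> ?R" by blast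
  next
    fix a assume "a \<in> ?R"
    then obtain j where j: "j < p" "a = int j * int (p ^ k * c)" by auto
    have "j * (p ^ k * c) < p * (p ^ k * c)" using j pos by simp
    hence lt: "a < int d" unfolding j c by (metis of_nat_less_iff of_nat_mult power_Suc mult.assoc)
    have "j * c < p * c" using j pos by simp
    also have "\<dots> \<le> d" unfolding c using pos by simp
    finally have "int (j * c) < int d" by (simp only: of_nat_less_iff)
    moreover have "a = (int (p ^ k) * int (j * c)) mod int d"
      using lt by (simp add: j mult_ac)
    moreover have "int p * a = int j * int d" by (simp add: j c mult_ac)
    ultimately have "\<exists>b\<in>{0..<int d}. a = (int (p ^ k) * b) mod int d" "(int p * a) mod int d = 0"
      by (force, simp)
    moreover have "a \<ge> 0" by (simp add: j)
    ultimately show "a \<in> ?L" using lt by auto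
  qed
  moreover have "inj_on (\<lambda>j. int j * int (p ^ k * c)) {..<p}"
    using pos by (auto intro!: inj_onI)
  ultimately show ?thesis using True by (simp add: card_image)
next
  case False
  have "{a \<in> {0..<int d}. (int p * a) mod int d = 0 \<and> (\<exists>b\<in>{0..<int d}. a = (int (p ^ k) * b) mod int d)} = {0}"
    (is "?L = _")
  proof (intro equalityI subsetI)
    fix a assume a: "a \<in> ?L"
    then obtain b where b: "a = (int (p ^ k) * b) mod int d" by auto
    define v c where "v = multiplicity p d" and "c = d div p ^ v"
    have d_eq: "d = p ^ v * c" by (simp add: c_def v_def multiplicity_dvd)
    have "\<not> p dvd c" unfolding c_def v_def by (rule multiplicity_decompose) (use d p in auto)
    hence "coprime p c" using prime_imp_coprime[OF p] by blast
    hence cop: "coprime (int c) (int p)" by (simp add: coprime_commute)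
    have "v \<le> k"
    proof (rule ccontr)
      assume "\<not> v \<le> k"
      hence "p ^ Suc k dvd d" unfolding v_def by (intro multiplicity_dvd') simp
      thus False using False by simp
    qed
    have "int d dvd int p * a" using a by auto
    hence "int c dvd int p * a" by (simp add: d_eq dvd_mult_right)
    hence "int c dvd a" using cop by (simp add: coprime_dvd_mult_right_iff)
    moreover have "int (p ^ v) dvd a"
    proof -
      have "int (p ^ v) dvd int (p ^ k) * b" using \<open>v \<le> k\<close> by (simp add: le_imp_power_dvd)
      moreover have "int (p ^ v) dvd int d" by (simp add: d_eq)
      ultimately show ?thesis unfolding b by (rule dvd_mod)
    qed
    moreover have "coprime (int (p ^ v)) (int c)" using cop by (simp add: coprime_commute)
    ultimately have "int d dvd a" by (simp add: d_eq divides_mult)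
    moreover have "0 \<le> a" "a < int d" using a by auto
    ultimately show "a \<in> {0}" using zdvd_not_zless[of a "int d"] by fastforce
  qed (use d in \<open>auto intro!: bexI[of _ 0]\<close>)
  thus ?thesis using False by simp
qed

lemma torsion_count_cyclic_sum:
  assumes d: "divisor_chain d" and p: "prime p"
  shows "torsion_count p k (cyclic_sum d) = p ^ card {i. p ^ Suc k dvd d i}"
proof -
  obtain J where J: "\<And>i. i \<ge> J \<Longrightarrow> d i = 1" using divisor_chain_eventually_1[OF d] by blast
  have pos: "d i > 0" for i using d by (rule divisor_chain_pos)
  define A where "A = (\<lambda>i. {a \<in> {0..<int (d i)}. (int p * a) mod int (d i) = 0 \<and>
      (\<exists>b\<in>{0..<int (d i)}. a = (int (p ^ k) * b) mod int (d i))})"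
  have "{x \<in> carrier (cyclic_sum d). x [^]\<^bsub>cyclic_sum d\<^esub> p = \<one>\<^bsub>cyclic_sum d\<^esub> \<and>
      (\<exists>y\<in>carrier (cyclic_sum d). x = y [^]\<^bsub>cyclic_sum d\<^esub> (p ^ k))} = {f. \<forall>i. f i \<in> A i}" (is "?L = ?R")
  proof (intro equalityI subsetI)
    fix x assume "x \<in> ?L"
    thus "x \<in> ?R" unfolding nat_pow_cyclic_sum by (auto simp: A_def cyclic_sum_def fun_eq_iff)
  next
    fix x assume x: "x \<in> ?R"
    hence "\<forall>i. \<exists>b. b \<in> {0..<int (d i)} \<and> x i = (int (p ^ k) * b) mod int (d i)"
      unfolding A_def by blast
    then obtain y where "\<forall>i. y i \<in> {0..<int (d i)} \<and> x i = (int (p ^ k) * y i) mod int (d i)" by metis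
    hence "y \<in> carrier (cyclic_sum d)" "x = y [^]\<^bsub>cyclic_sum d\<^esub> (p ^ k)"
      unfolding nat_pow_cyclic_sum by (auto simp: cyclic_sum_def)
    moreover have "x \<in> carrier (cyclic_sum d)" "x [^]\<^bsub>cyclic_sum d\<^esub> p = \<one>\<^bsub>cyclic_sum d\<^esub>"
      unfolding nat_pow_cyclic_sum using x by (auto simp: A_def cyclic_sum_def)
    ultimately show "x \<in> ?L" by blast
  qed
  moreover have "A i = {0}" if "i \<ge> J" for i using J[OF that] by (auto simp: A_def)
  hence "card {f. \<forall>i. f i \<in> A i} = (\<Prod>i<J. card (A i))"
    by (intro card_Pi_eventually_singleton) (auto simp: A_def)
  moreover have "(\<Prod>i<J. card (A i)) = (\<Prod>i<J. if p ^ Suc k dvd d i then p else 1)"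
    unfolding A_def by (intro prod.cong refl card_torsion_mod p pos)
  moreover have "\<dots> = p ^ card {i \<in> {..<J}. p ^ Suc k dvd d i}"
    by (simp add: prod.If_cases Int_def)
  moreover have "{i \<in> {..<J}. p ^ Suc k dvd d i} = {i. p ^ Suc k dvd d i}"
  proof (intro equalityI subsetI)
    fix i assume i: "i \<in> {i. p ^ Suc k dvd d i}"
    have "p ^ Suc k > 1" using prime_gt_1_nat[OF p] by (rule one_less_power) simp
    hence "d i \<noteq> 1" using i by auto
    hence "i < J" using J[of i] not_le by blast
    thus "i \<in> {i \<in> {..<J}. p ^ Suc k dvd d i}" using i by simp
  qed auto
  ultimately show ?thesis by (simp add: torsion_count_def)
qed

lemma torsion_count_mono:
  assumes inj: "inj_on h (carrier H)" and h: "h \<in> hom H G" and "group H" "group G" "finite (carrier G)"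
  shows "torsion_count p k H \<le> torsion_count p k G"
proof -
  interpret group_hom H G h using assms by (simp add: group_hom_def group_hom_axioms_def)
  let ?S = "\<lambda>G. {x \<in> carrier G. x [^]\<^bsub>G\<^esub> p = \<one>\<^bsub>G\<^esub> \<and> (\<exists>y\<in>carrier G. x = y [^]\<^bsub>G\<^esub> (p ^ k))}"
  have "h ` ?S H \<subseteq> ?S G"
  proof safe
    fix y assume y: "y \<in> carrier H" "(y [^]\<^bsub>H\<^esub> (p ^ k)) [^]\<^bsub>H\<^esub> p = \<one>\<^bsub>H\<^esub>"
    show "h (y [^]\<^bsub>H\<^esub> (p ^ k)) [^]\<^bsub>G\<^esub> p = \<one>\<^bsub>G\<^esub>"
      using y hom_nat_pow[of "y [^]\<^bsub>H\<^esub> (p ^ k)" p] by simp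
    show "\<exists>z\<in>carrier G. h (y [^]\<^bsub>H\<^esub> (p ^ k)) = z [^]\<^bsub>G\<^esub> (p ^ k)"
      using y by (intro bexI[of _ "h y"]) (auto simp: hom_nat_pow)
  qed auto
  moreover have "inj_on h (?S H)" using inj by (rule inj_on_subset) auto
  ultimately have "card (?S H) \<le> card (?S G)" using assms(5) by (intro card_inj_on_le[of h]) auto
  thus ?thesis by (simp add: torsion_count_def)
qed

text \<open>Divisibility by \<open>m\<close> passes from an entry to all earlier ones, so the
  entries divisible by \<open>m\<close> form an initial segment, determined by its length.\<close>

lemma divisor_chain_prefix:
  assumes "divisor_chain d" "m > 1" 
  shows "finite {i. m dvd d i}" "m dvd d j \<longleftrightarrow> j < card {i. m dvd d i}"
proof -
  obtain J where J: "\<And>i. i \<ge> J \<Longrightarrow> d i = 1" using divisor_chain_eventually_1[OF assms(1)] by blast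
  have sub: "{i. m dvd d i} \<subseteq> {..<J}"
  proof safe
    fix i assume "m dvd d i"
    hence "d i \<noteq> 1" using assms(2) by auto
    thus "i < J" using J[of i] not_le by blast
  qed
  thus fin: "finite {i. m dvd d i}" using finite_subset by blast
  have down: "m dvd d i" if "i \<le> j" "m dvd d j" for i j
    using divisor_chain_dvd[OF assms(1) that(1)] that(2) dvd_trans by blast
  define n where "n = (LEAST n. \<not> m dvd d n)"
  have ex: "\<not> m dvd d J" using J[of J] assms(2) by simp
  have n: "\<not> m dvd d n" unfolding n_def by (rule LeastI[of _ J], rule ex)
  have iff: "m dvd d i \<longleftrightarrow> i < n" for i
  proof
    show "i < n" if "m dvd d i" using that n down[of n i] not_less by blast
    show "m dvd d i" if "i < n" using not_less_Least[of i "\<lambda>n. \<not> m dvd d n"] that unfolding n_def by blast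
  qed
  hence "{i. m dvd d i} = {..<n}" by auto
  thus "m dvd d j \<longleftrightarrow> j < card {i. m dvd d i}" by (metis card_lessThan lessThan_iff mem_Collect_eq)
qed

text \<open>With \<open>p ^ Suc k\<close> the exact p-part of \<open>e j\<close>, the entries
  \<open>e 0\<close> to \<open>e j\<close> are all divisible by it. The torsion count carries this
  number over to \<open>d\<close>, whose entries divisible by \<open>p ^ Suc k\<close> form an
  initial segment and hence include \<open>d j\<close>.\<close>

lemma embedding_imp_dvd:
  assumes d: "divisor_chain d" and e: "divisor_chain e"
    and h: "h \<in> hom (cyclic_sum e) (cyclic_sum d)" "inj_on h (carrier (cyclic_sum e))"
  shows "e j dvd d j"
proof (rule multiplicity_le_imp_dvd)
  show "e j \<noteq> 0" using divisor_chain_pos[OF e, of j] by simp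
  fix p :: nat assume p: "prime p"
  show "multiplicity p (e j) \<le> multiplicity p (d j)"
  proof (cases "multiplicity p (e j)")
    case (Suc k)
    have "torsion_count p k (cyclic_sum e) \<le> torsion_count p k (cyclic_sum d)"
      using h d e card_cyclic_sum(1)[OF d] comm_group_cyclic_sum divisor_chain_pos
      by (intro torsion_count_mono[of h]) (auto simp: comm_group_def)
    hence "p ^ card {i. p ^ Suc k dvd e i} \<le> p ^ card {i. p ^ Suc k dvd d i}"
      by (simp only: torsion_count_cyclic_sum[OF d p] torsion_count_cyclic_sum[OF e p])
    hence le: "card {i. p ^ Suc k dvd e i} \<le> card {i. p ^ Suc k dvd d i}"
      by (rule power_le_imp_le_exp[OF prime_gt_1_nat[OF p]])
    have gt: "p ^ Suc k > 1" using prime_gt_1_nat[OF p] by (rule one_less_power) simp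
    have "p ^ Suc k dvd e j" unfolding Suc[symmetric] by (rule multiplicity_dvd)
    hence "j < card {i. p ^ Suc k dvd e i}" using divisor_chain_prefix(2)[OF e gt] by blast
    hence "j < card {i. p ^ Suc k dvd d i}" using le by linarith
    hence "p ^ Suc k dvd d j" using divisor_chain_prefix(2)[OF d gt] by blast
    moreover have "d j \<noteq> 0" using divisor_chain_pos[OF d, of j] by simp
    ultimately show ?thesis unfolding Suc using p by (intro multiplicity_geI) auto
  qed simp
qed

lemma dvd_imp_embedding:
  assumes d: "divisor_chain d" and e: "divisor_chain e" and dvd: "\<And>j. e j dvd d j"
  obtains h where "h \<in> hom (cyclic_sum e) (cyclic_sum d)" "inj_on h (carrier (cyclic_sum e))"
proof -
  define c where "c = (\<lambda>j. d j div e j)"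
  have dc: "d j = e j * c j" for j using dvd by (simp add: c_def)
  have pos: "e j > 0" "c j > 0" for j
    using divisor_chain_pos[OF d, of j] divisor_chain_pos[OF e, of j] by (auto simp: dc)
  define h where "h = (\<lambda>x j. x j * int (c j))"
  have "h \<in> hom (cyclic_sum e) (cyclic_sum d)"
  proof (rule homI)
    fix x assume x: "x \<in> carrier (cyclic_sum e)"
    have "0 \<le> x j * int (c j) \<and> x j * int (c j) < int (d j)" for j
      using x pos(2)[of j] unfolding dc by (simp add: cyclic_sum_def)
    thus "h x \<in> carrier (cyclic_sum d)" by (simp add: h_def cyclic_sum_def)
  next
    fix x y
    have "(x j + y j) mod int (e j) * int (c j) = (x j * int (c j) + y j * int (c j)) mod int (d j)" for j
      unfolding dc of_nat_mult mod_mult_mult2 distrib_right[symmetric] by simp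
    thus "h (x \<otimes>\<^bsub>cyclic_sum e\<^esub> y) = h x \<otimes>\<^bsub>cyclic_sum d\<^esub> h y" by (simp add: h_def cyclic_sum_def)
  qed
  moreover have "inj_on h (carrier (cyclic_sum e))"
  proof (rule inj_onI, rule ext)
    fix x y j assume "h x = h y"
    hence "x j * int (c j) = y j * int (c j)" by (auto simp: h_def dest: fun_cong)
    thus "x j = y j" using pos(2)[of j] by simp
  qed
  ultimately show ?thesis by (rule that)
qed

section \<open>Decomposition of finite abelian groups into cyclic groups\<close>

lemma (in group) int_pow_mod_ord:
  assumes "x \<in> carrier G" shows "x [^] (a mod int (ord x)) = x [^] a"
proof -
  have "x [^] a = x [^] (int (ord x) * (a div int (ord x)) + a mod int (ord x))" by simp
  also have "\<dots> = (x [^] ord x) [^] (a div int (ord x)) \<otimes> x [^] (a mod int (ord x))"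
    using assms by (simp only: int_pow_mult int_pow_pow[symmetric] int_pow_int)
  finally show ?thesis using assms by simp
qed

lemma (in comm_group) subgroup_is_comm_group:
  assumes K: "subgroup K G" shows "comm_group (G\<lparr>carrier := K\<rparr>)"
  by (rule group.group_comm_groupI[OF subgroup.subgroup_is_group[OF K is_group]])
     (use subgroup.mem_carrier[OF K] in \<open>auto intro: m_comm\<close>)

text \<open>An element \<open>x\<close> of maximal order splits off as a cyclic direct factor, and
  the complement decomposes by \<open>IH\<close>. As every order divides \<open>ord x\<close>, so
  does the first invariant factor of the complement, and \<open>ord x\<close> can be put in front of
  the chain.\<close>

lemma (in comm_group) cyclic_sum_decomposition_step:
  assumes fin: "finite (carrier G)"
    and IH: "\<And>K. subgroup K G \<Longrightarrow> card K < card (carrier G) \<Longrightarrow>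
               \<exists>d. divisor_chain d \<and> cyclic_sum d \<cong> G\<lparr>carrier := K\<rparr>"
  shows "\<exists>d. divisor_chain d \<and> cyclic_sum d \<cong> G"
proof -
  define m where "m = Max (ord ` carrier G)"
  have "m \<in> ord ` carrier G" unfolding m_def using fin one_closed by (intro Max_in) auto
  then obtain x where x: "x \<in> carrier G" "ord x = m" by auto
  have max: "ord z \<le> ord x" if "z \<in> carrier G" for z
    unfolding x(2) m_def using fin that by (intro Max_ge) auto
  have exp: "y [^] ord x = \<one>" if y: "y \<in> carrier G" for y
  proof -
    have "ord y dvd ord x"
      by (rule ord_dvd_max_ord[OF fin x(1)]) (fact max, rule y)
    thus ?thesis by (simp only: pow_eq_id[OF y])
  qed
  define C where "C = range (\<lambda>i::int. x [^] i)"
  obtain K where K: "subgroup K G" "K \<inter> C = {\<one>}" "K <#> C = carrier G"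
    using complement_of_max_ord[OF fin x(1) exp] unfolding C_def by blast
  define e where "e = ord x"
  have e0: "e > 0" using ord_ge_1[OF fin x(1)] by (simp add: e_def)
  show ?thesis
  proof (cases "carrier G = {\<one>}")
    case True
    have "f = (\<lambda>_. 0)" if "f \<in> carrier (cyclic_sum (\<lambda>_. 1))" for f
    proof
      fix i
      have "0 \<le> f i \<and> f i < 1" using that by (simp add: cyclic_sum_def)
      thus "f i = 0" by linarith
    qed
    hence "carrier (cyclic_sum (\<lambda>_. 1)) = {\<lambda>_. 0}" by (auto simp: cyclic_sum_def)
    hence "(\<lambda>_. \<one>) \<in> iso (cyclic_sum (\<lambda>_. 1)) G"
      using True by (auto simp: iso_def hom_def bij_betw_def)
    moreover have "divisor_chain (\<lambda>_. 1)" by (simp add: divisor_chain_def)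
    ultimately show ?thesis unfolding is_iso_def by blast
  next
    case False
    then obtain z where z: "z \<in> carrier G" "z \<noteq> \<one>" using one_closed by blast
    have "x \<noteq> \<one>"
    proof
      assume "x = \<one>"
      thus False using exp[OF z(1)] z by simp
    qed
    moreover have "x \<in> C" unfolding C_def using x(1) by (metis int_pow_1 rangeI)
    ultimately have "x \<notin> K" using K(2) by blast
    hence "K \<subset> carrier G" using subgroup.subset[OF K(1)] x(1) by blast
    hence "card K < card (carrier G)" by (rule psubset_card_mono[OF fin])
    then obtain d' where d': "divisor_chain d'" "cyclic_sum d' \<cong> G\<lparr>carrier := K\<rparr>"
      using IH[OF K(1)] by blast
    have Kcomm: "comm_group (G\<lparr>carrier := K\<rparr>)" by (rule subgroup_is_comm_group[OF K(1)])
    from d'(2) obtain \<psi> where \<psi>: "\<psi> \<in> iso (cyclic_sum d') (G\<lparr>carrier := K\<rparr>)" unfolding is_iso_def by blast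
    have \<psi>K: "\<psi> f \<in> K" if "f \<in> carrier (cyclic_sum d')" for f
      using \<psi> that unfolding iso_def hom_def by auto
    have \<psi>G: "\<psi> f \<in> carrier G" if "f \<in> carrier (cyclic_sum d')" for f
      using \<psi>K[OF that] subgroup.mem_carrier[OF K(1)] by blast
    have \<psi>m: "\<psi> (f \<otimes>\<^bsub>cyclic_sum d'\<^esub> g) = \<psi> f \<otimes> \<psi> g"
      if "f \<in> carrier (cyclic_sum d')" "g \<in> carrier (cyclic_sum d')" for f g
      using \<psi> that unfolding iso_def hom_def by auto
    have \<psi>bij: "bij_betw \<psi> (carrier (cyclic_sum d')) K" using \<psi> unfolding iso_def by auto
    have pos': "d' i > 0" for i using d'(1) by (rule divisor_chain_pos)
    have "d' 0 dvd e"
    proof -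
      \<comment> \<open>A generator of the first summand of the complement, whose
        \<open>e\<close>-th power is trivial. Reducing 1 modulo \<open>d' 0\<close> keeps it in the
        carrier also when \<open>d' 0 = 1\<close>.\<close>
      define u where "u = (\<lambda>i::nat. if i = 0 then 1 mod int (d' 0) else 0)"
      have u: "u \<in> carrier (cyclic_sum d')" using pos' by (auto simp: u_def cyclic_sum_def)
      interpret \<psi>: group_hom "cyclic_sum d'" "G\<lparr>carrier := K\<rparr>" \<psi>
        using \<psi> Kcomm comm_group_cyclic_sum[of d', OF pos']
        by (simp add: group_hom_def group_hom_axioms_def iso_def comm_group_def)
      have "\<psi> (u [^]\<^bsub>cyclic_sum d'\<^esub> e) = \<psi> u [^]\<^bsub>G\<lparr>carrier := K\<rparr>\<^esub> e" by (rule \<psi>.hom_nat_pow[OF u])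
      also have "\<dots> = \<psi> u [^] e" by (simp add: nat_pow_def)
      also have "\<dots> = \<one>" using exp[OF \<psi>G[OF u]] by (simp add: e_def)
      also have "\<dots> = \<psi> \<one>\<^bsub>cyclic_sum d'\<^esub>" using \<psi>.hom_one by simp
      finally have "u [^]\<^bsub>cyclic_sum d'\<^esub> e = \<one>\<^bsub>cyclic_sum d'\<^esub>"
        using \<psi>bij monoid.nat_pow_closed[OF \<psi>.G.is_monoid u] monoid.one_closed[OF \<psi>.G.is_monoid] unfolding bij_betw_def inj_on_def by blast
      hence "(int e * u 0) mod int (d' 0) = 0"
        unfolding nat_pow_cyclic_sum by (auto simp: cyclic_sum_def dest: fun_cong)
      hence "int e mod int (d' 0) = 0" by (simp add: u_def mod_mult_right_eq)
      thus ?thesis by presburger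
    qed
    define d where "d = case_nat e d'"
    have chain: "divisor_chain d"
    proof -
      have "{i. d i \<noteq> 1} \<subseteq> insert 0 (Suc ` {i. d' i \<noteq> 1})"
      proof
        fix i assume "i \<in> {i. d i \<noteq> 1}"
        thus "i \<in> insert 0 (Suc ` {i. d' i \<noteq> 1})" by (cases i) (auto simp: d_def)
      qed
      moreover have "finite {i. d' i \<noteq> 1}" using d'(1) by (simp add: divisor_chain_def)
      ultimately have "finite {i. d i \<noteq> 1}" by (meson finite_imageI finite_insert finite_subset)
      thus ?thesis using d'(1) e0 \<open>d' 0 dvd e\<close> by (auto simp: divisor_chain_def d_def split: nat.splits)
    qed
    define \<phi> where "\<phi> = (\<lambda>f. x [^] (f 0 :: int) \<otimes> \<psi> (\<lambda>i. f (Suc i)))"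
    have tl: "(\<lambda>i. f (Suc i)) \<in> carrier (cyclic_sum d')" if "f \<in> carrier (cyclic_sum d)" for f
      using that by (auto simp: cyclic_sum_def d_def dest: spec[of _ "Suc _"])
    have hd: "0 \<le> f 0 \<and> f 0 < int e" if "f \<in> carrier (cyclic_sum d)" for f
      using that by (auto simp: cyclic_sum_def d_def dest: spec[of _ 0])
    have "\<phi> \<in> hom (cyclic_sum d) G"
    proof (rule homI)
      show "\<phi> f \<in> carrier G" if "f \<in> carrier (cyclic_sum d)" for f
        using \<psi>G[OF tl[OF that]] x(1) by (simp add: \<phi>_def)
      fix f g assume fg: "f \<in> carrier (cyclic_sum d)" "g \<in> carrier (cyclic_sum d)"
      have 1: "(\<lambda>i. (f \<otimes>\<^bsub>cyclic_sum d\<^esub> g) (Suc i)) = (\<lambda>i. f (Suc i)) \<otimes>\<^bsub>cyclic_sum d'\<^esub> (\<lambda>i. g (Suc i))"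
        by (simp add: cyclic_sum_def d_def)
      have 2: "x [^] ((f \<otimes>\<^bsub>cyclic_sum d\<^esub> g) 0) = x [^] f 0 \<otimes> x [^] g 0"
        using int_pow_mod_ord[OF x(1), of "f 0 + g 0"] x(1)
        by (simp add: cyclic_sum_def d_def e_def int_pow_mult)
      show "\<phi> (f \<otimes>\<^bsub>cyclic_sum d\<^esub> g) = \<phi> f \<otimes> \<phi> g"
        unfolding \<phi>_def 1 2 \<psi>m[OF tl[OF fg(1)] tl[OF fg(2)]]
        using x(1) \<psi>G[OF tl[OF fg(1)]] \<psi>G[OF tl[OF fg(2)]] by (simp add: m_ac)
    qed
    moreover have "inj_on \<phi> (carrier (cyclic_sum d))"
    proof (rule inj_onI)
      fix f g assume f: "f \<in> carrier (cyclic_sum d)" and g: "g \<in> carrier (cyclic_sum d)" and eq: "\<phi> f = \<phi> g"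
      note F = \<psi>G[OF tl[OF f]] and G = \<psi>G[OF tl[OF g]]
      have "x [^] (f 0 - g 0) = inv (\<psi> (\<lambda>i. f (Suc i))) \<otimes> \<psi> (\<lambda>i. g (Suc i))"
      proof -
        have "x [^] f 0 = x [^] g 0 \<otimes> \<psi> (\<lambda>i. g (Suc i)) \<otimes> inv (\<psi> (\<lambda>i. f (Suc i)))"
          using eq F G x(1) unfolding \<phi>_def by (metis inv_solve_right int_pow_closed m_closed)
        hence 1: "x [^] f 0 = x [^] g 0 \<otimes> (inv (\<psi> (\<lambda>i. f (Suc i))) \<otimes> \<psi> (\<lambda>i. g (Suc i)))"
          using F G x(1) by (simp add: m_ac)
        have "x [^] (f 0 - g 0) = inv (x [^] g 0) \<otimes> x [^] f 0"
          using x(1) by (simp add: int_pow_diff m_comm)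
        also have "\<dots> = inv (\<psi> (\<lambda>i. f (Suc i))) \<otimes> \<psi> (\<lambda>i. g (Suc i))"
          unfolding 1 using F G x(1) by (simp add: m_assoc[symmetric])
        finally show ?thesis .
      qed
      also have "\<dots> \<in> K" using \<psi>K[OF tl[OF f]] \<psi>K[OF tl[OF g]] K(1)
        by (simp add: subgroup.m_closed subgroup.m_inv_closed)
      finally have "x [^] (f 0 - g 0) \<in> K \<inter> C" by (auto simp: C_def)
      hence "x [^] (f 0 - g 0) = \<one>" using K(2) by blast
      hence "int e dvd f 0 - g 0" using x(1) by (simp add: int_pow_eq_id e_def)
      hence 0: "f 0 = g 0" using hd[OF f] hd[OF g] by (metis mod_eq_dvd_iff mod_pos_pos_trivial)
      hence "\<psi> (\<lambda>i. f (Suc i)) = \<psi> (\<lambda>i. g (Suc i))"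
        using eq F G x(1) unfolding \<phi>_def by simp
      hence "(\<lambda>i. f (Suc i)) = (\<lambda>i. g (Suc i))"
        using \<psi>bij tl[OF f] tl[OF g] unfolding bij_betw_def inj_on_def by blast
      hence "f (Suc i) = g (Suc i)" for i by (rule fun_cong)
      thus "f = g" using 0 by (metis (no_types) ext not0_implies_Suc)
    qed
    moreover have "carrier G \<subseteq> \<phi> ` carrier (cyclic_sum d)"
    proof
      fix w assume "w \<in> carrier G"
      then obtain k i where ki: "k \<in> K" "w = k \<otimes> x [^] (i::int)"
        using K(3) unfolding set_mult_def C_def by blast
      obtain f' where f': "f' \<in> carrier (cyclic_sum d')" "\<psi> f' = k"
        using \<psi>bij ki(1) unfolding bij_betw_def by blast
      define f where "f = case_nat (i mod int e) f'"
      have "f \<in> carrier (cyclic_sum d)"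
        using f'(1) e0 by (auto simp: f_def d_def cyclic_sum_def split: nat.splits)
      moreover have "\<phi> f = w"
        using int_pow_mod_ord[OF x(1)] f'(2) x(1) ki subgroup.mem_carrier[OF K(1)]
        by (simp add: \<phi>_def f_def e_def m_comm)
      ultimately show "w \<in> \<phi> ` carrier (cyclic_sum d)" by blast
    qed
    ultimately have "\<phi> \<in> iso (cyclic_sum d) G" by (auto simp: iso_def bij_betw_def hom_def)
    thus ?thesis using chain unfolding is_iso_def by blast
  qed
qed

lemma cyclic_sum_decomposition:
  assumes "comm_group G" "finite (carrier G)"
  shows "\<exists>d. divisor_chain d \<and> cyclic_sum d \<cong> G"
  using assms
proof (induction "card (carrier G)" arbitrary: G rule: less_induct)
  case less
  show ?case
  proof (rule comm_group.cyclic_sum_decomposition_step[OF less.prems])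
    fix K assume K: "subgroup K G" "card K < card (carrier G)"
    have "comm_group (G\<lparr>carrier := K\<rparr>)" by (rule comm_group.subgroup_is_comm_group[OF less.prems(1) K(1)])
    moreover have "finite K" using subgroup.subset[OF K(1)] less.prems(2) by (rule finite_subset)
    ultimately show "\<exists>d. divisor_chain d \<and> cyclic_sum d \<cong> G\<lparr>carrier := K\<rparr>"
      using less.hyps[of "G\<lparr>carrier := K\<rparr>"] K(2) by simp
  qed
qed

lemma group_cyclic_sum: "divisor_chain d \<Longrightarrow> group (cyclic_sum d)"
  using comm_group_cyclic_sum[of d] divisor_chain_pos by (auto simp: comm_group_def)

lemma cyclic_sum_iso_imp_eq:
  assumes d: "divisor_chain d" and e: "divisor_chain e" and iso: "cyclic_sum d \<cong> cyclic_sum e"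
  shows "d = e"
proof
  fix j
  have *: "b j dvd a j" if "divisor_chain a" "divisor_chain b" "cyclic_sum b \<cong> cyclic_sum a" for a b
    using that embedding_imp_dvd[OF that(1,2)] unfolding is_iso_def iso_def bij_betw_def by blast
  have "cyclic_sum e \<cong> cyclic_sum d" by (rule group.iso_sym[OF group_cyclic_sum[OF d] iso])
  thus "d j = e j" using *[OF d e] *[OF e d iso] by (simp add: dvd_antisym)
qed

section \<open>Counting isomorphism classes by invariant factors\<close>

lemma ex_nat_copy_cyclic_sum:
  assumes d: "divisor_chain d"
  obtains H :: "nat monoid" where "comm_group H" "H \<cong> cyclic_sum d"
proof -
  obtain f :: "(nat \<Rightarrow> int) \<Rightarrow> nat" where f: "inj_on f (carrier (cyclic_sum d))"
    using finite_imp_inj_to_nat_seg[OF card_cyclic_sum(1)[OF d]] by blast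
  define g where "g = inv_into (carrier (cyclic_sum d)) f"
  define H where "H = \<lparr>carrier = f ` carrier (cyclic_sum d),
    monoid.mult = (\<lambda>a b. f (g a \<otimes>\<^bsub>cyclic_sum d\<^esub> g b)), one = f \<one>\<^bsub>cyclic_sum d\<^esub>\<rparr>"
  interpret D: comm_group "cyclic_sum d" by (rule comm_group_cyclic_sum) (rule divisor_chain_pos[OF d])
  have gf: "g (f a) = a" if "a \<in> carrier (cyclic_sum d)" for a
    unfolding g_def by (rule inv_into_f_f[OF f that])
  have fH: "f \<in> iso (cyclic_sum d) H"
    using f by (auto simp: iso_def hom_def bij_betw_def H_def gf)
  have "comm_group (H\<lparr>one := f \<one>\<^bsub>cyclic_sum d\<^esub>\<rparr>)"
    by (rule D.iso_imp_img_comm_group[OF fH])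
  hence "comm_group H" by (simp add: H_def)
  moreover have "H \<cong> cyclic_sum d"
    using D.iso_sym fH unfolding is_iso_def by blast
  ultimately show ?thesis by (rule that)
qed

text \<open>Serves both counts: with \<open>X\<close> the abelian groups of a given order, and with
  \<open>X\<close> the groups isomorphic to a subgroup of a fixed group. Distinct chains give
  distinct classes because isomorphic sums of cyclic groups have the same chain.\<close>

lemma iso_classes_bij:
  assumes D: "\<And>d. d \<in> D \<Longrightarrow> divisor_chain d"
    and X: "\<And>H. H \<in> X \<Longrightarrow> group H" "\<And>H. H \<in> X \<Longrightarrow> \<exists>d\<in>D. H \<cong> cyclic_sum d"
    and ex: "\<And>d. d \<in> D \<Longrightarrow> \<exists>H\<in>X. H \<cong> cyclic_sum d"
  shows "bij_betw (\<lambda>d. {H \<in> X. H \<cong> cyclic_sum d}) D (iso_classes X)"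
proof -
  let ?R = "{(G, H). G \<in> X \<and> H \<in> X \<and> G \<cong> H}"
  have class_eq: "?R `` {H} = {H' \<in> X. H' \<cong> cyclic_sum d}" if "H \<in> X" "H \<cong> cyclic_sum d" for H d
  proof -
    have "H \<cong> H' \<longleftrightarrow> H' \<cong> cyclic_sum d" if "H' \<in> X" for H'
    proof
      assume "H \<cong> H'"
      hence "H' \<cong> H" by (rule group.iso_sym[OF X(1)[OF \<open>H \<in> X\<close>]])
      thus "H' \<cong> cyclic_sum d" using \<open>H \<cong> cyclic_sum d\<close> by (rule iso_trans)
    next
      assume "H' \<cong> cyclic_sum d"
      hence "cyclic_sum d \<cong> H'" by (rule group.iso_sym[OF X(1)[OF \<open>H' \<in> X\<close>]])
      thus "H \<cong> H'" by (rule iso_trans[OF \<open>H \<cong> cyclic_sum d\<close>])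
    qed
    thus ?thesis using that by auto
  qed
  show ?thesis unfolding bij_betw_def
  proof
    show "inj_on (\<lambda>d. {H \<in> X. H \<cong> cyclic_sum d}) D"
    proof (rule inj_onI)
      fix d e assume de: "d \<in> D" "e \<in> D" "{H \<in> X. H \<cong> cyclic_sum d} = {H \<in> X. H \<cong> cyclic_sum e}"
      obtain H where H: "H \<in> X" "H \<cong> cyclic_sum d" using ex[OF de(1)] by blast
      hence "H \<cong> cyclic_sum e" using de(3) by blast
      have "cyclic_sum d \<cong> H" by (rule group.iso_sym[OF X(1)[OF H(1)] H(2)])
      hence "cyclic_sum d \<cong> cyclic_sum e" by (rule iso_trans) (rule \<open>H \<cong> cyclic_sum e\<close>)
      thus "d = e" by (rule cyclic_sum_iso_imp_eq[OF D[OF de(1)] D[OF de(2)]])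
    qed
    show "(\<lambda>d. {H \<in> X. H \<cong> cyclic_sum d}) ` D = iso_classes X"
    proof (intro equalityI subsetI)
      fix S assume "S \<in> (\<lambda>d. {H \<in> X. H \<cong> cyclic_sum d}) ` D"
      then obtain d where d: "d \<in> D" "S = {H \<in> X. H \<cong> cyclic_sum d}" by blast
      then obtain H where H: "H \<in> X" "H \<cong> cyclic_sum d" using ex by blast
      show "S \<in> iso_classes X" unfolding iso_classes_def d(2) class_eq[OF H, symmetric] using H(1) by (rule quotientI)
    next
      fix S assume "S \<in> iso_classes X"
      then obtain H where H: "H \<in> X" "S = ?R `` {H}" unfolding iso_classes_def by (rule quotientE)
      then obtain d where "d \<in> D" "H \<cong> cyclic_sum d" using X(2) by blast
      thus "S \<in> (\<lambda>d. {H \<in> X. H \<cong> cyclic_sum d}) ` D" using class_eq[OF H(1)] H(2) by blast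
    qed
  qed
qed

text \<open>A group with invariant factors \<open>e\<close> embeds into \<open>G\<close> exactly if
  \<open>e j\<close> divides \<open>d j\<close> for all \<open>j\<close>: necessity by torsion
  counts, sufficiency by multiplying each coordinate by \<open>d j div e j\<close>.\<close>

lemma num_subgroup_classes_cyclic_sum:
  fixes G :: "nat monoid"
  assumes G: "comm_group G" and d: "divisor_chain d" and iso: "G \<cong> cyclic_sum d"
  shows "num_subgroup_classes G = card {e. divisor_chain e \<and> (\<forall>j. e j dvd d j)}"
proof -
  interpret G: comm_group G by (rule G)
  interpret D: group "cyclic_sum d" by (rule group_cyclic_sum[OF d])
  obtain \<phi> where \<phi>: "\<phi> \<in> iso G (cyclic_sum d)" using iso unfolding is_iso_def by blast
  obtain \<psi> where \<psi>: "\<psi> \<in> iso (cyclic_sum d) G" using G.iso_sym[OF iso] unfolding is_iso_def by blast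
  have finG: "finite (carrier G)"
    using \<phi> card_cyclic_sum(1)[OF d] bij_betw_finite unfolding iso_def by auto
  let ?X = "{H :: nat monoid. group H \<and> (\<exists>K. subgroup K G \<and> H \<cong> G\<lparr>carrier := K\<rparr>)}"
  have "bij_betw (\<lambda>e. {H \<in> ?X. H \<cong> cyclic_sum e}) {e. divisor_chain e \<and> (\<forall>j. e j dvd d j)} (iso_classes ?X)"
  proof (rule iso_classes_bij)
    fix H assume "H \<in> ?X"
    then obtain K where H: "group H" and K: "subgroup K G" "H \<cong> G\<lparr>carrier := K\<rparr>" by blast
    have "finite K" using subgroup.subset[OF K(1)] finG by (rule finite_subset)
    hence "\<exists>e. divisor_chain e \<and> cyclic_sum e \<cong> G\<lparr>carrier := K\<rparr>"
      by (intro cyclic_sum_decomposition G.subgroup_is_comm_group[OF K(1)]) simp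
    then obtain e where e: "divisor_chain e" "cyclic_sum e \<cong> G\<lparr>carrier := K\<rparr>" by blast
    obtain h where h: "h \<in> iso (cyclic_sum e) (G\<lparr>carrier := K\<rparr>)" using e(2) unfolding is_iso_def by blast
    have "e j dvd d j" for j
    proof (rule embedding_imp_dvd[OF d e(1)])
      have hK: "h f \<in> K" if "f \<in> carrier (cyclic_sum e)" for f using h that unfolding iso_def hom_def by auto
      have sub: "K \<subseteq> carrier G" by (rule subgroup.subset[OF K(1)])
      show "\<phi> \<circ> h \<in> hom (cyclic_sum e) (cyclic_sum d)"
        using h \<phi> sub unfolding iso_def hom_def by (auto simp: Pi_iff subset_iff)
      have "inj_on h (carrier (cyclic_sum e))" using h unfolding iso_def bij_betw_def by auto
      moreover have "inj_on \<phi> (h ` carrier (cyclic_sum e))"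
        using \<phi> hK sub unfolding iso_def bij_betw_def by (auto intro: inj_on_subset)
      ultimately show "inj_on (\<phi> \<circ> h) (carrier (cyclic_sum e))" by (rule comp_inj_on)
    qed
    moreover have "G\<lparr>carrier := K\<rparr> \<cong> cyclic_sum e" by (rule group.iso_sym[OF group_cyclic_sum[OF e(1)] e(2)])
    hence "H \<cong> cyclic_sum e" by (rule iso_trans[OF K(2)])
    ultimately show "\<exists>e\<in>{e. divisor_chain e \<and> (\<forall>j. e j dvd d j)}. H \<cong> cyclic_sum e" using e(1) by blast
  next
    fix e assume "e \<in> {e. divisor_chain e \<and> (\<forall>j. e j dvd d j)}"
    hence e: "divisor_chain e" "\<And>j. e j dvd d j" by auto
    interpret E: group "cyclic_sum e" by (rule group_cyclic_sum[OF e(1)])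
    obtain H :: "nat monoid" where H: "comm_group H" "H \<cong> cyclic_sum e" using ex_nat_copy_cyclic_sum[OF e(1)] .
    obtain h where h: "h \<in> hom (cyclic_sum e) (cyclic_sum d)" "inj_on h (carrier (cyclic_sum e))"
      using dvd_imp_embedding[OF d e] .
    define k where "k = \<psi> \<circ> h"
    have k: "k \<in> hom (cyclic_sum e) G"
      using h(1) \<psi> unfolding k_def iso_def by (auto intro: hom_compose)
    have hd: "h ` carrier (cyclic_sum e) \<subseteq> carrier (cyclic_sum d)" using h(1) unfolding hom_def by auto
    have ki: "inj_on k (carrier (cyclic_sum e))"
      unfolding k_def using \<psi> hd unfolding iso_def bij_betw_def by (intro comp_inj_on h(2)) (auto intro: inj_on_subset)
    interpret k: group_hom "cyclic_sum e" G k using k by (simp add: group_hom_def group_hom_axioms_def)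
    define K where "K = k ` carrier (cyclic_sum e)"
    have K: "subgroup K G" unfolding K_def by (rule k.img_is_subgroup)
    have "k \<in> iso (cyclic_sum e) (G\<lparr>carrier := K\<rparr>)"
      using ki k unfolding iso_def hom_def bij_betw_def K_def by auto
    hence "cyclic_sum e \<cong> G\<lparr>carrier := K\<rparr>" unfolding is_iso_def by blast
    hence "H \<cong> G\<lparr>carrier := K\<rparr>" by (rule iso_trans[OF H(2)])
    thus "\<exists>H\<in>?X. H \<cong> cyclic_sum e" using H K by (auto simp: comm_group_def)
  qed auto
  thus ?thesis unfolding num_subgroup_classes_def by (simp add: bij_betw_same_card)
qed

lemma finite_divisor_chains_dvd:
  assumes "divisor_chain d" shows "finite {e. divisor_chain e \<and> (\<forall>j. e j dvd d j)}"
proof -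
  obtain J where J: "\<And>i. i \<ge> J \<Longrightarrow> d i = 1" using divisor_chain_eventually_1[OF assms] by blast
  have "inj_on (\<lambda>e. restrict e {..<J}) {e. divisor_chain e \<and> (\<forall>j. e j dvd d j)}"
  proof (rule inj_onI, rule ext)
    fix e e' j assume *: "e \<in> {e. divisor_chain e \<and> (\<forall>j. e j dvd d j)}" "e' \<in> {e. divisor_chain e \<and> (\<forall>j. e j dvd d j)}"
      and eq: "restrict e {..<J} = restrict e' {..<J}"
    show "e j = e' j"
    proof (cases "j < J")
      case True thus ?thesis using fun_cong[OF eq, of j] by simp
    next
      case False
      hence "d j = 1" using J by simp
      moreover have "e j dvd d j" "e' j dvd d j" using * by auto
      ultimately show ?thesis by simp
    qed
  qed
  moreover have "(\<lambda>e. restrict e {..<J}) ` {e. divisor_chain e \<and> (\<forall>j. e j dvd d j)} \<subseteq> Pi\<^sub>E {..<J} (\<lambda>j. {..d j})"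
  proof (rule image_subsetI)
    fix e assume "e \<in> {e. divisor_chain e \<and> (\<forall>j. e j dvd d j)}"
    hence "e j \<le> d j" for j using divisor_chain_pos[OF assms, of j] by (auto intro: dvd_imp_le)
    thus "restrict e {..<J} \<in> Pi\<^sub>E {..<J} (\<lambda>j. {..d j})" by (intro restrict_PiE_iff[THEN iffD2]) auto
  qed
  moreover have "finite (Pi\<^sub>E {..<J} (\<lambda>j. {..d j}))" by (intro finite_PiE) auto
  ultimately show ?thesis using finite_imageD finite_subset by blast
qed

text \<open>Here \<open>d\<close> describes a group of order \<open>n\<close> and \<open>e\<close> a
  class of its subgroups.\<close>

definition chain_pairs :: "nat \<Rightarrow> ((nat \<Rightarrow> nat) \<times> (nat \<Rightarrow> nat)) set" where
  "chain_pairs n = {(d, e). divisor_chain d \<and> divisor_chain e \<and> (\<forall>j. e j dvd d j) \<and> (\<Prod>i | d i \<noteq> 1. d i) = n}"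

lemma finite_divisor_chains: "finite {d. divisor_chain d \<and> (\<Prod>i | d i \<noteq> 1. d i) = n}" (is "finite ?D")
proof (cases "n = 0")
  case True
  have "(\<Prod>i | d i \<noteq> 1. d i) \<noteq> 0" if "divisor_chain d" for d
    using that divisor_chain_pos[OF that] by (auto simp: divisor_chain_def)
  hence "?D = {}" using True by blast
  thus ?thesis by (simp only: finite.emptyI)
next
  case False
  have "?D \<subseteq> {d. \<forall>i. (i \<in> {..<n} \<longrightarrow> d i \<in> {..n}) \<and> (i \<notin> {..<n} \<longrightarrow> d i = 1)}"
  proof (intro subsetI CollectI allI)
    fix d i assume "d \<in> ?D"
    hence d: "divisor_chain d" and n: "n = (\<Prod>i | d i \<noteq> 1. d i)" by auto
    obtain J where J: "\<And>i. i \<ge> J \<Longrightarrow> d i = 1" using divisor_chain_eventually_1[OF d] by blast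
    have n': "n = (\<Prod>i<max J (Suc i). d i)"
      unfolding n by (rule prod_divisor_chain[symmetric]) (use J in auto)
    have "d i dvd n" unfolding n' by (rule dvd_prodI) auto
    hence "d i \<le> n" using False by (intro dvd_imp_le) auto
    \<comment> \<open>An entry other than 1 makes all earlier entries at least 2, so that
      \<open>n\<close> would be at least \<open>2 ^ Suc i\<close>.\<close>
    moreover have "d i = 1" if "n \<le> i"
    proof (rule ccontr)
      assume "d i \<noteq> 1"
      hence "d j \<ge> 2" if "j \<le> i" for j
        using divisor_chain_dvd[OF d that] divisor_chain_pos[OF d, of j] divisor_chain_pos[OF d, of i] by (auto dest!: dvd_imp_le)
      hence "(\<Prod>j<Suc i. 2) \<le> (\<Prod>j<Suc i. d j)" by (intro prod_mono) auto
      hence "2 ^ Suc i \<le> (\<Prod>j<Suc i. d j)" by simp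
      also have "\<dots> dvd n" unfolding n' by (rule prod_dvd_prod_subset) auto
      hence "(\<Prod>j<Suc i. d j) \<le> n" using False by (auto dest: dvd_imp_le)
      finally have "2 ^ Suc i \<le> n" .
      moreover have "Suc i < 2 ^ Suc i" by (rule less_exp)
      ultimately show False using \<open>n \<le> i\<close> by linarith
    qed
    ultimately show "(i \<in> {..<n} \<longrightarrow> d i \<in> {..n}) \<and> (i \<notin> {..<n} \<longrightarrow> d i = 1)" by auto
  qed
  moreover have "finite {d. \<forall>i. (i \<in> {..<n} \<longrightarrow> d i \<in> {..n}) \<and> (i \<notin> {..<n} \<longrightarrow> d i = 1)}"
    by (rule finite_set_of_finite_funs) auto
  ultimately show ?thesis by (rule finite_subset)
qed

lemma subgroup_class_sum_eq_card: "subgroup_class_sum n = card (chain_pairs n)"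
proof -
  let ?D = "{d. divisor_chain d \<and> (\<Prod>i | d i \<noteq> 1. d i) = n}"
  let ?X = "abelian_groups_of_order n"
  have bij: "bij_betw (\<lambda>d. {H \<in> ?X. H \<cong> cyclic_sum d}) ?D (iso_classes ?X)"
  proof (rule iso_classes_bij)
    fix H assume H: "H \<in> ?X"
    thus gr: "group H" by (auto simp: abelian_groups_of_order_def comm_group_def)
    obtain d where d: "divisor_chain d" "cyclic_sum d \<cong> H"
      using H cyclic_sum_decomposition[of H] by (auto simp: abelian_groups_of_order_def)
    have "card (carrier (cyclic_sum d)) = card (carrier H)" using d(2) by (rule iso_same_card)
    hence "order (cyclic_sum d) = n" using H by (simp add: order_def abelian_groups_of_order_def)
    hence "d \<in> ?D" using d(1) card_cyclic_sum(2)[OF d(1)] by simp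
    moreover have "H \<cong> cyclic_sum d" by (rule group.iso_sym[OF group_cyclic_sum[OF d(1)] d(2)])
    ultimately show "\<exists>d\<in>?D. H \<cong> cyclic_sum d" by blast
  next
    fix d assume "d \<in> ?D"
    hence d: "divisor_chain d" "(\<Prod>i | d i \<noteq> 1. d i) = n" by auto
    obtain H :: "nat monoid" where H: "comm_group H" "H \<cong> cyclic_sum d" using ex_nat_copy_cyclic_sum[OF d(1)] .
    have "card (carrier H) = n" using iso_same_card[OF H(2)] card_cyclic_sum(2)[OF d(1)] d(2) by (simp add: order_def)
    moreover have "finite (carrier H)"
      using H(2) card_cyclic_sum(1)[OF d(1)] bij_betw_finite unfolding is_iso_def iso_def by auto
    ultimately have "H \<in> ?X" using H by (simp add: abelian_groups_of_order_def order_def)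
    thus "\<exists>H\<in>?X. H \<cong> cyclic_sum d" using H(2) by blast
  qed auto
  have elem: "the_elem (num_subgroup_classes ` {H \<in> ?X. H \<cong> cyclic_sum d}) = card {e. divisor_chain e \<and> (\<forall>j. e j dvd d j)}"
    if d: "d \<in> ?D" for d
  proof -
    have "{H \<in> ?X. H \<cong> cyclic_sum d} \<in> iso_classes ?X" using bij d unfolding bij_betw_def by blast
    hence "{H \<in> ?X. H \<cong> cyclic_sum d} \<noteq> {}"
      unfolding iso_classes_def by (auto simp: quotient_def intro: iso_refl)
    moreover have "num_subgroup_classes H = card {e. divisor_chain e \<and> (\<forall>j. e j dvd d j)}"
      if "H \<in> {H \<in> ?X. H \<cong> cyclic_sum d}" for H
      using that d by (intro num_subgroup_classes_cyclic_sum) (auto simp: abelian_groups_of_order_def)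
    ultimately show ?thesis by (intro the_elem_image_unique) auto
  qed
  have "subgroup_class_sum n = (\<Sum>d\<in>?D. the_elem (num_subgroup_classes ` {H \<in> ?X. H \<cong> cyclic_sum d}))"
    unfolding subgroup_class_sum_def using sum.reindex_bij_betw[OF bij, symmetric] .
  also have "\<dots> = (\<Sum>d\<in>?D. card {e. divisor_chain e \<and> (\<forall>j. e j dvd d j)})"
    using elem by (intro sum.cong) auto
  also have "\<dots> = card (SIGMA d : ?D. {e. divisor_chain e \<and> (\<forall>j. e j dvd d j)})"
    using finite_divisor_chains[of n] finite_divisor_chains_dvd by (intro card_SigmaI[symmetric]) auto
  also have "(SIGMA d : ?D. {e. divisor_chain e \<and> (\<forall>j. e j dvd d j)}) = chain_pairs n"
    by (auto simp: chain_pairs_def)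
  finally show ?thesis .
qed

subsection \<open>Pairs of partitions\<close>

definition partition_pairs :: "nat \<Rightarrow> ((nat \<Rightarrow> nat) \<times> (nat \<Rightarrow> nat)) set" where
  "partition_pairs k = {(l, m). antimono l \<and> antimono m \<and> (\<forall>i. m i \<le> l i) \<and> finite {i. l i \<noteq> 0} \<and> (\<Sum>i | l i \<noteq> 0. l i) = k}"

definition num_partition_pairs :: "nat \<Rightarrow> nat" where
  "num_partition_pairs k = card (partition_pairs k)"

lemma sum_support:
  fixes l :: "nat \<Rightarrow> nat"
  assumes "\<And>i. i \<ge> J \<Longrightarrow> l i = 0" shows "finite {i. l i \<noteq> 0}" "(\<Sum>i | l i \<noteq> 0. l i) = (\<Sum>i<J. l i)"
proof -
  have sub: "{i. l i \<noteq> 0} \<subseteq> {..<J}"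
  proof
    fix i assume i: "i \<in> {i. l i \<noteq> 0}"
    show "i \<in> {..<J}" by (rule ccontr) (use assms[of i] i in \<open>simp add: not_less\<close>)
  qed
  thus "finite {i. l i \<noteq> 0}" by (rule finite_subset) simp
  show "(\<Sum>i | l i \<noteq> 0. l i) = (\<Sum>i<J. l i)" by (rule sum.mono_neutral_left[OF _ sub]) auto
qed

lemma support_bound:
  fixes l :: "nat \<Rightarrow> nat"
  assumes "finite {i. l i \<noteq> 0}" obtains J where "\<And>i. i \<ge> J \<Longrightarrow> l i = 0"
proof -
  obtain J where J: "\<forall>i\<in>{i. l i \<noteq> 0}. i < J" using assms unfolding finite_nat_set_iff_bounded by blast
  have "l i = 0" if "i \<ge> J" for i using J that not_less by blast
  thus ?thesis by (rule that)
qed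

lemma prod_prime_powers_eq:
  assumes "x > 0" "prime_factors x \<subseteq> P" "finite P" "\<And>p. p \<in> P \<Longrightarrow> prime p"
  shows "(\<Prod>p\<in>P. p ^ multiplicity p x) = (x :: nat)"
proof -
  have "x = (\<Prod>p\<in>prime_factors x. p ^ multiplicity p x)" using assms(1) by (rule prime_factorization_nat)
  also have "\<dots> = (\<Prod>p\<in>P. p ^ multiplicity p x)"
  proof (rule prod.mono_neutral_left[OF assms(3,2)], rule ballI)
    fix p assume "p \<in> P - prime_factors x"
    hence "\<not> p dvd x" using assms(1,4) by (auto simp: prime_factors_dvd)
    thus "p ^ multiplicity p x = 1" by (simp add: not_dvd_imp_multiplicity_0)
  qed
  finally show ?thesis by simp
qed

text \<open>Valuations at \<open>p\<close> turn a divisor chain into an antitone sequence and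
  divisibility into the order of sequences. The sequences at different primes are independent of
  each other, and the product of the \<open>d i\<close> prescribes their sums.\<close>

lemma card_chain_pairs:
  assumes n: "n > 0"
  shows "card (chain_pairs n) = (\<Prod>p\<in>prime_factors n. num_partition_pairs (multiplicity p n))"
proof -
  define P where "P = prime_factors n"
  have P: "finite P" "\<And>p. p \<in> P \<Longrightarrow> prime p" by (auto simp: P_def)
  define \<Phi> where "\<Phi> = (\<lambda>(d, e). \<lambda>p\<in>P. (\<lambda>i::nat. multiplicity p (d i :: nat), \<lambda>i::nat. multiplicity p (e i :: nat)))"
  define \<Psi> where "\<Psi> = (\<lambda>h. (\<lambda>i::nat. \<Prod>p\<in>P. p ^ fst (h p) i, \<lambda>i::nat. \<Prod>p\<in>P. p ^ snd (h p) i) :: (nat \<Rightarrow> nat) \<times> (nat \<Rightarrow> nat))"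
  have sub: "prime_factors (d i) \<subseteq> P" if d: "divisor_chain d" "(\<Prod>i | d i \<noteq> 1. d i) = n" for d i
  proof -
    obtain J where J: "\<And>i. i \<ge> J \<Longrightarrow> d i = 1" using divisor_chain_eventually_1[OF d(1)] by blast
    have "n = (\<Prod>i<max J (Suc i). d i)"
      unfolding d(2)[symmetric] by (rule prod_divisor_chain[symmetric]) (use J in auto)
    also have "d i dvd \<dots>" by (rule dvd_prodI) auto
    finally show ?thesis unfolding P_def using n by (intro dvd_prime_factors) auto
  qed
  have sub': "prime_factors (e i) \<subseteq> P"
    if "divisor_chain d" "(\<Prod>i | d i \<noteq> 1. d i) = n" "\<And>i. e i dvd d i" for d e i
    using sub[OF that(1,2), of i] dvd_prime_factors[OF _ that(3)[of i]] divisor_chain_pos[OF that(1), of i] by blast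
  have mult: "multiplicity p (\<Prod>q\<in>P. q ^ f q) = f p" if "p \<in> P" for p :: nat and f
    using multiplicity_prod_prime_powers[OF P(1), of p f] P(2) that by simp
  have "bij_betw \<Phi> (chain_pairs n) (Pi\<^sub>E P (\<lambda>p. partition_pairs (multiplicity p n)))"
  proof (rule bij_betwI[where g = \<Psi>])
    show "\<Phi> \<in> chain_pairs n \<rightarrow> Pi\<^sub>E P (\<lambda>p. partition_pairs (multiplicity p n))"
    proof (rule Pi_I)
      fix de assume "de \<in> chain_pairs n"
      then obtain d e where de: "de = (d, e)" "divisor_chain d" "divisor_chain e" "\<And>j. e j dvd d j" "(\<Prod>i | d i \<noteq> 1. d i) = n"
        unfolding chain_pairs_def by blast
      obtain J where J: "\<And>i. i \<ge> J \<Longrightarrow> d i = 1" using divisor_chain_eventually_1[OF de(2)] by blast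
      have nJ: "n = (\<Prod>i<J. d i)" unfolding de(5)[symmetric] by (rule prod_divisor_chain[symmetric]) (use J in auto)
      have pos: "d i \<noteq> 0" "e i \<noteq> 0" for i
        using divisor_chain_pos[OF de(2), of i] divisor_chain_pos[OF de(3), of i] by auto
      have "(\<lambda>i. multiplicity p (d i), \<lambda>i. multiplicity p (e i)) \<in> partition_pairs (multiplicity p n)" if p: "p \<in> P" for p
      proof -
        have J0: "multiplicity p (d i) = 0" if "i \<ge> J" for i using J[OF that] by simp
        have "0 \<notin> d ` {..<J}"
        proof
          assume "0 \<in> d ` {..<J}"
          then obtain i where "d i = 0" by auto
          thus False using pos(1)[of i] by simp
        qed
        hence "multiplicity p n = (\<Sum>i<J. multiplicity p (d i))"
          unfolding nJ using P(2)[OF p] by (intro prime_elem_multiplicity_prod_distrib) auto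
        moreover have "antimono (\<lambda>i. multiplicity p (d i))" "antimono (\<lambda>i. multiplicity p (e i))"
          using divisor_chain_dvd[OF de(2)] divisor_chain_dvd[OF de(3)] pos
          by (auto intro!: antimonoI dvd_imp_multiplicity_le)
        moreover have "multiplicity p (e i) \<le> multiplicity p (d i)" for i
          using de(4) pos by (intro dvd_imp_multiplicity_le)
        ultimately show ?thesis
          using sum_support[of J "\<lambda>i. multiplicity p (d i)", OF J0] by (simp add: partition_pairs_def)
      qed
      thus "\<Phi> de \<in> Pi\<^sub>E P (\<lambda>p. partition_pairs (multiplicity p n))" by (auto simp: \<Phi>_def de(1))
    qed
    show "\<Psi> \<in> Pi\<^sub>E P (\<lambda>p. partition_pairs (multiplicity p n)) \<rightarrow> chain_pairs n"
    proof (rule Pi_I)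
      fix h assume h: "h \<in> Pi\<^sub>E P (\<lambda>p. partition_pairs (multiplicity p n))"
      have hp: "antimono (fst (h p))" "antimono (snd (h p))" "\<And>i. snd (h p) i \<le> fst (h p) i"
        "finite {i. fst (h p) i \<noteq> 0}" "(\<Sum>i | fst (h p) i \<noteq> 0. fst (h p) i) = multiplicity p n" if "p \<in> P" for p
        using PiE_mem[OF h that] by (auto simp: partition_pairs_def split: prod.splits)
      define d e where "d = (\<lambda>i. \<Prod>p\<in>P. p ^ fst (h p) i)" and "e = (\<lambda>i. \<Prod>p\<in>P. p ^ snd (h p) i)"
      have "finite (\<Union>p\<in>P. {i. fst (h p) i \<noteq> 0})" using P(1) hp(4) by blast
      then obtain J where J: "\<forall>i\<in>(\<Union>p\<in>P. {i. fst (h p) i \<noteq> 0}). i < J" unfolding finite_nat_set_iff_bounded by blast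
      have J0: "fst (h p) i = 0" if "p \<in> P" "i \<ge> J" for p i
      proof (rule ccontr)
        assume "fst (h p) i \<noteq> 0"
        hence "i < J" using J that(1) by blast
        thus False using that(2) by simp
      qed
      have J1: "d i = 1" "e i = 1" if "i \<ge> J" for i
      proof -
        have "fst (h p) i = 0 \<and> snd (h p) i = 0" if "p \<in> P" for p
          using J0[OF that \<open>i \<ge> J\<close>] hp(3)[OF that, of i] by simp
        thus "d i = 1" "e i = 1" unfolding d_def e_def by (simp_all cong: prod.cong)
      qed
      have pos: "d i > 0" "e i > 0" for i
        unfolding d_def e_def by (intro prod_pos ballI zero_less_power prime_gt_0_nat P(2); assumption)+
      have chain: "finite {i. d i \<noteq> 1}" "finite {i. e i \<noteq> 1}"
        by (rule finite_subset[of _ "{..<J}"]; use J1 in \<open>auto simp: not_less[symmetric]\<close>)+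
      have "d (Suc i) dvd d i" "e (Suc i) dvd e i" "e i dvd d i" for i
        unfolding d_def e_def
        by (intro prod_dvd_prod le_imp_power_dvd antimonoD[OF hp(1)] antimonoD[OF hp(2)] hp(3); simp)+
      hence "divisor_chain d" "divisor_chain e" "\<forall>i. e i dvd d i" using pos chain by (auto simp: divisor_chain_def)
      moreover have "(\<Prod>i | d i \<noteq> 1. d i) = n"
      proof -
        have "(\<Prod>i | d i \<noteq> 1. d i) = (\<Prod>i<J. d i)" by (rule prod_divisor_chain[symmetric]) (use J1 in auto)
        also have "\<dots> = (\<Prod>p\<in>P. p ^ (\<Sum>i<J. fst (h p) i))"
          unfolding d_def power_sum by (rule prod.swap)
        also have "\<dots> = (\<Prod>p\<in>P. p ^ multiplicity p n)"
          using sum_support(2)[OF J0] hp(5) by (intro prod.cong refl) auto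
        also have "\<dots> = n" by (rule prod_prime_powers_eq) (use n P in \<open>auto simp: P_def\<close>)
        finally show ?thesis .
      qed
      ultimately show "\<Psi> h \<in> chain_pairs n" by (simp add: chain_pairs_def \<Psi>_def d_def e_def)
    qed
    show "\<Psi> (\<Phi> de) = de" if "de \<in> chain_pairs n" for de
    proof -
      obtain d e where de1: "de = (d, e)" by (rule prod.exhaust)
      have de: "de = (d, e)" "divisor_chain d" "divisor_chain e" "\<And>j. e j dvd d j" "(\<Prod>i | d i \<noteq> 1. d i) = n"
        using that by (simp_all add: chain_pairs_def de1)
      have "(\<Prod>p\<in>P. p ^ multiplicity p (d i)) = d i" "(\<Prod>p\<in>P. p ^ multiplicity p (e i)) = e i" for i
        by (rule prod_prime_powers_eq[OF divisor_chain_pos[OF de(2)] sub[OF de(2,5)] P], assumption)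
           (rule prod_prime_powers_eq[OF divisor_chain_pos[OF de(3)] sub'[OF de(2,5,4)] P], assumption)
      thus ?thesis by (simp add: \<Phi>_def \<Psi>_def de(1))
    qed
    show "\<Phi> (\<Psi> h) = h" if h: "h \<in> Pi\<^sub>E P (\<lambda>p. partition_pairs (multiplicity p n))" for h
    proof
      fix p
      show "\<Phi> (\<Psi> h) p = h p"
      proof (cases "p \<in> P")
        case True
        thus ?thesis using mult[OF True] by (simp add: \<Phi>_def \<Psi>_def)
      next
        case False
        thus ?thesis using PiE_arb[OF h False] by (simp add: \<Phi>_def \<Psi>_def)
      qed
    qed
  qed
  hence "card (chain_pairs n) = card (Pi\<^sub>E P (\<lambda>p. partition_pairs (multiplicity p n)))" by (rule bij_betw_same_card)
  thus ?thesis using P(1) by (simp add: card_PiE num_partition_pairs_def P_def)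
qed

lemma subgroup_class_sum_eq_prod:
  "n > 0 \<Longrightarrow> subgroup_class_sum n = (\<Prod>p\<in>prime_factors n. num_partition_pairs (multiplicity p n))"
  by (simp add: subgroup_class_sum_eq_card card_chain_pairs)

text \<open>\<open>bounded_pairs l m n\<close>: the pairs of total \<open>n\<close> whose largest parts are bounded by \<open>l\<close> and \<open>m\<close>.\<close>

definition bounded_pairs :: "nat \<Rightarrow> nat \<Rightarrow> nat \<Rightarrow> ((nat \<Rightarrow> nat) \<times> (nat \<Rightarrow> nat)) set" where
  "bounded_pairs l m n = {(a, b) \<in> partition_pairs n. a 0 \<le> l \<and> b 0 \<le> m}"

lemma partition_pairs_le:
  assumes "(a, b) \<in> partition_pairs n" shows "a i \<le> n" "i \<ge> n \<Longrightarrow> a i = 0"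
proof -
  have anti: "antimono a" and fin: "finite {i. a i \<noteq> 0}" and n: "(\<Sum>i | a i \<noteq> 0. a i) = n"
    using assms by (auto simp: partition_pairs_def)
  show "a i \<le> n"
  proof (cases "a i = 0")
    case False
    show ?thesis unfolding n[symmetric] by (rule member_le_sum[OF _ _ fin]) (use False in auto)
  qed simp
  assume i: "i \<ge> n"
  show "a i = 0"
  proof (rule ccontr)
    assume "a i \<noteq> 0"
    hence ge: "a j \<ge> 1" if "j \<le> i" for j using antimonoD[OF anti that] by linarith
    have sub: "{..i} \<subseteq> {i. a i \<noteq> 0}" using ge by fastforce
    have "Suc i = (\<Sum>j\<le>i. 1)" by simp
    also have "\<dots> \<le> (\<Sum>j\<le>i. a j)" using ge by (intro sum_mono) auto
    also have "\<dots> \<le> (\<Sum>i | a i \<noteq> 0. a i)" by (rule sum_mono2[OF fin sub]) auto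
    finally show False using n i by linarith
  qed
qed

lemma finite_partition_pairs: "finite (partition_pairs n)"
proof -
  define S where "S = {f :: nat \<Rightarrow> nat. \<forall>i. (i \<in> {..<n} \<longrightarrow> f i \<in> {..n}) \<and> (i \<notin> {..<n} \<longrightarrow> f i = 0)}"
  have "finite S" unfolding S_def by (rule finite_set_of_finite_funs) auto
  moreover have "partition_pairs n \<subseteq> S \<times> S"
  proof (rule subsetI)
    fix ab assume ab: "ab \<in> partition_pairs n"
    obtain a b where ab_eq: "ab = (a, b)" by (rule prod.exhaust)
    have p: "(a, b) \<in> partition_pairs n" using ab ab_eq by simp
    have ba: "b i \<le> a i" for i using p by (simp add: partition_pairs_def)
    have "a i \<le> n" "b i \<le> n" "i \<ge> n \<Longrightarrow> a i = 0" "i \<ge> n \<Longrightarrow> b i = 0" for i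
      using partition_pairs_le[OF p, of i] ba[of i] by auto
    thus "ab \<in> S \<times> S" by (auto simp: S_def ab_eq)
  qed
  ultimately show ?thesis using finite_subset finite_cartesian_product by blast
qed

lemma finite_bounded_pairs [simp]: "finite (bounded_pairs l m n)"
  unfolding bounded_pairs_def by (rule finite_subset[OF _ finite_partition_pairs[of n]]) auto

section \<open>A recursion on the largest parts\<close>

lemma sum_support_Suc:
  fixes a :: "nat \<Rightarrow> nat" assumes "finite {i. a i \<noteq> 0}"
  shows "(\<Sum>i | a i \<noteq> 0. a i) = a 0 + (\<Sum>i | a (Suc i) \<noteq> 0. a (Suc i))" "finite {i. a (Suc i) \<noteq> 0}"
proof -
  obtain J where J: "\<And>i. i \<ge> J \<Longrightarrow> a i = 0" using support_bound[OF assms] by blast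
  have "(\<Sum>i | a i \<noteq> 0. a i) = (\<Sum>i<Suc J. a i)" by (rule sum_support) (use J in auto)
  also have "\<dots> = a 0 + (\<Sum>i<J. a (Suc i))" by (rule sum.lessThan_Suc_shift)
  also have "(\<Sum>i<J. a (Suc i)) = (\<Sum>i | a (Suc i) \<noteq> 0. a (Suc i))" by (rule sum_support(2)[symmetric]) (use J in auto)
  finally show "(\<Sum>i | a i \<noteq> 0. a i) = a 0 + (\<Sum>i | a (Suc i) \<noteq> 0. a (Suc i))" .
  show "finite {i. a (Suc i) \<noteq> 0}" by (rule sum_support(1)[of J]) (use J in auto)
qed

text \<open>Deleting the first entries is invertible: what remains is a pair of total
  \<open>n - l\<close> bounded by \<open>l\<close> and \<open>m\<close>, and
  \<open>m \<le> l\<close> allows the two entries to be put back.\<close>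

lemma card_exact_pairs:
  assumes "m \<le> l" "l > 0"
  shows "card {(a, b) \<in> partition_pairs n. a 0 = l \<and> b 0 = m} = (if l \<le> n then card (bounded_pairs l m (n - l)) else 0)"
proof (cases "l \<le> n")
  case True
  let ?E = "{(a, b) \<in> partition_pairs n. a 0 = l \<and> b 0 = m}"
  define g where "g = (\<lambda>(a, b). (case_nat l a, case_nat m b) :: (nat \<Rightarrow> nat) \<times> (nat \<Rightarrow> nat))"
  have "bij_betw (\<lambda>(a, b). (\<lambda>i. a (Suc i), \<lambda>i. b (Suc i))) ?E (bounded_pairs l m (n - l))"
  proof (rule bij_betwI[where g = g])
    show "(\<lambda>(a, b). (\<lambda>i. a (Suc i), \<lambda>i. b (Suc i))) \<in> ?E \<rightarrow> bounded_pairs l m (n - l)"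
    proof (rule Pi_I)
      fix ab assume ab: "ab \<in> ?E"
      obtain a b where ab_eq: "ab = (a, b)" by (rule prod.exhaust)
      have p: "antimono a" "antimono b" "\<And>i. b i \<le> a i" "finite {i. a i \<noteq> 0}" "(\<Sum>i | a i \<noteq> 0. a i) = n" "a 0 = l" "b 0 = m"
        using ab by (auto simp: ab_eq partition_pairs_def)
      have "antimono (\<lambda>i. a (Suc i))" "antimono (\<lambda>i. b (Suc i))"
        by (intro antimonoI antimonoD[OF p(1)] antimonoD[OF p(2)]; simp)+
      moreover have "a (Suc 0) \<le> l" "b (Suc 0) \<le> m"
        using antimonoD[OF p(1), of 0 1] antimonoD[OF p(2), of 0 1] p(6,7) by auto
      moreover have "(\<Sum>i | a (Suc i) \<noteq> 0. a (Suc i)) = n - l" "finite {i. a (Suc i) \<noteq> 0}"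
        using sum_support_Suc[OF p(4)] p(5,6) by auto
      ultimately show "(case ab of (a, b) \<Rightarrow> (\<lambda>i. a (Suc i), \<lambda>i. b (Suc i))) \<in> bounded_pairs l m (n - l)"
        using p(3) by (simp add: ab_eq bounded_pairs_def partition_pairs_def)
    qed
    show "g \<in> bounded_pairs l m (n - l) \<rightarrow> ?E"
    proof (rule Pi_I)
      fix ab assume ab: "ab \<in> bounded_pairs l m (n - l)"
      obtain a b where ab_eq: "ab = (a, b)" by (rule prod.exhaust)
      have p: "antimono a" "antimono b" "\<And>i. b i \<le> a i" "finite {i. a i \<noteq> 0}" "(\<Sum>i | a i \<noteq> 0. a i) = n - l" "a 0 \<le> l" "b 0 \<le> m"
        using ab by (auto simp: ab_eq bounded_pairs_def partition_pairs_def)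
      obtain J where J: "\<And>i. i \<ge> J \<Longrightarrow> a i = 0" using support_bound[OF p(4)] by blast
      have J': "case_nat l a i = 0" if "i \<ge> Suc J" for i using that J by (cases i) auto
      have fin: "finite {i. case_nat l a i \<noteq> 0}" by (rule sum_support(1)[OF J'])
      have "(\<Sum>i | case_nat l a i \<noteq> 0. case_nat l a i) = n"
        using sum_support_Suc(1)[OF fin] p(5) True by simp
      moreover have "antimono (case_nat l a)" "antimono (case_nat m b)"
        using p(1,2,6,7) by (auto simp: antimono_iff_le_Suc split: nat.splits)
      moreover have "case_nat m b i \<le> case_nat l a i" for i
        using p(3) assms(1) by (cases i) auto
      ultimately show "g ab \<in> ?E" using fin by (simp add: ab_eq g_def partition_pairs_def)
    qed
    show "g ((\<lambda>(a, b). (\<lambda>i. a (Suc i), \<lambda>i. b (Suc i))) ab) = ab" if "ab \<in> ?E" for ab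
      using that by (auto simp: g_def fun_eq_iff split: nat.splits)
    show "(\<lambda>(a, b). (\<lambda>i. a (Suc i), \<lambda>i. b (Suc i))) (g ab) = ab" if "ab \<in> bounded_pairs l m (n - l)" for ab
      by (auto simp: g_def split: prod.splits)
  qed
  thus ?thesis using True by (simp add: bij_betw_same_card)
next
  case False
  have "{(a, b) \<in> partition_pairs n. a 0 = l \<and> b 0 = m} = {}"
    using partition_pairs_le(1)[of _ _ n 0] False by fastforce
  thus ?thesis using False by (simp only: card.empty if_False)
qed

text \<open>Inclusion-exclusion over the pairs that miss one of the two bounds, plus the pairs that
  attain both. In terms of generating functions the last summand is a division by
  \<open>1 - x ^ Suc l\<close>.\<close>

lemma card_bounded_pairs_Suc:
  assumes "Suc m \<le> Suc l"
  shows "int (card (bounded_pairs (Suc l) (Suc m) n)) =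
    int (card (bounded_pairs l (Suc m) n)) + int (card (bounded_pairs (Suc l) m n)) - int (card (bounded_pairs l m n))
      + (if Suc l \<le> n then int (card (bounded_pairs (Suc l) (Suc m) (n - Suc l))) else 0)"
proof -
  let ?E = "{(a, b) \<in> partition_pairs n. a 0 = Suc l \<and> b 0 = Suc m}"
  let ?U = "bounded_pairs l (Suc m) n \<union> bounded_pairs (Suc l) m n"
  have "finite ?E" by (rule finite_subset[OF _ finite_partition_pairs[of n]]) auto
  moreover have "bounded_pairs (Suc l) (Suc m) n = ?U \<union> ?E" "?U \<inter> ?E = {}"
    by (auto simp: bounded_pairs_def le_Suc_eq)
  ultimately have "card (bounded_pairs (Suc l) (Suc m) n) = card ?U + card ?E"
    by (simp add: card_Un_disjoint)
  moreover have "bounded_pairs l (Suc m) n \<inter> bounded_pairs (Suc l) m n = bounded_pairs l m n"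
    by (auto simp: bounded_pairs_def)
  hence "card (bounded_pairs l (Suc m) n) + card (bounded_pairs (Suc l) m n) = card ?U + card (bounded_pairs l m n)"
    by (metis card_Un_Int finite_bounded_pairs)
  ultimately show ?thesis using card_exact_pairs[OF assms, of n] by (auto split: if_splits)
qed

lemma card_bounded_pairs_Suc_0:
  "int (card (bounded_pairs (Suc l) 0 n)) =
    int (card (bounded_pairs l 0 n)) + (if Suc l \<le> n then int (card (bounded_pairs (Suc l) 0 (n - Suc l))) else 0)"
proof -
  let ?E = "{(a, b) \<in> partition_pairs n. a 0 = Suc l \<and> b 0 = 0}"
  have "finite ?E" by (rule finite_subset[OF _ finite_partition_pairs[of n]]) auto
  moreover have "bounded_pairs (Suc l) 0 n = bounded_pairs l 0 n \<union> ?E" "bounded_pairs l 0 n \<inter> ?E = {}"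
    by (auto simp: bounded_pairs_def le_Suc_eq)
  ultimately have "card (bounded_pairs (Suc l) 0 n) = card (bounded_pairs l 0 n) + card ?E"
    by (simp add: card_Un_disjoint)
  thus ?thesis using card_exact_pairs[of 0 "Suc l" n] by (auto split: if_splits)
qed

text \<open>The table of counts keeps only \<open>m \<le> l\<close>. This identity replaces the
  missing neighbour of a diagonal entry, where the recursion reduces to dividing the entry before
  it.\<close>

lemma bounded_pairs_Suc_right: "bounded_pairs l (Suc l) n = bounded_pairs l l n"
proof -
  have "b 0 \<le> a 0" if "(a, b) \<in> partition_pairs n" for a b using that by (simp add: partition_pairs_def)
  hence "(a, b) \<in> bounded_pairs l (Suc l) n \<longleftrightarrow> (a, b) \<in> bounded_pairs l l n" for a b
    by (force simp: bounded_pairs_def)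
  thus ?thesis by auto
qed

lemma card_bounded_pairs_0: "card (bounded_pairs 0 0 n) = (if n = 0 then 1 else 0)"
proof -
  have z: "ab = (\<lambda>_. 0, \<lambda>_. 0) \<and> n = 0" if ab: "ab \<in> bounded_pairs 0 0 n" for ab
  proof -
    obtain a b where ab_eq: "ab = (a, b)" by (rule prod.exhaust)
    have p: "antimono a" "\<And>i. b i \<le> a i" "(\<Sum>i | a i \<noteq> 0. a i) = n" "a 0 = 0"
      using ab unfolding ab_eq by (simp_all add: bounded_pairs_def partition_pairs_def)
    have a0: "a i = 0" for i using antimonoD[OF p(1), of 0 i] p(4) by simp
    have b0: "b i = 0" for i using p(2)[of i] a0[of i] by simp
    have "n = 0" unfolding p(3)[symmetric] using a0 by simp
    moreover have "a = (\<lambda>_. 0)" "b = (\<lambda>_. 0)" by (rule ext, rule a0, rule ext, rule b0)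
    ultimately show ?thesis by (simp only: ab_eq)
  qed
  show ?thesis
  proof (cases "n = 0")
    case True
    have "(\<lambda>_. 0, \<lambda>_. 0) \<in> bounded_pairs 0 0 n"
      by (simp add: bounded_pairs_def partition_pairs_def antimono_def True)
    hence "bounded_pairs 0 0 n = {(\<lambda>_. 0, \<lambda>_. 0)}" using z by blast
    thus ?thesis using True by simp
  next
    case False
    hence "bounded_pairs 0 0 n = {}" using z by blast
    thus ?thesis using False by simp
  qed
qed

lemma num_partition_pairs_eq_bounded:
  assumes "n \<le> K" shows "num_partition_pairs n = card (bounded_pairs K K n)"
proof -
  have "a 0 \<le> K \<and> b 0 \<le> K" if "(a, b) \<in> partition_pairs n" for a b
  proof -
    have "b 0 \<le> a 0" using that by (simp add: partition_pairs_def)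
    thus ?thesis using partition_pairs_le(1)[OF that, of 0] assms by linarith
  qed
  hence "bounded_pairs K K n = partition_pairs n" by (fastforce simp: bounded_pairs_def)
  thus ?thesis by (simp add: num_partition_pairs_def)
qed

text \<open>
  Division of a power series by \<open>1 - x ^ l\<close>: the two accumulators form a queue with the
  last \<open>l\<close> coefficients of the quotient.
\<close>

fun geometric_quotient :: "int list \<Rightarrow> int list \<Rightarrow> int list \<Rightarrow> int list" where
  "geometric_quotient [] fs bs = []"
| "geometric_quotient (u # us) (f # fs) bs = (u + f) # geometric_quotient us fs ((u + f) # bs)"
| "geometric_quotient (u # us) [] bs =
     (case rev bs of [] \<Rightarrow> [] | f # fs \<Rightarrow> (u + f) # geometric_quotient us fs [u + f])"

fun add_sub_lists :: "int list \<Rightarrow> int list \<Rightarrow> int list \<Rightarrow> int list" where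
  "add_sub_lists (a # as) (b # bs) (c # cs) = (a + b - c) # add_sub_lists as bs cs"
| "add_sub_lists _ _ _ = []"

text \<open>Row \<open>Suc l\<close> of the table from row \<open>l\<close>, one coefficient list
  for each \<open>m\<close>. \<open>pn\<close> and \<open>po\<close> are the entries for the
  preceding \<open>m\<close> in the new and in the old row, and \<open>z\<close> consists of
  \<open>Suc l\<close> zeros, the initial queue. Past the end of the old row stands the diagonal
  entry.\<close>

fun next_row :: "int list \<Rightarrow> int list list \<Rightarrow> int list \<Rightarrow> int list \<Rightarrow> int list list" where
  "next_row z [] pn po = [geometric_quotient pn z []]"
| "next_row z (a # as) pn po =
     (let q = geometric_quotient (add_sub_lists a pn po) z [] in q # next_row z as q a)"

text \<open>The unit list is a counter in list form, so that evaluation recurses on constructors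
  only. \<open>z\<close> gains a zero per row, as the divisor \<open>1 - x ^ l\<close> passes to the
  next \<open>l\<close>; the zero lists stand for the absent column before
  \<open>m = 0\<close>.\<close>

fun pair_table :: "nat \<Rightarrow> unit list \<Rightarrow> int list \<Rightarrow> int list list \<Rightarrow> int list list" where
  "pair_table L [] z fs = fs"
| "pair_table L (x # xs) z fs = pair_table L xs (0 # z) (next_row z fs (replicate L 0) (replicate L 0))"

text \<open>Invariant: the queue \<open>fs @ rev bs\<close> holds the next \<open>l\<close> values
  of \<open>g\<close>, which is the quotient \<open>w\<close> delayed by \<open>l\<close> places.
  Each step consumes a value at the front and appends \<open>w i\<close> at the back.\<close>

lemma geometric_quotient_eq:
  assumes g: "\<And>i. g (i + l) = w i" "\<And>i. w i = u i + g i" and "l > 0"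
    and "fs @ rev bs = map g [i..<i + l]"
  shows "geometric_quotient (map u [i..<i + k]) fs bs = map w [i..<i + k]"
  using assms(4)
proof (induction k arbitrary: i fs bs)
  case (Suc k)
  have il: "[i..<i + l] = i # [Suc i..<i + l]" using \<open>l > 0\<close> by (simp add: upt_conv_Cons)
  have ik: "[i..<i + Suc k] = i # [Suc i..<Suc i + k]" by (simp add: upt_conv_Cons)
  have q: "map g [Suc i..<i + l] @ [w i] = map g [Suc i..<Suc i + l]"
    using g(1)[of i] \<open>l > 0\<close> by (simp add: add.commute)
  show ?case
  proof (cases fs)
    case Nil
    hence "rev bs = g i # map g [Suc i..<i + l]" using Suc.prems il by simp
    moreover have "geometric_quotient (map u [Suc i..<Suc i + k]) (map g [Suc i..<i + l]) [w i] = map w [Suc i..<Suc i + k]"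
      by (rule Suc.IH) (simp only: rev.simps append_Nil q)
    ultimately show ?thesis unfolding ik Nil by (simp add: g(2)[of i, symmetric])
  next
    case (Cons f fs')
    have f: "f = g i" "fs' @ rev bs = map g [Suc i..<i + l]" using Suc.prems unfolding Cons il by auto
    have "geometric_quotient (map u [Suc i..<Suc i + k]) fs' (w i # bs) = map w [Suc i..<Suc i + k]"
      by (rule Suc.IH) (simp only: append_assoc[symmetric] f(2) rev.simps q)
    thus ?thesis unfolding ik Cons by (simp add: f g(2)[of i, symmetric])
  qed
qed simp

lemma geometric_quotient_correct:
  assumes "\<And>n. w n = u n + (if Suc l \<le> n then w (n - Suc l) else 0)"
  shows "geometric_quotient (map u [0..<L]) (replicate (Suc l) 0) [] = map w [0..<L]"
proof -
  define g where "g = (\<lambda>i. if Suc l \<le> i then w (i - Suc l) else 0)"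
  have "geometric_quotient (map u [0..<0 + L]) (replicate (Suc l) 0) [] = map w [0..<0 + L]"
  proof (rule geometric_quotient_eq[where g = g and l = "Suc l"])
    show "replicate (Suc l) 0 @ rev [] = map g [0..<0 + Suc l]"
      by (rule nth_equalityI) (auto simp: g_def simp del: upt_Suc replicate_Suc)
  qed (use assms in \<open>auto simp: g_def\<close>)
  thus ?thesis by simp
qed

lemma add_sub_lists_map:
  "add_sub_lists (map a xs) (map b xs) (map c xs) = map (\<lambda>n. a n + b n - c n) xs"
  by (induction xs) auto

definition pair_row :: "nat \<Rightarrow> nat \<Rightarrow> nat \<Rightarrow> int list" where
  "pair_row L l m = map (\<lambda>n. int (card (bounded_pairs l m n))) [0..<L]"

lemma next_row_correct:
  assumes "j \<le> l"
  shows "next_row (replicate (Suc l) 0) (map (pair_row L l) [Suc j..<Suc l]) (pair_row L (Suc l) j) (pair_row L l j)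
     = map (pair_row L (Suc l)) [Suc j..<Suc (Suc l)]"
  using assms
proof (induction "l - j" arbitrary: j)
  case 0
  hence j: "j = l" by simp
  have "geometric_quotient (pair_row L (Suc l) l) (replicate (Suc l) 0) [] = pair_row L (Suc l) (Suc l)"
    unfolding pair_row_def
    by (rule geometric_quotient_correct, subst card_bounded_pairs_Suc) (auto simp: bounded_pairs_Suc_right)
  thus ?case by (simp add: j)
next
  case (Suc d)
  hence j: "Suc j \<le> l" by simp
  have q: "geometric_quotient (add_sub_lists (pair_row L l (Suc j)) (pair_row L (Suc l) j) (pair_row L l j)) (replicate (Suc l) 0) []
     = pair_row L (Suc l) (Suc j)"
    unfolding pair_row_def add_sub_lists_map
    by (rule geometric_quotient_correct, subst card_bounded_pairs_Suc) (use j in auto)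
  have 1: "[Suc j..<Suc l] = Suc j # [Suc (Suc j)..<Suc l]" "[Suc j..<Suc (Suc l)] = Suc j # [Suc (Suc j)..<Suc (Suc l)]"
    using j by (auto simp: upt_conv_Cons)
  have "next_row (replicate (Suc l) 0) (map (pair_row L l) [Suc (Suc j)..<Suc l]) (pair_row L (Suc l) (Suc j)) (pair_row L l (Suc j))
     = map (pair_row L (Suc l)) [Suc (Suc j)..<Suc (Suc l)]"
    by (rule Suc.hyps) (use Suc.hyps j in auto)
  thus ?case unfolding 1 list.map next_row.simps q Let_def by simp
qed

lemma next_row_correct_0:
  "next_row (replicate (Suc l) 0) (map (pair_row L l) [0..<Suc l]) (replicate L 0) (replicate L 0)
     = map (pair_row L (Suc l)) [0..<Suc (Suc l)]"
proof -
  have r0: "replicate L 0 = map (\<lambda>_. 0 :: int) [0..<L]" by (simp add: map_replicate_const)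
  have q: "geometric_quotient (add_sub_lists (pair_row L l 0) (replicate L 0) (replicate L 0)) (replicate (Suc l) 0) []
     = pair_row L (Suc l) 0"
    unfolding pair_row_def r0 add_sub_lists_map
    by (rule geometric_quotient_correct, subst card_bounded_pairs_Suc_0) auto
  have 1: "[0..<Suc l] = 0 # [Suc 0..<Suc l]" "[0..<Suc (Suc l)] = 0 # [Suc 0..<Suc (Suc l)]"
    by (auto simp: upt_conv_Cons simp del: upt_Suc)
  show ?thesis unfolding 1 list.map next_row.simps q Let_def using next_row_correct[of 0 l L] by simp
qed

lemma pair_table_correct:
  "pair_table L xs (replicate (Suc l) 0) (map (pair_row L l) [0..<Suc l])
     = map (pair_row L (l + length xs)) [0..<Suc (l + length xs)]"
proof (induction xs arbitrary: l)
  case (Cons x xs)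
  have "pair_table L (x # xs) (replicate (Suc l) 0) (map (pair_row L l) [0..<Suc l])
     = pair_table L xs (replicate (Suc (Suc l)) 0) (map (pair_row L (Suc l)) [0..<Suc (Suc l)])"
    by (simp only: pair_table.simps next_row_correct_0) (simp only: replicate_Suc)
  also have "\<dots> = map (pair_row L (Suc l + length xs)) [0..<Suc (Suc l + length xs)]" by (rule Cons.IH)
  finally show ?case by simp
qed simp

text \<open>Row 0 consists of the empty pair alone. The last entry of row \<open>K\<close> has both
  bounds equal to \<open>K\<close>, which is no restriction for totals up to
  \<open>K\<close>.\<close>

definition pair_counts :: "nat \<Rightarrow> int list" where
  "pair_counts K = last (pair_table (Suc K) (replicate K ()) [0] [1 # replicate K 0])"

lemma pair_counts_correct: "pair_counts K = map (\<lambda>n. int (num_partition_pairs n)) [0..<Suc K]"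
proof -
  have "1 # replicate K 0 = pair_row (Suc K) 0 0"
    by (rule nth_equalityI) (auto simp: pair_row_def card_bounded_pairs_0 nth_Cons split: nat.splits simp del: upt_Suc)
  hence "pair_counts K = last (pair_table (Suc K) (replicate K ()) (replicate (Suc 0) 0) (map (pair_row (Suc K) 0) [0..<Suc 0]))"
    by (simp add: pair_counts_def)
  also have "\<dots> = pair_row (Suc K) K K" unfolding pair_table_correct by simp
  also have "\<dots> = map (\<lambda>n. int (num_partition_pairs n)) [0..<Suc K]"
    unfolding pair_row_def
  proof (rule map_cong[OF refl])
    fix n assume "n \<in> set [0..<Suc K]"
    hence "n \<le> K" by auto
    thus "int (card (bounded_pairs K K n)) = int (num_partition_pairs n)"
      by (simp add: num_partition_pairs_eq_bounded[of n K])
  qed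
  finally show ?thesis .
qed

text \<open>Newton's identities: the coefficients of \<open>x f' / f\<close> from those of \<open>f\<close>.\<close>

fun dot_product :: "int list \<Rightarrow> int list \<Rightarrow> int" where
  "dot_product (a # as) (b # bs) = a * b + dot_product as bs"
| "dot_product _ _ = 0"

text \<open>\<open>bs\<close> holds the sums found so far, latest first, so that its dot product
  with the coefficients \<open>as\<close> is the convolution in Newton's identity. The coefficient
  lists start at index 1, the constant coefficient being 1.\<close>

fun newton_sums :: "int \<Rightarrow> int list \<Rightarrow> int list \<Rightarrow> int list \<Rightarrow> int list" where
  "newton_sums n [] as bs = bs"
| "newton_sums n (x # xs) as bs = newton_sums (n + 1) xs as ((n * x - dot_product bs as) # bs)"

text \<open>If \<open>pair_series\<close> had no zero in the disc, the estimate at radius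
  \<open>(79/80)\<^sup>2\<close> would keep the modulus of this sum below 87700.\<close>

lemma newton_sum_39: "hd (newton_sums 1 (tl (pair_counts 39)) (tl (pair_counts 39)) []) = - 89858"
  by code_simp

lemma dot_product_eq:
  fixes b :: "nat \<Rightarrow> complex" and N :: "nat \<Rightarrow> int"
  assumes "map of_int bs = rev (map b [1..<i])" "1 \<le> i" "i \<le> K"
  shows "of_int (dot_product bs (map N [1..<K])) = (\<Sum>k=1..<i. b k * of_int (N (i - k)))"
proof -
  have *: "of_int (dot_product xs ys) = (\<Sum>j<length xs. (of_int (xs ! j) :: complex) * of_int (ys ! j))" if "length xs \<le> length ys" for xs ys
    using that
  proof (induction xs ys rule: dot_product.induct)
    case (1 a as b bs)
    thus ?case by (simp add: sum.lessThan_Suc_shift del: sum.lessThan_Suc)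
  qed auto
  have len: "length bs = i - 1" using arg_cong[OF assms(1), of length] by simp
  have nth: "of_int (bs ! j) = b (i - 1 - j)" if "j < i - 1" for j
  proof -
    have "of_int (bs ! j) = map of_int bs ! j" using that len by simp
    also have "\<dots> = b (i - 1 - j)" unfolding assms(1) using that by (simp add: rev_nth Suc_diff_Suc)
    finally show ?thesis .
  qed
  have "of_int (dot_product bs (map N [1..<K])) = (\<Sum>j<i - 1. of_int (bs ! j) * (of_int (map N [1..<K] ! j) :: complex))"
    by (subst *) (use len assms in auto)
  also have "\<dots> = (\<Sum>j<i - 1. b (i - 1 - j) * of_int (N (Suc j)))"
    using nth assms by (intro sum.cong) auto
  also have "\<dots> = (\<Sum>k=1..<i. b k * of_int (N (i - k)))"
    by (rule sum.reindex_bij_witness[of _ "\<lambda>k. i - 1 - k" "\<lambda>j. i - 1 - j"]) (auto simp: Suc_diff_Suc)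
  finally show ?thesis .
qed

lemma newton_sums_correct:
  fixes b :: "nat \<Rightarrow> complex" and N :: "nat \<Rightarrow> int"
  assumes N0: "N 0 = 1"
    and b: "\<And>n. n \<ge> 1 \<Longrightarrow> of_nat n * of_int (N n) = (\<Sum>k=1..n. b k * of_int (N (n - k)))"
    and "map of_int bs = rev (map b [1..<i])" "1 \<le> i" "i + k \<le> K"
  shows "map of_int (newton_sums (int i) (map N [i..<i + k]) (map N [1..<K]) bs) = rev (map b [1..<i + k])"
  using assms(3-5)
proof (induction k arbitrary: i bs)
  case (Suc k)
  have "of_nat i * of_int (N i) = (\<Sum>k=1..<i. b k * of_int (N (i - k))) + b i"
  proof -
    have "{1..i} = insert i {1..<i}" using Suc.prems by auto
    thus ?thesis using b[of i] Suc.prems N0 by (simp add: add.commute)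
  qed
  also have "(\<Sum>k=1..<i. b k * of_int (N (i - k))) = of_int (dot_product bs (map N [1..<K]))"
    by (rule dot_product_eq[symmetric]) (use Suc.prems in auto)
  finally have bi: "of_int (int i * N i - dot_product bs (map N [1..<K])) = b i" by (simp add: algebra_simps)
  have l: "[i..<i + Suc k] = i # [Suc i..<Suc i + k]" by (simp add: upt_conv_Cons)
  have "map of_int (newton_sums (int (Suc i)) (map N [Suc i..<Suc i + k]) (map N [1..<K])
      ((int i * N i - dot_product bs (map N [1..<K])) # bs)) = rev (map b [1..<Suc i + k])"
    by (rule Suc.IH) (use Suc.prems bi in auto)
  thus ?case unfolding l list.map newton_sums.simps by (simp add: add.commute)
qed simp

lemma newton_sum_value:
  fixes b :: "nat \<Rightarrow> complex"
  assumes b: "\<And>n. n \<ge> 1 \<Longrightarrow> of_nat n * of_nat (num_partition_pairs n) = (\<Sum>k=1..n. b k * of_nat (num_partition_pairs (n - k)))"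
    and val: "hd (newton_sums 1 (tl (pair_counts 39)) (tl (pair_counts 39)) []) = - 89858"
    and N0: "num_partition_pairs 0 = 1"
  shows "b 39 = - 89858"
proof -
  define N where "N = (\<lambda>n. int (num_partition_pairs n))"
  have tl: "tl (pair_counts 39) = map N [1..<40]"
    unfolding pair_counts_correct N_def by (simp add: upt_conv_Cons del: upt_Suc)
  have "map of_int (newton_sums (int 1) (map N [1..<1 + 39]) (map N [1..<40]) []) = rev (map b [1..<1 + 39])"
    by (rule newton_sums_correct) (use b N0 in \<open>auto simp: N_def\<close>)
  moreover have "rev (map b [1..<1 + 39]) = b 39 # rev (map b [1..<39])" 
  proof -
    have "[1..<1 + 39] = [1..<39] @ [39::nat]" using upt_Suc_append[of 1 39] by simp
    thus ?thesis by simp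
  qed
  ultimately have *: "map of_int (newton_sums 1 (map N [1..<40]) (map N [1..<40]) []) = b 39 # rev (map b [1..<39])" by simp
  hence "newton_sums 1 (map N [1..<40]) (map N [1..<40]) [] \<noteq> []" by auto
  hence "hd (map of_int (newton_sums 1 (map N [1..<40]) (map N [1..<40]) [])) = (of_int (- 89858) :: complex)"
    using val unfolding tl by (simp add: hd_map)
  thus ?thesis unfolding * by simp
qed

lemma num_partition_pairs_0_3:
  "num_partition_pairs 0 = 1" "num_partition_pairs 1 = 2" "num_partition_pairs 2 = 6" "num_partition_pairs 3 = 13"
proof -
  have "pair_counts 3 = [1, 2, 6, 13]" by code_simp
  hence eq: "map (\<lambda>n. int (num_partition_pairs n)) [0..<Suc 3] = [1, 2, 6, 13]" unfolding pair_counts_correct .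
  have "int (num_partition_pairs n) = [1, 2, 6, 13] ! n" if "n < 4" for n
    using arg_cong[OF eq, of "\<lambda>xs. xs ! n"] that by (simp del: upt_Suc)
  from this[of 0] this[of 1] this[of 2] this[of 3]
  show "num_partition_pairs 0 = 1" "num_partition_pairs 1 = 2" "num_partition_pairs 2 = 6" "num_partition_pairs 3 = 13"
    by auto
qed

section \<open>Growth of the number of pairs\<close>

lemma sum_by_multiplicities:
  fixes a :: "nat \<Rightarrow> nat"
  assumes "antimono a" "a K = 0" shows "(\<Sum>i<K. a i) = (\<Sum>j<K. Suc j * (a j - a (Suc j)))"
proof -
  have "(\<Sum>j<J. Suc j * (a j - a (Suc j))) + J * a J = (\<Sum>i<J. a i)" for J
  proof (induction J)
    case (Suc J)
    have "a J = (a J - a (Suc J)) + a (Suc J)" using antimonoD[OF assms(1), of J "Suc J"] by simp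
    hence "Suc J * a J = Suc J * (a J - a (Suc J)) + Suc J * a (Suc J)" by (metis distrib_left)
    thus ?case using Suc.IH by simp
  qed simp
  from this[of K] show ?thesis using assms(2) by simp
qed

text \<open>A finite form of Euler's product for the partition generating function. The differences
  \<open>a j - a (Suc j)\<close> are the multiplicities of the parts \<open>Suc j\<close> in the
  conjugate partition; they determine \<open>a\<close>, and admitting all choices of multiplicities
  gives a product of geometric sums.\<close>

lemma sum_partitions_le_prod:
  fixes q :: real
  assumes q: "0 < q" "q < 1" and A: "finite A" "\<And>a. a \<in> A \<Longrightarrow> antimono a \<and> a K = 0 \<and> (\<forall>i. a i \<le> K)"
  shows "(\<Sum>a\<in>A. q ^ (\<Sum>i<K. a i)) \<le> (\<Prod>j<K. 1 / (1 - q ^ Suc j))"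
proof -
  define g where "g = (\<lambda>a::nat\<Rightarrow>nat. \<lambda>j\<in>{..<K}. a j - a (Suc j))"
  have inj: "inj_on g A"
  proof (rule inj_onI)
    fix a b assume ab: "a \<in> A" "b \<in> A" "g a = g b"
    have "a j = b j" for j
    proof (cases "j \<le> K")
      case True
      thus ?thesis
      proof (induction j rule: inc_induct)
        case base
        show ?case using A(2)[OF ab(1)] A(2)[OF ab(2)] by simp
      next
        case (step j)
        have "a j - a (Suc j) = b j - b (Suc j)"
          using fun_cong[OF ab(3), of j] step.hyps by (simp add: g_def)
        moreover have "a (Suc j) \<le> a j" "b (Suc j) \<le> b j"
          using A(2)[OF ab(1)] A(2)[OF ab(2)] antimonoD[of _ j "Suc j"] by auto
        ultimately show ?case using step.IH by linarith
      qed
    next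
      case False
      hence "a j \<le> a K" "b j \<le> b K"
        using A(2)[OF ab(1)] A(2)[OF ab(2)] antimonoD[of a K j] antimonoD[of b K j] by auto
      thus ?thesis using A(2)[OF ab(1)] A(2)[OF ab(2)] by simp
    qed
    thus "a = b" by (rule ext)
  qed
  have sub: "g ` A \<subseteq> Pi\<^sub>E {..<K} (\<lambda>_. {..K})"
  proof (rule image_subsetI)
    fix a assume "a \<in> A"
    hence "a j - a (Suc j) \<le> K" for j using A(2)[of a] by (meson diff_le_self order_trans)
    thus "g a \<in> Pi\<^sub>E {..<K} (\<lambda>_. {..K})" by (auto simp: g_def)
  qed
  have "(\<Sum>a\<in>A. q ^ (\<Sum>i<K. a i)) = (\<Sum>a\<in>A. \<Prod>j<K. (q ^ Suc j) ^ g a j)"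
  proof (rule sum.cong[OF refl])
    fix a assume "a \<in> A"
    hence "(\<Sum>i<K. a i) = (\<Sum>j<K. Suc j * g a j)" using A(2) by (subst sum_by_multiplicities) (auto simp: g_def)
    thus "q ^ (\<Sum>i<K. a i) = (\<Prod>j<K. (q ^ Suc j) ^ g a j)" by (simp only: power_sum power_mult)
  qed
  also have "\<dots> = (\<Sum>m\<in>g ` A. \<Prod>j<K. (q ^ Suc j) ^ m j)" by (simp add: sum.reindex[OF inj])
  also have "\<dots> \<le> (\<Sum>m\<in>Pi\<^sub>E {..<K} (\<lambda>_. {..K}). \<Prod>j<K. (q ^ Suc j) ^ m j)"
    by (rule sum_mono2[OF _ sub]) (use q in \<open>auto intro!: finite_PiE prod_nonneg\<close>)
  also have "\<dots> = (\<Prod>j<K. \<Sum>m\<le>K. (q ^ Suc j) ^ m)" by (rule prod_sum_PiE[symmetric]) auto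
  also have "\<dots> \<le> (\<Prod>j<K. 1 / (1 - q ^ Suc j))"
  proof (rule prod_mono, intro conjI)
    fix j
    have lt: "q ^ Suc j < 1" using q by (intro power_Suc_less_one) auto
    have sm: "summable (\<lambda>m. (q ^ Suc j) ^ m)" using lt q by (intro summable_geometric) auto
    show "0 \<le> (\<Sum>m\<le>K. (q ^ Suc j) ^ m)" using q by (intro sum_nonneg) auto
    have "(\<Sum>m\<le>K. (q ^ Suc j) ^ m) \<le> (\<Sum>m. (q ^ Suc j) ^ m)" by (rule sum_le_suminf[OF sm]) (use q in auto)
    also have "\<dots> = 1 / (1 - q ^ Suc j)" by (rule suminf_geometric) (use lt q in auto)
    finally show "(\<Sum>m\<le>K. (q ^ Suc j) ^ m) \<le> 1 / (1 - q ^ Suc j)" .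
  qed
  finally show ?thesis .
qed

text \<open>Expanding the logarithms and summing over \<open>j\<close> first leaves at most the sum
  over \<open>m \<ge> 1\<close> of \<open>q^m / (m (1 - q^m))\<close>. Each term is at most
  \<open>q / (1 - q)\<close> times \<open>1 / m^2\<close>, and the inverse squares sum to less than
  8/3.\<close>

lemma prod_euler_phi_inverse_le:
  fixes q :: real
  assumes q: "0 < q" "q < 1"
  shows "(\<Prod>j<K. 1 / (1 - q ^ Suc j)) \<le> exp ((8/3) * (q / (1 - q)))"
proof -
  have lt: "q ^ Suc j < 1" for j using q by (intro power_Suc_less_one) auto
  have gt: "q ^ Suc j > 0" for j using q by simp
  have ln: "(\<lambda>m. (q ^ Suc j) ^ Suc m / real (Suc m)) sums (- ln (1 - q ^ Suc j))" for j
  proof -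
    have "(\<lambda>n. - ((- (- (q ^ Suc j))) ^ n) / of_nat n) sums ln (1 + (- (q ^ Suc j)))"
      by (rule ln_series') (use lt[of j] gt[of j] in simp)
    hence "(\<lambda>n. - (- ((q ^ Suc j) ^ n) / real n)) sums (- ln (1 - q ^ Suc j))" using sums_minus by fastforce
    hence "(\<lambda>n. (q ^ Suc j) ^ n / real n) sums (- ln (1 - q ^ Suc j))" by simp
    thus ?thesis by (subst sums_Suc_iff) simp
  qed
  have sq: "(\<lambda>n. 1 / real ((n + 1)\<^sup>2)) sums (pi\<^sup>2 / 6)" by (rule inverse_squares_sums)
  have "(\<lambda>m. \<Sum>j<K. (q ^ Suc j) ^ Suc m / real (Suc m)) sums (\<Sum>j<K. - ln (1 - q ^ Suc j))"
    by (intro sums_sum ln)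
  moreover have "(\<lambda>m. (q / (1 - q)) * (1 / real ((m + 1)\<^sup>2))) sums ((q / (1 - q)) * (pi\<^sup>2 / 6))"
    by (intro sums_mult sq)
  moreover have "(\<Sum>j<K. (q ^ Suc j) ^ Suc m / real (Suc m)) \<le> (q / (1 - q)) * (1 / real ((m + 1)\<^sup>2))" for m
  proof -
    define y where "y = q ^ Suc m"
    have y: "0 < y" "y < 1" unfolding y_def using lt gt by auto
    have "(\<Sum>j<K. (q ^ Suc j) ^ Suc m / real (Suc m)) = y * (\<Sum>j<K. y ^ j) / real (Suc m)"
    proof -
      have "(q ^ Suc j) ^ Suc m = y * y ^ j" for j
      proof -
        have "(q ^ Suc j) ^ Suc m = q ^ (Suc m * Suc j)"
          by (subst power_mult[symmetric]) (simp only: mult.commute)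
        thus ?thesis by (simp only: y_def power_mult power_Suc)
      qed
      thus ?thesis by (simp only: sum_distrib_left sum_divide_distrib)
    qed
    also have "(\<Sum>j<K. y ^ j) \<le> 1 / (1 - y)"
    proof -
      have "(\<Sum>j<K. y ^ j) \<le> (\<Sum>j. y ^ j)" by (rule sum_le_suminf) (use y in \<open>auto intro: summable_geometric\<close>)
      thus ?thesis using suminf_geometric[of y] y by simp
    qed
    hence "y * (\<Sum>j<K. y ^ j) / real (Suc m) \<le> y * (1 / (1 - y)) / real (Suc m)"
      using y by (intro divide_right_mono mult_left_mono) auto
    also have "\<dots> \<le> (q / (1 - q)) * (1 / real ((m + 1)\<^sup>2))"
    proof -
      \<comment> \<open>Dividing \<open>1 - q ^ Suc m\<close> by \<open>1 - q\<close> leaves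
        \<open>Suc m\<close> powers of \<open>q\<close>, each at least \<open>q ^ m\<close>.\<close>
      have "real (Suc m) * q ^ m = (\<Sum>i<Suc m. q ^ m)" by simp
      also have "\<dots> \<le> (\<Sum>i<Suc m. q ^ i)" using q by (intro sum_mono power_decreasing) auto
      finally have "real (Suc m) * q ^ m \<le> (\<Sum>i<Suc m. q ^ i)" .
      hence "(real (Suc m) * q ^ m) * (1 - q) \<le> (\<Sum>i<Suc m. q ^ i) * (1 - q)" using q by (intro mult_right_mono) auto
      also have "\<dots> = 1 - y" unfolding y_def using one_diff_power_eq[of q "Suc m"] by (simp only: mult.commute)
      finally have "q * ((real (Suc m) * q ^ m) * (1 - q)) \<le> q * (1 - y)" using q by (intro mult_left_mono) auto
      hence "real (Suc m) * (1 - q) * y \<le> q * (1 - y)" by (simp add: y_def mult_ac)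
      moreover define c where "c = (1 - q) * real (Suc m)"
      ultimately have "y * c \<le> q * (1 - y)" by (simp only: mult.assoc mult.left_commute mult.commute)
      moreover have "c > 0" using q by (simp add: c_def)
      ultimately have "y / (1 - y) \<le> q / c" using y by (simp add: pos_le_divide_eq pos_divide_le_eq)
      hence "y / (1 - y) \<le> q / ((1 - q) * real (Suc m))" by (simp only: c_def)
      hence "y / (1 - y) / real (Suc m) \<le> q / ((1 - q) * real (Suc m)) / real (Suc m)" by (rule divide_right_mono) simp
      moreover have "real ((m + 1)\<^sup>2) = real (Suc m) * real (Suc m)"
        by (simp only: power2_eq_square of_nat_mult Suc_eq_plus1)
      ultimately show ?thesis by (simp only: times_divide_eq_right mult_1_right divide_divide_eq_left mult.assoc)
    qed
    finally show ?thesis .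
  qed
  ultimately have "(\<Sum>j<K. - ln (1 - q ^ Suc j)) \<le> (q / (1 - q)) * (pi\<^sup>2 / 6)" by (rule sums_le[rotated 1])
  also have "\<dots> \<le> (q / (1 - q)) * (8/3)"
  proof (rule mult_left_mono)
    \<comment> \<open>The crude bound \<open>pi < 4\<close> turns \<open>pi\<^sup>2 / 6\<close> into
      16/6, the origin of 8/3.\<close>
    have "pi * pi \<le> 4 * 4" by (intro mult_mono) (use pi_less_4 pi_gt_zero in auto)
    thus "pi\<^sup>2 / 6 \<le> 8/3" by (simp add: power2_eq_square)
  qed (use q in auto)
  finally have le: "(\<Sum>j<K. - ln (1 - q ^ Suc j)) \<le> (8/3) * (q / (1 - q))" by (simp only: mult.commute)
  have "(\<Prod>j<K. 1 / (1 - q ^ Suc j)) = exp (\<Sum>j<K. - ln (1 - q ^ Suc j))"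
    unfolding exp_sum[OF finite_lessThan]
  proof (rule prod.cong[OF refl])
    fix j
    show "1 / (1 - q ^ Suc j) = exp (- ln (1 - q ^ Suc j))"
      using lt[of j] by (simp only: exp_minus exp_ln diff_gt_0_iff_gt inverse_eq_divide)
  qed
  thus ?thesis using le by simp
qed

text \<open>Containment gives \<open>|b| \<le> |a| = k\<close> for the totals, hence
  \<open>(q^2)^k \<le> q^|a| * q^|b|\<close>. After that it is dropped, and the sum is at most the
  square of the bound for single partitions. This explains the argument \<open>q\<^sup>2\<close> and
  the constant 16/3.\<close>

lemma sum_num_partition_pairs_le:
  fixes q :: real
  assumes q: "0 < q" "q < 1"
  shows "(\<Sum>k<K. real (num_partition_pairs k) * (q\<^sup>2) ^ k) \<le> exp ((16/3) * (q / (1 - q)))"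
proof -
  define S where "S = (SIGMA k:{..<K}. partition_pairs k)"
  define A where "A = (fst \<circ> snd) ` S \<union> (snd \<circ> snd) ` S"
  have finS: "finite S" unfolding S_def using finite_partition_pairs by (intro finite_SigmaI) auto
  have finA: "finite A" unfolding A_def using finS by simp
  have mem: "antimono a \<and> antimono b \<and> (\<forall>i. b i \<le> a i) \<and> (\<forall>i. a i \<le> K) \<and> a K = 0 \<and> (\<Sum>i<K. a i) = k"
    if "(k, a, b) \<in> S" for k a b
  proof -
    have k: "k < K" "(a, b) \<in> partition_pairs k" using that by (auto simp: S_def)
    have z: "a i = 0" if "i \<ge> K" for i using partition_pairs_le(2)[OF k(2), of i] k(1) that by simp
    have "(\<Sum>i | a i \<noteq> 0. a i) = (\<Sum>i<K. a i)" by (rule sum_support(2)[OF z])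
    moreover have "a i \<le> K" for i using partition_pairs_le(1)[OF k(2), of i] k(1) by simp
    ultimately show ?thesis using k(2) z[of K] by (auto simp: partition_pairs_def)
  qed
  have Amem: "antimono a \<and> a K = 0 \<and> (\<forall>i. a i \<le> K)" if a: "a \<in> A" for a
  proof -
    obtain k x y where kxy: "(k, x, y) \<in> S" "a = x \<or> a = y" using a by (auto simp: A_def)
    have "y i \<le> K" "y K = 0" for i using mem[OF kxy(1)] by (meson order_trans, metis le_zero_eq)
    thus ?thesis using mem[OF kxy(1)] kxy(2) by blast
  qed
  have "(\<Sum>k<K. real (num_partition_pairs k) * (q\<^sup>2) ^ k) = (\<Sum>k<K. \<Sum>ab\<in>partition_pairs k. (q\<^sup>2) ^ k)"
    by (simp add: num_partition_pairs_def)
  also have "\<dots> = (\<Sum>(k, ab)\<in>S. (q\<^sup>2) ^ k)"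
    unfolding S_def by (rule sum.Sigma) (auto simp: finite_partition_pairs)
  also have "\<dots> \<le> (\<Sum>(k, a, b)\<in>S. q ^ (\<Sum>i<K. a i) * q ^ (\<Sum>i<K. b i))"
  proof (rule sum_mono, clarify)
    fix k a b assume kab: "(k, a, b) \<in> S"
    have m: "(\<Sum>i<K. a i) = k" "(\<Sum>i<K. b i) \<le> (\<Sum>i<K. a i)" using mem[OF kab] by (auto intro: sum_mono)
    hence "q ^ k \<le> q ^ (\<Sum>i<K. b i)" using q by (intro power_decreasing) auto
    hence "q ^ k * q ^ k \<le> q ^ k * q ^ (\<Sum>i<K. b i)" using q by (intro mult_left_mono) auto
    thus "(q\<^sup>2) ^ k \<le> q ^ (\<Sum>i<K. a i) * q ^ (\<Sum>i<K. b i)" using m(1) by (simp add: power2_eq_square power_mult_distrib)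
  qed
  also have "\<dots> = (\<Sum>(a, b)\<in>snd ` S. q ^ (\<Sum>i<K. a i) * q ^ (\<Sum>i<K. b i))"
  proof (subst sum.reindex)
    show "inj_on snd S"
    proof (rule inj_onI)
      fix x y assume "x \<in> S" "y \<in> S" "snd x = snd y"
      thus "x = y" using mem by (cases x; cases y) (metis prod.collapse snd_conv)
    qed
  qed (simp add: case_prod_unfold)
  also have "\<dots> \<le> (\<Sum>(a, b)\<in>A \<times> A. q ^ (\<Sum>i<K. a i) * q ^ (\<Sum>i<K. b i))"
    by (rule sum_mono2) (use finA q in \<open>force simp: A_def\<close>)+
  also have "\<dots> = (\<Sum>a\<in>A. q ^ (\<Sum>i<K. a i)) * (\<Sum>b\<in>A. q ^ (\<Sum>i<K. b i))"
    by (simp add: sum_product sum.cartesian_product)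
  also have "\<dots> \<le> exp ((8/3) * (q / (1 - q))) * exp ((8/3) * (q / (1 - q)))"
  proof -
    have "(\<Sum>a\<in>A. q ^ (\<Sum>i<K. a i)) \<le> exp ((8/3) * (q / (1 - q)))"
      using sum_partitions_le_prod[OF q finA Amem] prod_euler_phi_inverse_le[OF q, of K] by (rule order_trans)
    moreover have "0 \<le> (\<Sum>a\<in>A. q ^ (\<Sum>i<K. a i))" using q by (intro sum_nonneg) auto
    ultimately show ?thesis by (intro mult_mono) auto
  qed
  also have "\<dots> = exp ((16/3) * (q / (1 - q)))" by (simp flip: exp_add)
  finally show ?thesis .
qed

subsection \<open>A zero of the generating function of pairs\<close>

lemma circle_has_integral:
  assumes "(f has_contour_integral I) (circlepath 0 r)"
  shows "((\<lambda>t. f (r * cis t) * r * \<i> * cis t) has_integral I) {0..2 * pi}"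
  using assms has_contour_integral_part_circlepath_iff[of 0 "2 * pi" f I 0 r] by (simp add: circlepath_def)

text \<open>Borel-Caratheodory for Taylor coefficients, from the Fourier coefficients of the real part.\<close>

lemma higher_deriv_le_Re_bound:
  assumes L: "L holomorphic_on ball 0 1" and r: "0 < r" "r < 1" and n: "n > 0"
    and A: "\<And>x. norm x = r \<Longrightarrow> Re (L x) \<le> A"
  shows "norm ((deriv ^^ n) L 0 / fact n) * r ^ n \<le> 2 * (A - Re (L 0))"
proof -
  have sub: "cball 0 r \<subseteq> ball (0::complex) 1" using r by auto
  have cont: "continuous_on (cball 0 r) L"
    by (rule continuous_on_subset[OF holomorphic_on_imp_continuous_on[OF L] sub])
  have hol: "L holomorphic_on ball 0 r" by (rule holomorphic_on_subset[OF L]) (use r in auto)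
  have cisn: "cis t ^ n = cis (real n * t)" for t by (rule Complex.DeMoivre)
  define f where "f = (\<lambda>t. L (r * cis t))"
  define d where "d = (deriv ^^ n) L 0 / fact n"
  have high: "((\<lambda>t. f t * cis (- (real n * t))) has_integral (2 * pi * d * r ^ n)) {0..2 * pi}"
  proof -
    have "((\<lambda>u. L u / (u - 0) ^ Suc n) has_contour_integral (2 * pi * \<i> / fact n * (deriv ^^ n) L 0)) (circlepath 0 r)"
      by (rule Cauchy_has_contour_integral_higher_derivative_circlepath[OF cont hol]) (use r in auto)
    from has_integral_mult_right[OF circle_has_integral[OF this], of "r ^ n / \<i>"]
    have "((\<lambda>t. r ^ n / \<i> * (L (r * cis t) / (r * cis t - 0) ^ Suc n * r * \<i> * cis t)) has_integral
        (r ^ n / \<i> * (2 * pi * \<i> / fact n * (deriv ^^ n) L 0))) {0..2 * pi}" .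
    also have "(\<lambda>t. r ^ n / \<i> * (L (r * cis t) / (r * cis t - 0) ^ Suc n * r * \<i> * cis t)) = (\<lambda>t. f t * cis (- (real n * t)))"
    proof
      fix t
      have p: "(r * cis t - 0) ^ Suc n = r * cis t * (of_real r ^ n * cis (real n * t))"
        by (simp add: power_mult_distrib cisn)
      have "r ^ n / \<i> * (L (r * cis t) / (r * cis t - 0) ^ Suc n * r * \<i> * cis t) = f t / cis (real n * t)"
      proof -
        have 1: "a / \<i> * (X * b * \<i> * c) = a * (X * b * c)" for a b c X :: complex by (simp add: field_simps)
        show ?thesis unfolding p f_def 1 using r by simp
      qed
      also have "\<dots> = f t * cis (- (real n * t))" by (simp add: divide_inverse)
      finally show "r ^ n / \<i> * (L (r * cis t) / (r * cis t - 0) ^ Suc n * r * \<i> * cis t) = f t * cis (- (real n * t))" .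
    qed
    also have "r ^ n / \<i> * (2 * pi * \<i> / fact n * (deriv ^^ n) L 0) = 2 * pi * d * r ^ n"
    proof -
      have "a / \<i> * (b * \<i> / F * X) = b * (X / F) * a" if "F \<noteq> 0" for a b F X :: complex
        using that by (simp add: field_simps)
      from this[of "fact n" "r ^ n" "2 * pi" "(deriv ^^ n) L 0"] show ?thesis by (simp add: d_def)
    qed
    finally show ?thesis .
  qed
  have mean: "(f has_integral (2 * pi * L 0)) {0..2 * pi}"
  proof -
    have "((\<lambda>u. L u / (u - 0) ^ Suc 0) has_contour_integral (2 * pi * \<i> / fact 0 * (deriv ^^ 0) L 0)) (circlepath 0 r)"
      by (rule Cauchy_has_contour_integral_higher_derivative_circlepath[OF cont hol]) (use r in auto)
    from has_integral_mult_right[OF circle_has_integral[OF this], of "1 / \<i>"]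
    moreover have "\<i> * (X * \<i>) = - X" "\<i> * (X * \<i> * Y) = - (X * Y)" for X Y :: complex
      by (simp_all add: complex_eq_iff)
    ultimately show ?thesis using r by (simp add: f_def)
  qed
  \<comment> \<open>On the circle the conjugate of \<open>g\<close> has only nonpositive
    frequencies, so multiplication by \<open>cis (- (real n * t))\<close> with \<open>n > 0\<close>
    leaves no constant term.\<close>
  have low: "((\<lambda>t. cnj (g (r * cis t)) * cis (- (real n * t))) has_integral 0) {0..2 * pi}"
    if g: "g holomorphic_on ball 0 1" for g
  proof -
    have "((\<lambda>u. g u * u ^ (n - 1)) has_contour_integral 0) (circlepath 0 r)"
    proof (rule Cauchy_theorem_convex_simple[where S = "ball 0 1"])
      show "(\<lambda>u. g u * u ^ (n - 1)) holomorphic_on ball 0 1" by (intro holomorphic_intros g)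
    qed (use r in \<open>auto simp: path_image_circlepath\<close>)
    from has_integral_mult_right[OF circle_has_integral[OF this], of "1 / (\<i> * r ^ n)"]
    have "((\<lambda>t. 1 / (\<i> * r ^ n) * (g (r * cis t) * (r * cis t) ^ (n - 1) * r * \<i> * cis t)) has_integral 0) {0..2 * pi}" by simp
    also have "(\<lambda>t. 1 / (\<i> * r ^ n) * (g (r * cis t) * (r * cis t) ^ (n - 1) * r * \<i> * cis t)) = (\<lambda>t. g (r * cis t) * cis (real n * t))"
    proof
      fix t
      have rc: "(r * cis t) ^ (n - 1) * (r * cis t) = r ^ n * cis (real n * t)"
      proof -
        have "(r * cis t) ^ (n - 1) * (r * cis t) = (r * cis t) ^ n" by (rule power_minus_mult[OF n])
        also have "\<dots> = r ^ n * cis (real n * t)" by (simp only: power_mult_distrib cisn of_real_power)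
        finally show ?thesis .
      qed
      hence *: "g (r * cis t) * (r * cis t) ^ (n - 1) * r * \<i> * cis t = \<i> * r ^ n * (g (r * cis t) * cis (real n * t))"
      proof -
        have "g (r * cis t) * (r * cis t) ^ (n - 1) * r * \<i> * cis t = \<i> * (g (r * cis t) * ((r * cis t) ^ (n - 1) * (r * cis t)))"
          by (simp only: mult_ac)
        thus ?thesis unfolding rc by (simp only: mult_ac)
      qed
      show "1 / (\<i> * r ^ n) * (g (r * cis t) * (r * cis t) ^ (n - 1) * r * \<i> * cis t) = g (r * cis t) * cis (real n * t)"
        unfolding * using r by simp
    qed
    finally have "((\<lambda>t. g (r * cis t) * cis (real n * t)) has_integral 0) {0..2 * pi}" .
    from has_integral_linear[OF this bounded_linear_cnj] show ?thesis by (simp add: o_def cis_cnj)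
  qed
  \<comment> \<open>The conjugate of \<open>f\<close> and the constant \<open>2 * A\<close>
    contribute nothing at this frequency and turn \<open>f\<close> into a real weight. The weight is
    nonnegative on the circle, so its Fourier coefficient is bounded by its mean, which is known
    from \<open>L 0\<close>.\<close>
  have "((\<lambda>t. cnj (of_real (2 * A)) * cis (- (real n * t)) - (f t * cis (- (real n * t)) + cnj (f t) * cis (- (real n * t))))
      has_integral (0 - (2 * pi * d * r ^ n + 0))) {0..2 * pi}"
    unfolding f_def by (intro has_integral_diff has_integral_add high[unfolded f_def] low[OF L] low) auto
  hence I: "((\<lambda>t. of_real (2 * A - 2 * Re (f t)) * cis (- (real n * t))) has_integral (- (2 * pi * d * r ^ n))) {0..2 * pi}"
    by (simp add: algebra_simps complex_add_cnj flip: distrib_left distrib_right)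
  have "((\<lambda>t. Re (f t)) has_integral Re (2 * pi * L 0)) {0..2 * pi}"
    using has_integral_linear[OF mean bounded_linear_Re] by (simp add: o_def)
  moreover have "((\<lambda>_::real. 2 * A) has_integral (2 * pi * (2 * A))) {0..2 * pi}"
    using has_integral_const_real[of "2 * A" 0 "2 * pi"] by simp
  ultimately have "((\<lambda>t. 2 * A - 2 * Re (f t)) has_integral (2 * pi * (2 * A) - 2 * Re (2 * pi * L 0))) {0..2 * pi}"
    by (intro has_integral_diff has_integral_mult_right)
  hence J: "((\<lambda>t. 2 * A - 2 * Re (f t)) has_integral (4 * pi * (A - Re (L 0)))) {0..2 * pi}"
    by (simp add: algebra_simps)
  have "norm (integral {0..2 * pi} (\<lambda>t. of_real (2 * A - 2 * Re (f t)) * cis (- (real n * t))))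
      \<le> integral {0..2 * pi} (\<lambda>t. 2 * A - 2 * Re (f t))"
  proof (rule integral_norm_bound_integral)
    fix t
    have "Re (f t) \<le> A" unfolding f_def using r by (intro A) (simp add: norm_mult)
    thus "norm (of_real (2 * A - 2 * Re (f t)) * cis (- (real n * t))) \<le> 2 * A - 2 * Re (f t)"
      by (simp add: norm_mult del: of_real_diff of_real_mult)
  qed (use I J has_integral_integrable in blast)+
  hence "norm (- (2 * pi * d * r ^ n)) \<le> 4 * pi * (A - Re (L 0))"
    using integral_unique[OF I] integral_unique[OF J] by simp
  hence "(2 * pi) * (norm d * r ^ n) \<le> (2 * pi) * (2 * (A - Re (L 0)))"
    using r by (simp add: norm_mult norm_power mult_ac)
  thus ?thesis unfolding d_def by (rule mult_left_le_imp_le) simp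
qed

definition disc_coeffs :: "(nat \<Rightarrow> complex) \<Rightarrow> bool" where
  "disc_coeffs a \<longleftrightarrow> (\<forall>r. 0 \<le> r \<longrightarrow> r < 1 \<longrightarrow> summable (\<lambda>k. norm (a k) * r ^ k))"

lemma disc_coeffs_sums:
  assumes "disc_coeffs a" "norm x < 1" shows "(\<lambda>k. a k * x ^ k) sums (\<Sum>k. a k * x ^ k)"
  using assms by (intro summable_sums summable_norm_cancel[of "\<lambda>k. a k * x ^ k"]) (auto simp: disc_coeffs_def norm_mult norm_power)

lemma disc_coeffs_holomorphic:
  assumes "disc_coeffs a" shows "(\<lambda>x. \<Sum>k. a k * x ^ k) holomorphic_on ball 0 1"
  by (rule power_series_holomorphic[where a = a]) (use disc_coeffs_sums[OF assms] in auto)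

lemma disc_coeffs_has_fps_expansion:
  assumes "disc_coeffs a" shows "(\<lambda>x. \<Sum>k. a k * x ^ k) has_fps_expansion Abs_fps a"
proof (rule has_fps_expansionI)
  have "eventually (\<lambda>x. x \<in> ball 0 1) (nhds (0::complex))" by (intro eventually_nhds_in_open) auto
  thus "eventually (\<lambda>x. (\<lambda>k. fps_nth (Abs_fps a) k * x ^ k) sums (\<Sum>k. a k * x ^ k)) (nhds 0)"
    by eventually_elim (use disc_coeffs_sums[OF assms] in auto)
qed

definition pair_series :: "complex \<Rightarrow> complex" where
  "pair_series x = (\<Sum>k. of_nat (num_partition_pairs k) * x ^ k)"

lemma summable_num_partition_pairs:
  fixes q :: real assumes q: "0 < q" "q < 1"
  shows "summable (\<lambda>k. real (num_partition_pairs k) * (q\<^sup>2) ^ k)"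
    "(\<Sum>k. real (num_partition_pairs k) * (q\<^sup>2) ^ k) \<le> exp ((16/3) * (q / (1 - q)))"
proof -
  show *: "summable (\<lambda>k. real (num_partition_pairs k) * (q\<^sup>2) ^ k)"
  proof (rule bounded_imp_summable)
    show "(\<Sum>k\<le>n. real (num_partition_pairs k) * (q\<^sup>2) ^ k) \<le> exp ((16/3) * (q / (1 - q)))" for n
      using sum_num_partition_pairs_le[OF q, of "Suc n"] by (simp only: lessThan_Suc_atMost)
  qed simp
  show "(\<Sum>k. real (num_partition_pairs k) * (q\<^sup>2) ^ k) \<le> exp ((16/3) * (q / (1 - q)))"
    by (rule suminf_le_const[OF *]) (rule sum_num_partition_pairs_le[OF q])
qed

lemma disc_coeffs_pairs: "disc_coeffs (\<lambda>k. of_nat (num_partition_pairs k))"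
  unfolding disc_coeffs_def
proof (intro allI impI)
  fix r :: real assume r: "0 \<le> r" "r < 1"
  \<comment> \<open>The midpoint of \<open>sqrt r\<close> and 1: its square dominates
    \<open>r\<close>, and it stays positive for \<open>r = 0\<close>.\<close>
  define q where "q = (sqrt r + 1) / 2"
  have "sqrt r < 1" using r by (simp add: real_sqrt_lt_1_iff)
  hence q: "0 < q" "q < 1" "sqrt r \<le> q" using r by (auto simp: q_def intro: add_nonneg_pos)
  have "r \<le> q\<^sup>2" using power_mono[OF q(3), of 2] r by simp
  hence "r ^ k \<le> (q\<^sup>2) ^ k" for k using r by (intro power_mono) auto
  hence le: "norm (norm (of_nat (num_partition_pairs k) :: complex) * r ^ k) \<le> real (num_partition_pairs k) * (q\<^sup>2) ^ k" for k
    using r by (simp add: mult_left_mono)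
  show "summable (\<lambda>k. norm (of_nat (num_partition_pairs k) :: complex) * r ^ k)"
    by (rule summable_comparison_test'[OF summable_num_partition_pairs(1)[OF q(1,2)], of 0]) (rule le)
qed

text \<open>Contradicts the estimate of coefficient 39 at \<open>r = (79/80)\<^sup>2\<close> after
  the denominators are cleared. The two sides differ by about 2.5 per cent.\<close>

lemma numeral_bound: "(2528::nat) * 39 * 80 ^ 78 < 89858 * 3 * 79 ^ 78"
  by simp

lemma pair_series_has_zero: "\<exists>x. norm x < 1 \<and> pair_series x = 0"
proof (rule ccontr)
  assume "\<not> ?thesis"
  hence nz: "pair_series x \<noteq> 0" if "x \<in> ball 0 1" for x using that by (simp only: mem_ball_0) blast
  have hol: "pair_series holomorphic_on ball 0 1"
    unfolding pair_series_def[abs_def] by (rule disc_coeffs_holomorphic[OF disc_coeffs_pairs])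
  have fps: "pair_series has_fps_expansion Abs_fps (\<lambda>k. of_nat (num_partition_pairs k))"
    unfolding pair_series_def[abs_def] by (rule disc_coeffs_has_fps_expansion[OF disc_coeffs_pairs])
  have "simply_connected (ball (0::complex) 1)" by (intro convex_imp_simply_connected convex_ball)
  hence "\<forall>f. f holomorphic_on ball 0 1 \<and> (\<forall>z\<in>ball 0 1. f z \<noteq> 0) \<longrightarrow>
      (\<exists>g. g holomorphic_on ball 0 1 \<and> (\<forall>z\<in>ball (0::complex) 1. f z = exp (g z)))"
    unfolding simply_connected_eq_holomorphic_log[OF open_ball] by (rule conjunct2)
  from spec[OF this, of pair_series]
  have "\<exists>L. L holomorphic_on ball 0 1 \<and> (\<forall>x\<in>ball 0 1. pair_series x = exp (L x))"
    using hol nz by (rule mp[OF _ conjI[OF _ ballI]])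
  then obtain L where L: "L holomorphic_on ball 0 1" "\<And>x. x \<in> ball 0 1 \<Longrightarrow> pair_series x = exp (L x)"
    by (elim exE conjE) (rule that, assumption, erule bspec)
  define lam where "lam = fps_expansion L 0"
  have fpsL: "L has_fps_expansion lam"
    unfolding lam_def by (rule has_fps_expansion_fps_expansion[OF _ _ L(1)]) auto
  define N where "N = (\<lambda>k. of_nat (num_partition_pairs k) :: complex)"
  have "deriv pair_series has_fps_expansion fps_deriv (Abs_fps N)"
    unfolding N_def by (rule has_fps_expansion_deriv[OF fps])
  moreover have "(\<lambda>x. deriv L x * pair_series x) has_fps_expansion fps_deriv lam * Abs_fps N"
    unfolding N_def by (intro has_fps_expansion_mult has_fps_expansion_deriv fps fpsL)
  moreover have "eventually (\<lambda>x. deriv pair_series x = deriv L x * pair_series x) (nhds 0)"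
  proof -
    have "eventually (\<lambda>x. x \<in> ball 0 1) (nhds (0::complex))" by (intro eventually_nhds_in_open) auto
    thus ?thesis
    proof eventually_elim
      case (elim x)
      have "(L has_field_derivative deriv L x) (at x)" by (rule holomorphic_derivI[OF L(1) open_ball elim])
      hence "((\<lambda>x. exp (L x)) has_field_derivative exp (L x) * deriv L x) (at x)" by (rule DERIV_fun_exp)
      hence "(pair_series has_field_derivative exp (L x) * deriv L x) (at x)"
        by (rule has_field_derivative_transform_within_open[OF _ open_ball elim]) (simp only: L(2))
      hence "deriv pair_series x = exp (L x) * deriv L x" by (rule DERIV_imp_deriv)
      thus ?case unfolding L(2)[OF elim] by (simp only: mult.commute)
    qed
  qed
  ultimately have "fps_deriv (Abs_fps N) = fps_deriv lam * Abs_fps N"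
    using has_fps_expansion_cong[OF _ refl, of "deriv pair_series" "\<lambda>x. deriv L x * pair_series x"]
    by (intro fps_expansion_unique_complex[of "deriv pair_series"]) auto
  hence co: "of_nat (Suc n) * N (Suc n) = (\<Sum>i=0..n. of_nat (Suc i) * fps_nth lam (Suc i) * N (n - i))" for n
    by (auto simp: fps_eq_iff fps_mult_nth)
  define b where "b = (\<lambda>k. of_nat k * fps_nth lam k)"
  have rec: "of_nat n * N n = (\<Sum>k=1..n. b k * N (n - k))" if "n \<ge> 1" for n
  proof -
    obtain j where j: "n = Suc j" using \<open>n \<ge> 1\<close> by (cases n) auto
    have "(\<Sum>k=1..n. b k * N (n - k)) = (\<Sum>i=0..j. b (Suc i) * N (j - i))"
      unfolding j One_nat_def by (subst sum.shift_bounds_cl_Suc_ivl) simp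
    thus ?thesis using co[of j] by (simp add: j b_def)
  qed
  have "b 39 = - 89858"
    by (rule newton_sum_value[OF _ newton_sum_39 num_partition_pairs_0_3(1)]) (use rec in \<open>simp add: N_def\<close>)
  hence "39 * ((deriv ^^ 39) L 0 / fact 39) = - 89858"
    unfolding b_def lam_def fps_expansion_def by simp
  hence "norm (39 * ((deriv ^^ 39) L 0 / fact 39)) = norm (- 89858 :: complex)" by (rule arg_cong)
  hence "39 * norm ((deriv ^^ 39) L 0 / fact 39) = 89858"
    by (simp only: norm_mult norm_numeral norm_minus_cancel)
  hence l39: "norm ((deriv ^^ 39) L 0 / fact 39) = 89858 / 39" by linarith
  \<comment> \<open>The bound for \<open>ln F\<close> is stated at squares \<open>q\<^sup>2\<close>.
    The choice \<open>q = 79/80\<close> nearly minimises \<open>q / (1 - q) * q powr - 78\<close>,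
    to which the bound for coefficient 39 is proportional. Here
    \<open>2 * A = 2528 / 3\<close>.\<close>
  define r A where "r = (79/80 :: real)\<^sup>2" and "A = (16/3) * ((79/80) / (1 - 79/80) :: real)"
  have "norm ((deriv ^^ 39) L 0 / fact 39) * r ^ 39 \<le> 2 * (A - Re (L 0))"
  proof (rule higher_deriv_le_Re_bound[OF L(1)])
    show "0 < r" "r < 1" by (auto simp: r_def power2_eq_square)
    fix x :: complex assume x: "norm x = r"
    have xb: "x \<in> ball 0 1" using x by (simp add: r_def power2_eq_square)
    have "norm (pair_series x) \<le> (\<Sum>k. real (num_partition_pairs k) * r ^ k)"
      unfolding pair_series_def
      by (rule norm_suminf_le) (use x summable_num_partition_pairs(1)[of "79/80"] in \<open>auto simp: norm_mult norm_power r_def\<close>)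
    also have "\<dots> \<le> exp A" unfolding r_def A_def by (rule summable_num_partition_pairs(2)) auto
    finally have "exp (Re (L x)) \<le> exp A" using L(2)[OF xb] by simp
    thus "Re (L x) \<le> A" by simp
  qed simp
  \<comment> \<open>\<open>L 0\<close> is some logarithm of \<open>F 0 = 1\<close>; its imaginary
    part remains open but does not enter the estimate.\<close>
  moreover have "Re (L 0) = 0"
  proof -
    have "exp (L 0) = pair_series 0" by (rule L(2)[symmetric]) simp
    also have "\<dots> = 1" unfolding pair_series_def by (subst powser_zero) (simp add: num_partition_pairs_0_3)
    finally have "norm (exp (L 0)) = 1" by simp
    thus ?thesis by simp
  qed
  ultimately have "89858 / 39 * r ^ 39 \<le> 2528 / 3" unfolding l39 A_def by simp
  moreover have "r ^ 39 = 79 ^ 78 / 80 ^ 78" unfolding r_def power_mult[symmetric] by (simp add: power_divide)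
  ultimately have le: "89858 / 39 * (79 ^ 78 / 80 ^ 78) \<le> (2528 / 3 :: real)" by simp
  have pos: "(0::real) < 80 ^ 78" by (rule zero_less_power) simp
  have "a * 3 * x \<le> b * 39 * y" if "a / 39 * (x / y) \<le> b / 3" "y > 0" for a b x y :: real
    using that by (simp add: divide_simps mult_ac)
  from this[OF le pos] have "89858 * 3 * 79 ^ 78 \<le> (2528 * 39 * 80 ^ 78 :: real)" .
  hence "real (89858 * 3 * 79 ^ 78) \<le> real (2528 * 39 * 80 ^ 78)"
    by (simp only: of_nat_mult of_nat_power of_nat_numeral)
  hence "89858 * 3 * 79 ^ 78 \<le> (2528 * 39 * 80 ^ 78 :: nat)" by (simp only: of_nat_le_iff)
  thus False using numeral_bound by (rule leD[THEN notE])
qed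

subsection \<open>The Riemann zeta function\<close>

lemma holomorphic_suminf:
  fixes f :: "nat \<Rightarrow> complex \<Rightarrow> complex"
  assumes S: "open S" and hol: "\<And>n. f n holomorphic_on S"
    and bd: "\<And>x. x \<in> S \<Longrightarrow> \<exists>d>0. \<exists>M. summable M \<and> cball x d \<subseteq> S \<and> (\<forall>n. \<forall>z\<in>cball x d. norm (f n z) \<le> M n)"
  shows "(\<lambda>z. \<Sum>n. f n z) holomorphic_on S"
proof (rule holomorphic_uniform_sequence[OF S, where f = "\<lambda>N z. \<Sum>n<N. f n z"])
  show "(\<lambda>z. \<Sum>n<N. f n z) holomorphic_on S" for N using hol by (intro holomorphic_intros)
  fix x assume "x \<in> S"
  from bd[OF this] obtain d M where d: "d > 0" "summable M" "cball x d \<subseteq> S" "\<forall>n. \<forall>z\<in>cball x d. norm (f n z) \<le> M n"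
    by (elim exE conjE)
  have "uniform_limit (cball x d) (\<lambda>N z. \<Sum>n<N. f n z) (\<lambda>z. \<Sum>n. f n z) sequentially"
    by (rule Weierstrass_m_test[where M = M]) (use d in auto)
  thus "\<exists>d>0. cball x d \<subseteq> S \<and> uniform_limit (cball x d) (\<lambda>N z. \<Sum>n<N. f n z) (\<lambda>z. \<Sum>n. f n z) sequentially"
    using d(1,3) by (intro exI[of _ d] conjI)
qed

lemma norm_Suc_powr: "norm (of_nat (Suc n) powr s :: complex) = real (Suc n) powr Re s"
  by (subst norm_powr_real_powr) (auto simp: Reals_of_nat)

lemma summable_Suc_powr:
  fixes x :: real assumes "x > 1" shows "summable (\<lambda>n. real (Suc n) powr (- x))"
proof -
  have "summable (\<lambda>n. real n powr (- x))" using assms by (subst summable_real_powr_iff) auto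
  thus ?thesis by (subst summable_Suc_iff)
qed

lemma Suc_powr_mono: "x \<le> y \<Longrightarrow> real (Suc n) powr (- y) \<le> real (Suc n) powr (- x)"
  by (intro powr_mono) auto

lemma Re_ge_on_cball: "z \<in> cball x d \<Longrightarrow> Re z \<ge> Re x - d"
  using abs_Re_le_cmod[of "x - z"] by (simp add: dist_norm)

section \<open>Polynomial growth on half-planes\<close>

definition poly_bounded_on :: "complex set \<Rightarrow> (complex \<Rightarrow> complex) \<Rightarrow> bool" where
  "poly_bounded_on S f \<longleftrightarrow> (\<exists>C\<ge>0. \<exists>A::nat. \<forall>s\<in>S. norm (f s) \<le> C * (1 + norm s) ^ A)"

lemma poly_bounded_onI:
  assumes "\<And>s. s \<in> S \<Longrightarrow> norm (f s) \<le> C * (1 + norm s) ^ A" shows "poly_bounded_on S f"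
  unfolding poly_bounded_on_def
proof (intro exI[of _ "max C 0"] conjI exI[of _ A] ballI)
  fix s assume "s \<in> S"
  have "C * (1 + norm s) ^ A \<le> max C 0 * (1 + norm s) ^ A" by (intro mult_right_mono) auto
  thus "norm (f s) \<le> max C 0 * (1 + norm s) ^ A" using assms[OF \<open>s \<in> S\<close>] by linarith
qed auto

lemma poly_bounded_on_const [intro]: "poly_bounded_on S (\<lambda>_. c)"
  by (rule poly_bounded_onI[where C = "norm c" and A = 0]) auto

lemma poly_bounded_on_ident [intro]: "poly_bounded_on S (\<lambda>s. s)"
  by (rule poly_bounded_onI[where C = 1 and A = 1]) auto

lemma poly_bounded_on_mult [intro]:
  assumes "poly_bounded_on S f" "poly_bounded_on S g" shows "poly_bounded_on S (\<lambda>s. f s * g s)"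
proof -
  obtain C A D B where *: "C \<ge> 0" "D \<ge> 0" "\<And>s. s \<in> S \<Longrightarrow> norm (f s) \<le> C * (1 + norm s) ^ A"
    "\<And>s. s \<in> S \<Longrightarrow> norm (g s) \<le> D * (1 + norm s) ^ B"
    using assms unfolding poly_bounded_on_def by blast
  show ?thesis
  proof (rule poly_bounded_onI[where C = "C * D" and A = "A + B"])
    fix s assume "s \<in> S"
    have "norm (f s * g s) \<le> (C * (1 + norm s) ^ A) * (D * (1 + norm s) ^ B)"
      unfolding norm_mult using *(1,2) by (intro mult_mono *(3,4) \<open>s \<in> S\<close>) auto
    thus "norm (f s * g s) \<le> C * D * (1 + norm s) ^ (A + B)" by (simp add: power_add mult_ac)
  qed
qed

lemma poly_bounded_on_add [intro]:
  assumes "poly_bounded_on S f" "poly_bounded_on S g" shows "poly_bounded_on S (\<lambda>s. f s + g s)"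
proof -
  obtain C A D B where *: "C \<ge> 0" "D \<ge> 0" "\<And>s. s \<in> S \<Longrightarrow> norm (f s) \<le> C * (1 + norm s) ^ A"
    "\<And>s. s \<in> S \<Longrightarrow> norm (g s) \<le> D * (1 + norm s) ^ B"
    using assms unfolding poly_bounded_on_def by blast
  show ?thesis
  proof (rule poly_bounded_onI[where C = "C + D" and A = "A + B"])
    fix s assume "s \<in> S"
    have "C * (1 + norm s) ^ A \<le> C * (1 + norm s) ^ (A + B)" "D * (1 + norm s) ^ B \<le> D * (1 + norm s) ^ (A + B)"
      using *(1,2) by (intro mult_left_mono power_increasing; simp)+
    thus "norm (f s + g s) \<le> (C + D) * (1 + norm s) ^ (A + B)"
      using *(3,4)[OF \<open>s \<in> S\<close>] norm_triangle_ineq[of "f s" "g s"] by (simp add: distrib_right)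
  qed
qed

lemma poly_bounded_on_diff [intro]:
  assumes "poly_bounded_on S f" "poly_bounded_on S g" shows "poly_bounded_on S (\<lambda>s. f s - g s)"
  using poly_bounded_on_add[OF assms(1) poly_bounded_on_mult[OF poly_bounded_on_const[of S "-1"] assms(2)]] by simp

lemma poly_bounded_on_sum [intro]:
  "(\<And>i. i \<in> I \<Longrightarrow> poly_bounded_on S (f i)) \<Longrightarrow> poly_bounded_on S (\<lambda>s. \<Sum>i\<in>I. f i s)"
  by (induction I rule: infinite_finite_induct) auto

lemma poly_bounded_on_prod [intro]:
  "(\<And>i. i \<in> I \<Longrightarrow> poly_bounded_on S (f i)) \<Longrightarrow> poly_bounded_on S (\<lambda>s. \<Prod>i\<in>I. f i s)"
  by (induction I rule: infinite_finite_induct) auto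

lemma poly_bounded_on_translate:
  assumes "poly_bounded_on T f" "\<And>s. s \<in> S \<Longrightarrow> s + c \<in> T" shows "poly_bounded_on S (\<lambda>s. f (s + c))"
proof -
  obtain C A where *: "C \<ge> 0" "\<And>s. s \<in> T \<Longrightarrow> norm (f s) \<le> C * (1 + norm s) ^ A"
    using assms unfolding poly_bounded_on_def by blast
  show ?thesis
  proof (rule poly_bounded_onI[where C = "C * (1 + norm c) ^ A" and A = A])
    fix s assume "s \<in> S"
    have "1 + norm (s + c) \<le> (1 + norm c) * (1 + norm s)"
    proof -
      have "0 \<le> norm c * norm s" by simp
      thus ?thesis unfolding distrib_left distrib_right mult_1 mult_1_right
        using norm_triangle_ineq[of s c] by linarith
    qed
    hence "(1 + norm (s + c)) ^ A \<le> ((1 + norm c) * (1 + norm s)) ^ A" by (intro power_mono) auto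
    hence "C * (1 + norm (s + c)) ^ A \<le> C * ((1 + norm c) * (1 + norm s)) ^ A" using *(1) by (rule mult_left_mono)
    thus "norm (f (s + c)) \<le> C * (1 + norm c) ^ A * (1 + norm s) ^ A"
      using *(2)[OF assms(2)[OF \<open>s \<in> S\<close>]] by (simp add: power_mult_distrib mult_ac)
  qed
qed

section \<open>Continuation of the zeta function\<close>

lemma summable_zeta_series:
  assumes "Re s > 1" shows "summable (dirichlet_term (\<lambda>_. 1) s)" "summable (\<lambda>n. norm (dirichlet_term (\<lambda>_. 1) s n))"
proof -
  show *: "summable (\<lambda>n. norm (dirichlet_term (\<lambda>_. 1) s n))"
    unfolding dirichlet_term_def mult_1 norm_Suc_powr using summable_Suc_powr[OF assms] by simp
  show "summable (dirichlet_term (\<lambda>_. 1) s)" by (rule summable_norm_cancel[OF *])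
qed

text \<open>The binomial coefficient of \<open>1 - s\<close> over \<open>k\<close>.\<close>

definition powr_taylor_coeff :: "nat \<Rightarrow> complex \<Rightarrow> complex" where
  "powr_taylor_coeff k s = (\<Prod>i<k. 1 - s - of_nat i) / fact k"

text \<open>
  Remainder of the Taylor expansion of \<open>t \<mapsto> t powr (1 - s)\<close> about \<open>Suc n\<close>, evaluated at \<open>Suc n + 1\<close>.
\<close>

definition powr_taylor_rem :: "nat \<Rightarrow> nat \<Rightarrow> complex \<Rightarrow> complex" where
  "powr_taylor_rem K n s = of_nat (Suc (Suc n)) powr (1 - s)
     - (\<Sum>k\<le>K. powr_taylor_coeff k s * of_nat (Suc n) powr (1 - s - of_nat k))"

text \<open>Taylor's theorem on a segment of length 1. The derivative of order \<open>Suc K\<close>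
  is largest at the left end, because its exponent has negative real part.\<close>

lemma norm_powr_taylor_rem_le:
  assumes "Re s + real K > 0"
  shows "norm (powr_taylor_rem K n s) \<le> norm (\<Prod>i<Suc K. 1 - s - of_nat i) * real (Suc n) powr (- (Re s + real K))"
proof -
  define f where "f = (\<lambda>i (t::complex). (\<Prod>j<i. 1 - s - of_nat j) * t powr (1 - s - of_nat i))"
  define S :: "complex set" where "S = closed_segment (of_nat (Suc n)) (of_nat (Suc (Suc n)))"
  define B where "B = norm (\<Prod>i<Suc K. 1 - s - of_nat i) * real (Suc n) powr (- (Re s + real K))"
  have S: "\<exists>x\<ge>real (Suc n). t = of_real x" if t: "t \<in> S" for t
  proof -
    obtain u where u: "0 \<le> u" "t = (1 - u) *\<^sub>R of_nat (Suc n) + u *\<^sub>R of_nat (Suc (Suc n))"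
      using t unfolding S_def closed_segment_def by blast
    have "t = of_real (real (Suc n) + u)" unfolding u(2) by (simp add: scaleR_conv_of_real algebra_simps)
    thus ?thesis using u(1) by (intro exI[of _ "real (Suc n) + u"]) auto
  qed
  have "norm (f 0 (of_nat (Suc (Suc n))) - (\<Sum>i\<le>K. f i (of_nat (Suc n)) * (of_nat (Suc (Suc n)) - of_nat (Suc n)) ^ i / fact i))
     \<le> B * norm (of_nat (Suc (Suc n)) - of_nat (Suc n) :: complex) ^ Suc K / fact K"
  proof (rule field_Taylor)
    show "convex S" unfolding S_def by (rule convex_closed_segment)
    show "of_nat (Suc n) \<in> S" "of_nat (Suc (Suc n)) \<in> S" unfolding S_def by auto
    fix t assume t: "t \<in> S"
    obtain x where x: "x \<ge> real (Suc n)" "t = of_real x" using S[OF t] by blast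
    have "real (Suc n) > 0" by simp
    hence x0: "x > 0" using x(1) by linarith
    show "(f i has_field_derivative f (Suc i) t) (at t within S)" for i
    proof -
      have "t \<notin> \<real>\<^sub>\<le>\<^sub>0" using x0 x(2) by simp
      hence "((\<lambda>z. z powr (1 - s - of_nat i)) has_field_derivative
          (1 - s - of_nat i) * t powr (1 - s - of_nat i - 1)) (at t within S)"
        by (rule has_field_derivative_at_within[OF has_field_derivative_powr])
      hence "((\<lambda>z. (\<Prod>j<i. 1 - s - of_nat j) * z powr (1 - s - of_nat i)) has_field_derivative
          (\<Prod>j<i. 1 - s - of_nat j) * ((1 - s - of_nat i) * t powr (1 - s - of_nat i - 1))) (at t within S)"
        by (rule DERIV_cmult)
      thus ?thesis by (simp add: f_def mult.assoc diff_diff_eq add.commute)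
    qed
    have "norm (t powr (1 - s - of_nat (Suc K))) = x powr (- (Re s + real K))"
      unfolding x(2) using x0 by (subst norm_powr_real_powr) auto
    also have "\<dots> \<le> real (Suc n) powr (- (Re s + real K))"
      using x assms by (intro powr_mono2') auto
    finally show "norm (f (Suc K) t) \<le> B"
      unfolding f_def B_def norm_mult by (intro mult_left_mono) auto
  qed
  moreover have "of_nat (Suc (Suc n)) - of_nat (Suc n) = (1::complex)" by simp
  moreover have "B / fact K \<le> B / 1"
    using fact_ge_1[of K, where ?'a = real] by (intro divide_left_mono) (auto simp: B_def intro!: mult_nonneg_nonneg prod_nonneg)
  ultimately have "norm (f 0 (of_nat (Suc (Suc n))) - (\<Sum>i\<le>K. f i (of_nat (Suc n)) / fact i)) \<le> B"
    by simp
  thus ?thesis by (simp add: f_def B_def powr_taylor_rem_def powr_taylor_coeff_def)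
qed

text \<open>Summed over \<open>n\<close>, the differences of the powers
  \<open>of_nat (Suc n) powr (1 - s)\<close> telescope to -1. Taylor expansion turns them into
  \<open>(1 - s) * zeta s\<close>, multiples of \<open>zeta (s + k - 1)\<close> for
  \<open>2 \<le> k \<le> K\<close>, and remainders summable for \<open>Re s > 1 - K\<close>. All
  values of zeta but the first are taken further to the right, so the identity extends
  \<open>E\<close> by one unit to the left.\<close>

lemma zeta_continuation_step:
  fixes m :: nat
  assumes E: "E holomorphic_on {s. Re s > 1 - real m}"
    and eq: "\<And>s. Re s > 1 \<Longrightarrow> E s = (s - 1) * dirichlet_series (\<lambda>_. 1) s"
    and pb: "poly_bounded_on {s. Re s \<ge> 3/2 - real m} E"
  shows "\<exists>E'. E' holomorphic_on {s. Re s > 1 - real (Suc m)} \<and>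
     (\<forall>s. Re s > 1 \<longrightarrow> E' s = (s - 1) * dirichlet_series (\<lambda>_. 1) s) \<and>
     poly_bounded_on {s. Re s \<ge> 3/2 - real (Suc m)} E'"
proof -
  define K where "K = Suc m"
  \<comment> \<open>The binomial coefficient without its last factor. Up to sign that factor is
    \<open>s + k - 2\<close>, which is contained in \<open>E (s + (of_nat k - 1))\<close>; so only
    the holomorphic \<open>E\<close> occurs, and not the pole of zeta.\<close>
  define q where "q = (\<lambda>k s. (\<Prod>i<k-1. 1 - s - of_nat i :: complex) / fact k)"
  define R where "R = (\<lambda>s. \<Sum>n. powr_taylor_rem K n s)"
  define E' where "E' = (\<lambda>s. 1 + R s - (\<Sum>k=2..K. q k s * E (s + (of_nat k - 1))))"
  define D where "D = {s. Re s > 1 - real (Suc m)}"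
  have openD: "open D" unfolding D_def by (rule open_halfspace_Re_gt)
  have rem_hol: "powr_taylor_rem K n holomorphic_on D" for n
    unfolding powr_taylor_rem_def[abs_def] powr_taylor_coeff_def by (intro holomorphic_intros) auto
  have Rhol: "R holomorphic_on D" unfolding R_def
  proof (rule holomorphic_suminf[OF openD rem_hol])
    fix x assume x: "x \<in> D"
    define d where "d = (Re x - (1 - real (Suc m))) / 2"
    have d: "d > 0" using x by (simp add: D_def d_def)
    have Re: "Re z + real K \<ge> 1 + d" if "z \<in> cball x d" for z
      using Re_ge_on_cball[OF that] d by (simp add: d_def K_def field_simps)
    have "bounded ((\<lambda>z. \<Prod>i<Suc K. 1 - z - of_nat i) ` cball x d)"
      by (intro compact_imp_bounded compact_continuous_image continuous_intros) auto
    then obtain B where "\<forall>y\<in>(\<lambda>z. \<Prod>i<Suc K. 1 - z - of_nat i) ` cball x d. norm y \<le> B"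
      unfolding bounded_iff by blast
    hence B: "norm (\<Prod>i<Suc K. 1 - z - of_nat i) \<le> B" if "z \<in> cball x d" for z using that by blast
    have "0 \<le> norm (\<Prod>i<Suc K. 1 - x - of_nat i)" by simp
    also have "\<dots> \<le> B" by (rule B) (use d in simp)
    finally have B0: "B \<ge> 0" .
    show "\<exists>d>0. \<exists>M. summable M \<and> cball x d \<subseteq> D \<and> (\<forall>n. \<forall>z\<in>cball x d. norm (powr_taylor_rem K n z) \<le> M n)"
    proof (intro exI conjI allI ballI)
      show "summable (\<lambda>n. B * real (Suc n) powr (- (1 + d)))"
        by (intro summable_mult summable_Suc_powr) (use d in auto)
      show "cball x d \<subseteq> D" using Re d by (force simp: D_def K_def)
      fix n z assume z: "z \<in> cball x d"
      have "norm (powr_taylor_rem K n z) \<le> norm (\<Prod>i<Suc K. 1 - z - of_nat i) * real (Suc n) powr (- (Re z + real K))"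
        by (rule norm_powr_taylor_rem_le) (use Re[OF z] d in linarith)
      also have "\<dots> \<le> B * real (Suc n) powr (- (1 + d))"
        by (rule mult_mono[OF B[OF z] Suc_powr_mono[OF Re[OF z]] B0]) simp
      finally show "norm (powr_taylor_rem K n z) \<le> B * real (Suc n) powr (- (1 + d))" .
    qed (rule d)
  qed
  have hol: "E' holomorphic_on D"
  proof -
    have "(\<lambda>s. E (s + (of_nat k - 1))) holomorphic_on D" if "k \<in> {2..K}" for k
    proof -
      have "(E \<circ> (\<lambda>s. s + (of_nat k - 1))) holomorphic_on D"
      proof (rule holomorphic_on_compose_gen[OF _ E])
        show "(\<lambda>s. s + (of_nat k - 1)) holomorphic_on D" by (intro holomorphic_intros)
        show "(\<lambda>s. s + (of_nat k - 1)) ` D \<subseteq> {s. 1 - real m < Re s}" using that by (auto simp: D_def)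
      qed
      thus ?thesis by (simp add: o_def)
    qed
    thus ?thesis unfolding E'_def q_def using Rhol by (intro holomorphic_intros) auto
  qed
  have val: "E' s = (s - 1) * dirichlet_series (\<lambda>_. 1) s" if s: "Re s > 1" for s
  proof -
    define d where "d = (\<lambda>k. dirichlet_term (\<lambda>_. 1) (s + (of_nat k - 1)))"
    have dsum: "summable (d k)" if "k \<ge> 1" for k
      unfolding d_def by (rule summable_zeta_series(1)) (use s that in auto)
    define g where "g = (\<lambda>n. of_nat (Suc n) powr (1 - s) :: complex)"
    have "(\<lambda>n. real (Suc n) powr (1 - Re s)) \<longlonglongrightarrow> 0"
      by (rule tendsto_neg_powr[OF _ filterlim_compose[OF filterlim_real_sequentially filterlim_Suc]]) (use s in simp)
    hence "(\<lambda>n. norm (g n)) \<longlonglongrightarrow> 0" unfolding g_def norm_Suc_powr by simp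
    hence "g \<longlonglongrightarrow> 0" by (rule tendsto_norm_zero_cancel)
    hence "(\<lambda>n. g (Suc n) - g n) sums (0 - g 0)" by (rule telescope_sums)
    hence tel: "(\<lambda>n. g (Suc n) - g n) sums (- 1)" by (simp add: g_def)
    have "powr_taylor_rem K n s = (g (Suc n) - g n) - (\<Sum>k=1..K. powr_taylor_coeff k s * d k n)" for n
    proof -
      have "(\<Sum>k\<le>K. powr_taylor_coeff k s * of_nat (Suc n) powr (1 - s - of_nat k))
         = g n + (\<Sum>k=1..K. powr_taylor_coeff k s * of_nat (Suc n) powr (1 - s - of_nat k))"
        by (simp add: g_def sum.atMost_shift sum.atLeast_Suc_atMost_Suc_shift powr_taylor_coeff_def
              atLeast0LessThan lessThan_Suc_atMost[symmetric] sum.lessThan_Suc_shift sum.atLeast1_atMost_eq del: sum.lessThan_Suc)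
      also have "(\<Sum>k=1..K. powr_taylor_coeff k s * of_nat (Suc n) powr (1 - s - of_nat k)) = (\<Sum>k=1..K. powr_taylor_coeff k s * d k n)"
        by (simp add: d_def dirichlet_term_def algebra_simps)
      finally show ?thesis by (simp add: powr_taylor_rem_def g_def)
    qed
    moreover have "(\<lambda>n. (g (Suc n) - g n) - (\<Sum>k=1..K. powr_taylor_coeff k s * d k n)) sums
        (- 1 - (\<Sum>k=1..K. powr_taylor_coeff k s * (\<Sum>n. d k n)))"
      by (intro sums_diff tel sums_sum sums_mult summable_sums dsum) auto
    ultimately have "R s = - 1 - (\<Sum>k=1..K. powr_taylor_coeff k s * (\<Sum>n. d k n))"
      unfolding R_def by (simp add: sums_iff)
    also have "(\<Sum>k=1..K. powr_taylor_coeff k s * (\<Sum>n. d k n)) =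
       powr_taylor_coeff 1 s * (\<Sum>n. d 1 n) + (\<Sum>k=2..K. powr_taylor_coeff k s * (\<Sum>n. d k n))"
      by (subst sum.atLeast_Suc_atMost) (auto simp: K_def numeral_2_eq_2)
    also have "powr_taylor_coeff 1 s * (\<Sum>n. d 1 n) = - (s - 1) * dirichlet_series (\<lambda>_. 1) s"
      by (simp add: powr_taylor_coeff_def d_def dirichlet_series_def)
    also have "(\<Sum>k=2..K. powr_taylor_coeff k s * (\<Sum>n. d k n)) = - (\<Sum>k=2..K. q k s * E (s + (of_nat k - 1)))"
      unfolding sum_negf[symmetric]
    proof (rule sum.cong[OF refl])
      fix k assume k: "k \<in> {2..K}"
      then obtain j where j: "k = Suc (Suc j)" by (metis Suc_le_D atLeastAtMost_iff numeral_2_eq_2 Suc_le_mono)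
      have c: "powr_taylor_coeff k s = q k s * (1 - s - of_nat (Suc j))"
        by (simp add: powr_taylor_coeff_def q_def j)
      have "E (s + (of_nat k - 1)) = (s + (of_nat k - 1) - 1) * (\<Sum>n. d k n)"
        using s by (subst eq) (auto simp: d_def dirichlet_series_def j)
      also have "s + (of_nat k - 1) - 1 = - (1 - s - of_nat (Suc j))" by (simp add: j)
      finally show "powr_taylor_coeff k s * (\<Sum>n. d k n) = - (q k s * E (s + (of_nat k - 1)))"
        unfolding c by (simp only: mult_minus_left mult_minus_right minus_minus mult.assoc)
    qed
    finally have "R s = - 1 - (- (s - 1) * dirichlet_series (\<lambda>_. 1) s + - (\<Sum>k=2..K. q k s * E (s + (of_nat k - 1))))" .
    thus ?thesis unfolding E'_def by (simp add: algebra_simps)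
  qed
  define T where "T = {s. Re s \<ge> 3/2 - real (Suc m)}"
  have "poly_bounded_on T R"
  proof -
    define C where "C = (\<Sum>n. real (Suc n) powr (- (3/2)))"
    have sC: "summable (\<lambda>n. real (Suc n) powr (- (3/2)))" by (rule summable_Suc_powr) simp
    have "poly_bounded_on T (\<lambda>s. (\<Prod>i<Suc K. 1 - s - of_nat i) * of_real C)"
      by (intro poly_bounded_on_mult poly_bounded_on_prod poly_bounded_on_diff poly_bounded_on_const poly_bounded_on_ident)
    then obtain B A where BA: "\<And>s. s \<in> T \<Longrightarrow> norm ((\<Prod>i<Suc K. 1 - s - of_nat i) * of_real C) \<le> B * (1 + norm s) ^ A"
      unfolding poly_bounded_on_def by blast
    show ?thesis
    proof (rule poly_bounded_onI)
      fix s assume s: "s \<in> T"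
      have Re: "Re s + real K \<ge> 3/2" using s by (simp add: T_def K_def)
      let ?c = "norm (\<Prod>i<Suc K. 1 - s - of_nat i)"
      have le: "norm (powr_taylor_rem K n s) \<le> ?c * real (Suc n) powr (- (3/2))" for n
      proof -
        have "norm (powr_taylor_rem K n s) \<le> ?c * real (Suc n) powr (- (Re s + real K))"
          by (rule norm_powr_taylor_rem_le) (use Re in linarith)
        also have "\<dots> \<le> ?c * real (Suc n) powr (- (3/2))"
          by (rule mult_left_mono[OF Suc_powr_mono[OF Re]]) simp
        finally show ?thesis .
      qed
      have "norm (R s) \<le> (\<Sum>n. ?c * real (Suc n) powr (- (3/2)))"
        unfolding R_def by (rule norm_suminf_le[OF le]) (intro summable_mult sC)
      also have "\<dots> = ?c * C" unfolding C_def by (rule suminf_mult[OF sC])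
      also have "\<dots> = norm ((\<Prod>i<Suc K. 1 - s - of_nat i) * of_real C)"
      proof -
        have "C \<ge> 0" unfolding C_def by (rule suminf_nonneg[OF sC]) simp
        thus ?thesis by (simp only: norm_mult norm_of_real abs_of_nonneg)
      qed
      also have "\<dots> \<le> B * (1 + norm s) ^ A" by (rule BA[OF s])
      finally show "norm (R s) \<le> B * (1 + norm s) ^ A" .
    qed
  qed
  moreover have "poly_bounded_on T (\<lambda>s. q k s * E (s + (of_nat k - 1)))" if "k \<in> {2..K}" for k
  proof (rule poly_bounded_on_mult)
    have "poly_bounded_on T (\<lambda>s. (\<Prod>i<k-1. 1 - s - of_nat i) * (1 / fact k))"
      by (intro poly_bounded_on_mult poly_bounded_on_prod poly_bounded_on_diff poly_bounded_on_const poly_bounded_on_ident)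
    thus "poly_bounded_on T (q k)" by (simp add: q_def)
    show "poly_bounded_on T (\<lambda>s. E (s + (of_nat k - 1)))"
      by (rule poly_bounded_on_translate[OF pb]) (use that in \<open>auto simp: T_def\<close>)
  qed
  ultimately have "poly_bounded_on T E'" unfolding E'_def 
    by (intro poly_bounded_on_diff poly_bounded_on_add poly_bounded_on_sum poly_bounded_on_const)
  thus ?thesis using hol val unfolding D_def T_def by blast
qed

text \<open>The growth bound is claimed half a unit inside the half-plane of holomorphy; there, up
  to polynomial factors, the series are dominated by the sum of
  \<open>real (Suc n) powr (- (3/2))\<close>.\<close>

lemma zeta_continuation:
  fixes m :: nat
  shows "\<exists>E. E holomorphic_on {s. Re s > 1 - real m} \<and>
     (\<forall>s. Re s > 1 \<longrightarrow> E s = (s - 1) * dirichlet_series (\<lambda>_. 1) s) \<and>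
     poly_bounded_on {s. Re s \<ge> 3/2 - real m} E"
proof (induction m)
  case 0
  define S where "S = {s. Re s > 1}"
  have openS: "open S" unfolding S_def by (rule open_halfspace_Re_gt)
  have "dirichlet_series (\<lambda>_. 1) holomorphic_on S"
    unfolding dirichlet_series_def[abs_def]
  proof (rule holomorphic_suminf[OF openS])
    show "(\<lambda>s. dirichlet_term (\<lambda>_. 1) s n) holomorphic_on S" for n
      unfolding dirichlet_term_def by (intro holomorphic_intros)
    fix x assume x: "x \<in> S"
    define d where "d = (Re x - 1) / 2"
    have d: "d > 0" using x by (simp add: S_def d_def)
    have Re: "Re z \<ge> 1 + d" if "z \<in> cball x d" for z
      using Re_ge_on_cball[OF that] d by (simp add: d_def field_simps)
    show "\<exists>d>0. \<exists>M. summable M \<and> cball x d \<subseteq> S \<and> (\<forall>n. \<forall>z\<in>cball x d. norm (dirichlet_term (\<lambda>_. 1) z n) \<le> M n)"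
    proof (intro exI conjI allI ballI)
      show "summable (\<lambda>n. real (Suc n) powr (- (1 + d)))" by (rule summable_Suc_powr) (use d in auto)
      show "cball x d \<subseteq> S" using Re d by (force simp: S_def)
      fix n z assume z: "z \<in> cball x d"
      show "norm (dirichlet_term (\<lambda>_. 1) z n) \<le> real (Suc n) powr (- (1 + d))"
        unfolding dirichlet_term_def mult_1 norm_Suc_powr using Suc_powr_mono[OF Re[OF z]] by simp
    qed (rule d)
  qed
  hence "(\<lambda>s. (s - 1) * dirichlet_series (\<lambda>_. 1) s) holomorphic_on S" by (intro holomorphic_intros)
  moreover have "poly_bounded_on {s. Re s \<ge> 3/2} (dirichlet_series (\<lambda>_. 1))"
  proof (rule poly_bounded_onI[where A = 0])
    fix s assume s: "s \<in> {s. Re s \<ge> 3/2}"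
    have sC: "summable (\<lambda>n. real (Suc n) powr (- (3/2)))" by (rule summable_Suc_powr) simp
    have "norm (dirichlet_series (\<lambda>_. 1) s) \<le> (\<Sum>n. real (Suc n) powr (- (3/2)))"
      unfolding dirichlet_series_def
    proof (rule norm_suminf_le[OF _ sC])
      show "norm (dirichlet_term (\<lambda>_. 1) s n) \<le> real (Suc n) powr (- (3/2))" for n
        unfolding dirichlet_term_def mult_1 norm_Suc_powr using s Suc_powr_mono[of "3/2" "Re s" n] by simp
    qed
    thus "norm (dirichlet_series (\<lambda>_. 1) s) \<le> (\<Sum>n. real (Suc n) powr (- (3/2))) * (1 + norm s) ^ 0" by simp
  qed
  hence "poly_bounded_on {s. Re s \<ge> 3/2} (\<lambda>s. (s - 1) * dirichlet_series (\<lambda>_. 1) s)"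
    by (intro poly_bounded_on_mult poly_bounded_on_diff poly_bounded_on_const poly_bounded_on_ident)
  ultimately show ?case unfolding S_def by (intro exI[of _ "\<lambda>s. (s - 1) * dirichlet_series (\<lambda>_. 1) s"]) auto
next
  case (Suc m)
  then obtain E where "E holomorphic_on {s. Re s > 1 - real m}"
     "\<And>s. Re s > 1 \<Longrightarrow> E s = (s - 1) * dirichlet_series (\<lambda>_. 1) s"
     "poly_bounded_on {s. Re s \<ge> 3/2 - real m} E" by blast
  thus ?case by (rule zeta_continuation_step)
qed

lemma ex_entire_zeta:
  "\<exists>E. E holomorphic_on UNIV \<and> (\<forall>s. Re s > 1 \<longrightarrow> E s = (s - 1) * dirichlet_series (\<lambda>_. 1) s) \<and>
     (\<forall>m::nat. poly_bounded_on {s. Re s \<ge> 3/2 - real m} E)"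
proof -
  obtain E where E: "\<And>m. E m holomorphic_on {s. Re s > 1 - real m}"
     "\<And>m s. Re s > 1 \<Longrightarrow> E m s = (s - 1) * dirichlet_series (\<lambda>_. 1) s"
     "\<And>m. poly_bounded_on {s. Re s \<ge> 3/2 - real m} (E m)" using zeta_continuation by metis
  have agree: "E m s = E k s" if "Re s > 1 - real m" "m \<le> k" for m k s
  proof (rule analytic_continuation_open[where f = "E m" and g = "E k" and z = s and s = "{s. Re s > 1}" and s' = "{s. Re s > 1 - real m}"])
    show "E k holomorphic_on {s. 1 - real m < Re s}" by (rule holomorphic_on_subset[OF E(1)]) (use that(2) in auto)
    show "E m holomorphic_on {s. 1 - real m < Re s}" by (rule E(1))
    show "open {s. 1 - real m < Re s}" "open {s. 1 < Re s}" by (rule open_halfspace_Re_gt)+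
    show "connected {s. 1 - real m < Re s}" by (rule convex_connected[OF convex_halfspace_Re_gt])
    have "(2::complex) \<in> {s. 1 < Re s}" by simp
    thus "{s. 1 < Re s} \<noteq> {}" by blast
    show "E m z = E k z" if "z \<in> {s. 1 < Re s}" for z using that by (simp add: E(2))
  qed (use that in auto)
  \<comment> \<open>This index \<open>m\<close> satisfies \<open>1 - real m < Re s\<close>, and by
    \<open>agree\<close> any other such index gives the same value.\<close>
  define e where "e = (\<lambda>s. E (nat \<lceil>2 - Re s\<rceil>) s)"
  have e: "e s = E m s" if "Re s > 1 - real m" for s m
  proof -
    have "Re s > 1 - real (nat \<lceil>2 - Re s\<rceil>)" by linarith
    thus ?thesis unfolding e_def using agree that by (metis nle_le)
  qed
  have "e holomorphic_on UNIV"
  proof -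
    have "e holomorphic_on (\<Union>m. {s. Re s > 1 - real m})"
      by (rule holomorphic_on_UN_open) (use e in \<open>auto intro: holomorphic_transform[OF E(1)] open_halfspace_Re_gt\<close>)
    moreover have "(\<Union>m. {s. Re s > 1 - real m}) = UNIV"
    proof (intro equalityI subsetI)
      fix s :: complex
      have "Re s > 1 - real (nat \<lceil>2 - Re s\<rceil>)" by linarith
      thus "s \<in> (\<Union>m. {s. Re s > 1 - real m})" by blast
    qed auto
    ultimately show ?thesis by simp
  qed
  moreover have "e s = (s - 1) * dirichlet_series (\<lambda>_. 1) s" if "Re s > 1" for s
    using e[of 0 s] E(2)[OF that] that by simp
  moreover have "poly_bounded_on {s. Re s \<ge> 3/2 - real m} e" for m
  proof -
    have "e s = E m s" if "s \<in> {s. Re s \<ge> 3/2 - real m}" for s using e[of m s] that by simp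
    thus ?thesis using E(3)[of m] unfolding poly_bounded_on_def by simp
  qed
  ultimately show ?thesis by blast
qed

text \<open>Uniqueness is the identity theorem on the connected punctured plane. Division by zero
  yields the conventional value 0 at the pole.\<close>

lemma riemann_zeta_eq_entire_div:
  assumes E: "E holomorphic_on UNIV" "\<And>s. Re s > 1 \<Longrightarrow> E s = (s - 1) * dirichlet_series (\<lambda>_. 1) s"
  shows "riemann_zeta = (\<lambda>s. E s / (s - 1))"
  unfolding riemann_zeta_def
proof (rule the_equality)
  let ?f = "\<lambda>s. E s / (s - 1)"
  have f: "?f holomorphic_on - {1}"
    by (intro holomorphic_intros holomorphic_on_subset[OF E(1)]) auto
  have fs: "?f s = dirichlet_series (\<lambda>_. 1) s" if "Re s > 1" for s
  proof -
    have "s \<noteq> 1" using that by auto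
    thus ?thesis using E(2)[OF that] by simp
  qed
  show "?f holomorphic_on - {1} \<and> ?f 1 = 0 \<and> (\<forall>s. Re s > 1 \<longrightarrow> ?f s = dirichlet_series (\<lambda>_. 1) s)"
    using f fs by simp
  fix g assume g: "g holomorphic_on - {1} \<and> g 1 = 0 \<and> (\<forall>s. Re s > 1 \<longrightarrow> g s = dirichlet_series (\<lambda>_. 1) s)"
  show "g = ?f"
  proof
    fix s
    show "g s = ?f s"
    proof (cases "s = 1")
      case False
      show ?thesis
      proof (rule analytic_continuation_open[where f = g and g = ?f and z = s and s = "{s. Re s > 1}" and s' = "- {1}"])
        show "open {s. 1 < Re s}" by (rule open_halfspace_Re_gt)
        have "(2::complex) \<in> {s. 1 < Re s}" by simp
        thus "{s. 1 < Re s} \<noteq> {}" by blast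
        show "connected (- {1::complex})" by (rule connected_punctured_universe) simp
      qed (use g f fs False in auto)
    qed (use g in simp)
  qed
qed

text \<open>The entire function \<open>(s - 1) * zeta s\<close>. Using it keeps the pole out of the
  growth bounds and of the count of zeros.\<close>

definition zeta_entire :: "complex \<Rightarrow> complex" where
  "zeta_entire = (SOME E. E holomorphic_on UNIV \<and>
     (\<forall>s. Re s > 1 \<longrightarrow> E s = (s - 1) * dirichlet_series (\<lambda>_. 1) s) \<and>
     (\<forall>m::nat. poly_bounded_on {s. Re s \<ge> 3/2 - real m} E))"

lemma zeta_entire:
  "zeta_entire holomorphic_on UNIV"
  "Re s > 1 \<Longrightarrow> zeta_entire s = (s - 1) * dirichlet_series (\<lambda>_. 1) s"
  "poly_bounded_on {s. Re s \<ge> 3/2 - real m} zeta_entire"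
  "riemann_zeta s = zeta_entire s / (s - 1)"
proof -
  have *: "zeta_entire holomorphic_on UNIV \<and>
     (\<forall>s. Re s > 1 \<longrightarrow> zeta_entire s = (s - 1) * dirichlet_series (\<lambda>_. 1) s) \<and>
     (\<forall>m::nat. poly_bounded_on {s. Re s \<ge> 3/2 - real m} zeta_entire)"
    unfolding zeta_entire_def by (rule someI_ex[OF ex_entire_zeta])
  thus hol: "zeta_entire holomorphic_on UNIV"
    and "poly_bounded_on {s. Re s \<ge> 3/2 - real m} zeta_entire" by blast+
  have val: "zeta_entire s = (s - 1) * dirichlet_series (\<lambda>_. 1) s" if "Re s > 1" for s
    using * that by blast
  show "Re s > 1 \<Longrightarrow> zeta_entire s = (s - 1) * dirichlet_series (\<lambda>_. 1) s" by (rule val)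
  show "riemann_zeta s = zeta_entire s / (s - 1)" using riemann_zeta_eq_entire_div[OF hol val] by (rule fun_cong)
qed

lemma riemann_zeta_eq_series: "Re s > 1 \<Longrightarrow> riemann_zeta s = dirichlet_series (\<lambda>_. 1) s"
  by (cases "s = 1") (auto simp: zeta_entire)

lemma riemann_zeta_holomorphic: "riemann_zeta holomorphic_on - {1}"
  unfolding zeta_entire(4)[abs_def]
  by (intro holomorphic_intros holomorphic_on_subset[OF zeta_entire(1)]) auto

lemma riemann_zeta_meromorphic: "riemann_zeta meromorphic_on UNIV"
  unfolding zeta_entire(4)[abs_def]
  by (intro meromorphic_intros analytic_on_imp_meromorphic_on)
     (use zeta_entire(1) in \<open>auto simp: analytic_on_open\<close>)

section \<open>Counting the zeros of zeta\<close>

lemma factor_out_zeros: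
  assumes "open S" "finite Z" "Z \<subseteq> S" "f holomorphic_on S" "\<And>z. z \<in> Z \<Longrightarrow> f z = (0::complex)"
  shows "\<exists>g. g holomorphic_on S \<and> (\<forall>z\<in>S. f z = g z * (\<Prod>a\<in>Z. z - a))"
  using assms(2-5)
proof (induction Z arbitrary: f rule: finite_induct)
  case empty
  thus ?case by (intro exI[of _ f]) auto
next
  case (insert a Z)
  define h where "h = (\<lambda>z. if z = a then deriv f a else (f z - f a) / (z - a))"
  have a: "a \<in> S" "f a = 0" using insert.prems by auto
  have h: "h holomorphic_on S"
    unfolding h_def by (rule pole_lemma[OF insert.prems(2)]) (use a assms(1) in \<open>simp add: interior_open\<close>)
  have fh: "f z = h z * (z - a)" for z using a(2) by (simp add: h_def)
  have "h z = 0" if "z \<in> Z" for z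
    using insert.prems(3)[of z] insert.hyps(2) that fh[of z] by auto
  then obtain g where g: "g holomorphic_on S" "\<forall>z\<in>S. h z = g z * (\<Prod>a\<in>Z. z - a)"
    using insert.IH[OF _ h] insert.prems(1) by auto
  have "f z = g z * (\<Prod>a\<in>insert a Z. z - a)" if "z \<in> S" for z
    using g(2) that fh[of z] insert.hyps by (simp add: mult_ac)
  thus ?case using g(1) by blast
qed

text \<open>Division by the product over the zeros leaves a holomorphic \<open>g\<close>. On the
  circle of radius \<open>R\<close> every factor has modulus at least
  \<open>R - r \<ge> 2 * r\<close>, at the centre at most \<open>r\<close>; the maximum principle
  for \<open>g\<close> thus gains a factor 2 per zero.\<close>

lemma jensen_zero_count:
  assumes f: "f holomorphic_on UNIV" and R: "R \<ge> 3 * r" "r > 0"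
    and M: "\<And>z. z \<in> cball c R \<Longrightarrow> norm (f z) \<le> M"
    and Z: "finite Z" "Z \<subseteq> cball c r" "\<And>z. z \<in> Z \<Longrightarrow> f z = 0"
  shows "2 ^ card Z * norm (f c) \<le> M"
proof -
  have M0: "M \<ge> 0" using order_trans[OF norm_ge_zero M[of c]] R by simp
  obtain g where g: "g holomorphic_on UNIV" "\<And>z. f z = g z * (\<Prod>a\<in>Z. z - a)"
    using factor_out_zeros[OF open_UNIV Z(1) _ f Z(3)] by auto
  define k where "k = card Z"
  have bd: "norm (g z) \<le> M / (R - r) ^ k" if z: "z \<in> sphere c R" for z
  proof -
    have "R - r \<le> norm (z - a)" if "a \<in> Z" for a
    proof -
      have "dist c a \<le> r" using Z(2) that by auto
      moreover have "dist c z \<le> dist c a + dist a z" by (rule dist_triangle)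
      ultimately show ?thesis using z by (simp add: dist_norm norm_minus_commute)
    qed
    hence "(\<Prod>a\<in>Z. R - r) \<le> (\<Prod>a\<in>Z. norm (z - a))" using R by (intro prod_mono) auto
    hence le: "(R - r) ^ k \<le> norm (\<Prod>a\<in>Z. z - a)" by (simp add: k_def prod_norm)
    have "norm (g z) * (R - r) ^ k \<le> norm (g z) * norm (\<Prod>a\<in>Z. z - a)"
      using le by (rule mult_left_mono) simp
    also have "\<dots> = norm (f z)" by (simp add: g(2) norm_mult)
    also have "\<dots> \<le> M" using z by (intro M) auto
    finally show ?thesis using R by (simp add: field_simps)
  qed
  have "norm (g c) \<le> M / (R - r) ^ k"
  proof (rule maximum_modulus_frontier[where S = "cball c R" and f = g])
    show "g holomorphic_on interior (cball c R)" by (rule holomorphic_on_subset[OF g(1)]) simp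
    show "continuous_on (closure (cball c R)) g"
      by (rule continuous_on_subset[OF holomorphic_on_imp_continuous_on[OF g(1)]]) simp
    show "norm (g z) \<le> M / (R - r) ^ k" if "z \<in> frontier (cball c R)" for z
      using that R bd by (simp add: frontier_cball)
  qed (use R in auto)
  moreover have "norm (\<Prod>a\<in>Z. c - a) \<le> r ^ k"
  proof -
    have "norm (c - a) \<le> r" if "a \<in> Z" for a using Z(2) that by (auto simp: dist_norm)
    hence "(\<Prod>a\<in>Z. norm (c - a)) \<le> (\<Prod>a\<in>Z. r)" by (intro prod_mono) auto
    thus ?thesis by (simp add: k_def prod_norm)
  qed
  ultimately have "norm (g c) * norm (\<Prod>a\<in>Z. c - a) \<le> (M / (R - r) ^ k) * r ^ k"
    using R M0 by (intro mult_mono) auto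
  hence fc: "norm (f c) \<le> M * r ^ k / (R - r) ^ k" by (simp add: g(2) norm_mult)
  have "2 ^ k * r ^ k \<le> (R - r) ^ k"
    unfolding power_mult_distrib[symmetric] using R by (intro power_mono) auto
  hence "M * (2 ^ k * r ^ k) \<le> M * (R - r) ^ k" using M0 by (rule mult_left_mono)
  hence "2 ^ k * (M * r ^ k / (R - r) ^ k) \<le> M"
    using R by (simp add: field_simps)
  moreover have "2 ^ k * norm (f c) \<le> 2 ^ k * (M * r ^ k / (R - r) ^ k)" using fc by (rule mult_left_mono) simp
  ultimately show ?thesis by (simp add: k_def)
qed

text \<open>The lower bound at the centres of the discs in which zeros are counted, uniform in the
  imaginary part. At \<open>Re s = 3\<close> the terms of the series after the first sum to at most
  5/6 in modulus.\<close>

lemma norm_zeta_entire_ge: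
  assumes "Re s = 3" shows "norm (zeta_entire s) \<ge> 1/8"
proof -
  have s1: "Re s > 1" using assms by simp
  define d where "d = dirichlet_term (\<lambda>_. 1) s"
  have sum_d: "summable d" unfolding d_def by (rule summable_zeta_series(1)[OF s1])
  have d0: "d 0 = 1" by (simp add: d_def dirichlet_term_def)
  have "(\<lambda>n. 1 / real ((n + 1)\<^sup>2)) sums (pi\<^sup>2 / 6)" by (rule inverse_squares_sums)
  hence "(\<lambda>n. 1 / real ((Suc n + 1)\<^sup>2)) sums (pi\<^sup>2 / 6 - 1)" by (subst sums_Suc_iff) simp
  hence sq: "(\<lambda>n. (1/2) * (1 / real ((Suc n + 1)\<^sup>2))) sums ((1/2) * (pi\<^sup>2 / 6 - 1))" by (rule sums_mult)
  have "norm (\<Sum>n. d (Suc n)) \<le> (\<Sum>n. (1/2) * (1 / real ((Suc n + 1)\<^sup>2)))"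
  proof (rule norm_suminf_le)
    fix n
    have "norm (d (Suc n)) = real (Suc (Suc n)) powr (- 3)"
      unfolding d_def dirichlet_term_def mult_1 norm_Suc_powr using assms by simp
    also have "\<dots> = 1 / (real (Suc (Suc n)) * real ((Suc n + 1)\<^sup>2))"
      by (simp add: powr_minus powr_numeral power3_eq_cube power2_eq_square field_simps)
    also have "\<dots> \<le> 1 / (2 * real ((Suc n + 1)\<^sup>2))"
      by (intro frac_le mult_right_mono) auto
    also have "\<dots> = (1/2) * (1 / real ((Suc n + 1)\<^sup>2))" by simp
    finally show "norm (d (Suc n)) \<le> (1/2) * (1 / real ((Suc n + 1)\<^sup>2))" .
  qed (use sq in \<open>simp add: sums_iff\<close>)
  also have "\<dots> = (1/2) * (pi\<^sup>2 / 6 - 1)" using sq by (simp only: sums_iff)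
  also have "\<dots> \<le> 5/6"
  proof -
    have "pi * pi \<le> 4 * 4" by (intro mult_mono) (use pi_less_4 pi_gt_zero in auto)
    thus ?thesis by (simp add: power2_eq_square)
  qed
  finally have tail: "norm (\<Sum>n. d (Suc n)) \<le> 5/6" .
  have "dirichlet_series (\<lambda>_. 1) s = 1 + (\<Sum>n. d (Suc n))"
    unfolding dirichlet_series_def using suminf_split_head[OF sum_d] d0 by (simp add: d_def)
  hence "norm (dirichlet_series (\<lambda>_. 1) s) \<ge> 1 - 5/6"
    using norm_diff_ineq[of 1 "\<Sum>n. d (Suc n)"] tail by simp
  moreover have "norm (s - 1) \<ge> 1" using abs_Re_le_cmod[of "s - 1"] assms by simp
  ultimately have "1 * (1 - 5/6) \<le> norm (s - 1) * norm (dirichlet_series (\<lambda>_. 1) s)" by (intro mult_mono) auto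
  thus ?thesis by (simp add: zeta_entire(2)[OF s1] norm_mult)
qed

text \<open>The disc of radius 4 about \<open>3 + \<i> * t\<close> contains the box, and the disc of
  radius 12 lies in \<open>Re z \<ge> - 9\<close>, inside the half-plane
  \<open>Re z \<ge> 3/2 - 11\<close> where polynomial growth is known.\<close>

lemma card_zeta_zeros_box:
  "\<exists>C\<ge>0. \<exists>A. \<forall>t::real. \<forall>W. finite W \<longrightarrow>
     W \<subseteq> {w. 0 \<le> Re w \<and> Re w \<le> 1 \<and> \<bar>Im w - t\<bar> \<le> 1 \<and> zeta_entire w = 0} \<longrightarrow> real (card W) \<le> C * (1 + \<bar>t\<bar>) ^ A"
proof -
  obtain C A where CA: "C \<ge> 0" "\<And>s. s \<in> {s. Re s \<ge> 3/2 - real (11::nat)} \<Longrightarrow> norm (zeta_entire s) \<le> C * (1 + norm s) ^ A"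
    using zeta_entire(3)[of 11] unfolding poly_bounded_on_def by blast
  show ?thesis
  proof (intro exI[of _ "8 * (C * 16 ^ A)"] exI[of _ A] conjI allI impI)
    show "0 \<le> 8 * (C * 16 ^ A)" using CA(1) by simp
    fix t :: real and W
    assume W: "finite W" "W \<subseteq> {w. 0 \<le> Re w \<and> Re w \<le> 1 \<and> \<bar>Im w - t\<bar> \<le> 1 \<and> zeta_entire w = 0}"
    define c where "c = Complex 3 t"
    have a: "2 ^ card W * norm (zeta_entire c) \<le> C * (16 * (1 + \<bar>t\<bar>)) ^ A"
    proof (rule jensen_zero_count[OF zeta_entire(1), where R = 12 and r = 4])
      fix z assume z: "z \<in> cball c 12"
      hence dz: "norm (c - z) \<le> 12" by (simp add: dist_norm)
      have "Re z \<ge> - 9" using abs_Re_le_cmod[of "c - z"] dz by (simp add: c_def)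
      hence "norm (zeta_entire z) \<le> C * (1 + norm z) ^ A" by (intro CA(2)) simp
      also have "norm z \<le> norm c + 12" using norm_triangle_ineq4[of c "c - z"] dz by simp
      hence "1 + norm z \<le> 16 * (1 + \<bar>t\<bar>)" using cmod_le[of c] by (simp add: c_def)
      hence "C * (1 + norm z) ^ A \<le> C * (16 * (1 + \<bar>t\<bar>)) ^ A" using CA(1) by (intro mult_left_mono power_mono) auto
      finally show "norm (zeta_entire z) \<le> C * (16 * (1 + \<bar>t\<bar>)) ^ A" .
    next
      show "W \<subseteq> cball c 4"
      proof
        fix w assume "w \<in> W"
        hence w: "0 \<le> Re w" "Re w \<le> 1" "\<bar>Im w - t\<bar> \<le> 1" using W(2) by auto
        have "norm (c - w) \<le> \<bar>Re (c - w)\<bar> + \<bar>Im (c - w)\<bar>" by (rule cmod_le)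
        thus "w \<in> cball c 4" using w by (simp add: dist_norm c_def)
      qed
    qed (use W in auto)
    have "norm (zeta_entire c) \<ge> 1/8" by (rule norm_zeta_entire_ge) (simp add: c_def)
    hence "2 ^ card W * (1/8) \<le> 2 ^ card W * norm (zeta_entire c)" by (rule mult_left_mono) simp
    also note a
    finally have b: "2 ^ card W \<le> 8 * (C * (16 * (1 + \<bar>t\<bar>)) ^ A)" by simp
    \<comment> \<open>Jensen's inequality bounds even the exponential of the count; a polynomial
      bound for the count itself is enough here.\<close>
    have "card W < 2 ^ card W" by (rule less_exp)
    hence "real (card W) < real (2 ^ card W)" by (simp only: of_nat_less_iff)
    hence "real (card W) \<le> 2 ^ card W" by simp
    also note b
    also have "8 * (C * (16 * (1 + \<bar>t\<bar>)) ^ A) = 8 * (C * 16 ^ A) * (1 + \<bar>t\<bar>) ^ A"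
      by (simp only: power_mult_distrib mult.assoc)
    finally show "real (card W) \<le> 8 * (C * 16 ^ A) * (1 + \<bar>t\<bar>) ^ A" .
  qed
qed

lemma card_zeta_zeros:
  "\<exists>C\<ge>0. \<exists>A. \<forall>N::nat. \<forall>W. finite W \<longrightarrow>
     W \<subseteq> {w. 0 \<le> Re w \<and> Re w \<le> 1 \<and> \<bar>Im w\<bar> \<le> real N \<and> zeta_entire w = 0} \<longrightarrow> real (card W) \<le> C * (1 + real N) ^ A"
proof -
  obtain C A where C: "C \<ge> 0" and CA: "\<And>(t::real) W. finite W \<Longrightarrow>
     W \<subseteq> {w. 0 \<le> Re w \<and> Re w \<le> 1 \<and> \<bar>Im w - t\<bar> \<le> 1 \<and> zeta_entire w = 0} \<Longrightarrow> real (card W) \<le> C * (1 + \<bar>t\<bar>) ^ A"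
    using card_zeta_zeros_box by blast
  show ?thesis
  proof (intro exI[of _ "3 * C"] exI[of _ "Suc A"] conjI allI impI)
    show "0 \<le> 3 * C" using C by simp
    fix N :: nat and W
    assume W: "finite W" "W \<subseteq> {w. 0 \<le> Re w \<and> Re w \<le> 1 \<and> \<bar>Im w\<bar> \<le> real N \<and> zeta_entire w = 0}"
    define V where "V = (\<lambda>j::int. {w \<in> W. \<bar>Im w - of_int j\<bar> \<le> 1})"
    have "W \<subseteq> (\<Union>j\<in>{-int N..int N}. V j)"
    proof
      fix w assume w: "w \<in> W"
      hence "\<bar>Im w\<bar> \<le> real N" using W(2) by blast
      hence "\<lfloor>Im w\<rfloor> \<in> {-int N..int N}" by (auto simp: le_floor_iff floor_le_iff)
      moreover have "\<bar>Im w - of_int \<lfloor>Im w\<rfloor>\<bar> \<le> 1" by linarith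
      hence "w \<in> V \<lfloor>Im w\<rfloor>" using w unfolding V_def by blast
      ultimately show "w \<in> (\<Union>j\<in>{-int N..int N}. V j)" by blast
    qed
    moreover have "(\<Union>j\<in>{-int N..int N}. V j) \<subseteq> W" by (auto simp: V_def)
    ultimately have "card W = card (\<Union>j\<in>{-int N..int N}. V j)" by (metis subset_antisym)
    also have "\<dots> \<le> (\<Sum>j\<in>{-int N..int N}. card (V j))" by (rule card_UN_le) simp
    finally have "real (card W) \<le> (\<Sum>j\<in>{-int N..int N}. real (card (V j)))" by (simp flip: of_nat_sum)
    also have "\<dots> \<le> (\<Sum>j\<in>{-int N..int N}. C * (1 + real N) ^ A)"
    proof (rule sum_mono)
      fix j assume j: "j \<in> {-int N..int N}"
      have "real (card (V j)) \<le> C * (1 + \<bar>real_of_int j\<bar>) ^ A"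
        by (rule CA) (use W in \<open>auto simp: V_def\<close>)
      also have "\<dots> \<le> C * (1 + real N) ^ A" using j C by (intro mult_left_mono power_mono) auto
      finally show "real (card (V j)) \<le> C * (1 + real N) ^ A" .
    qed
    also have "\<dots> = (1 + 2 * real N) * (C * (1 + real N) ^ A)" by simp
    also have "\<dots> \<le> (3 * (1 + real N)) * (C * (1 + real N) ^ A)" using C by (intro mult_right_mono) auto
    also have "\<dots> = 3 * C * (1 + real N) ^ Suc A" by (simp only: power_Suc mult.assoc mult.left_commute mult.commute)
    finally show "real (card W) \<le> 3 * C * (1 + real N) ^ Suc A" .
  qed
qed

subsection \<open>Euler products\<close>

text \<open>Every prime power \<open>p ^ k\<close> with \<open>k > 0\<close> gets the value
  \<open>a k\<close>, independently of \<open>p\<close>. The function is multiplicative, and for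
  \<open>a 0 = 1\<close> its Euler factors are one and the same power series evaluated at
  \<open>p powr - s\<close>.\<close>

definition mult_coeff :: "(nat \<Rightarrow> 'a::comm_monoid_mult) \<Rightarrow> nat \<Rightarrow> 'a" where
  "mult_coeff a n = (\<Prod>p\<in>prime_factors n. a (multiplicity p n))"

text \<open>Bounding the exponents as well keeps the set finite, so that a finite product of
  truncated Euler factors expands into a finite sum over it.\<close>

definition smooth_nats :: "nat \<Rightarrow> nat \<Rightarrow> nat set" where
  "smooth_nats N K = {n. n > 0 \<and> (\<forall>p\<in>prime_factors n. p < N \<and> multiplicity p n \<le> K)}"

lemma bij_betw_smooth_nats:
  fixes N :: nat
  defines "P \<equiv> {p. prime p \<and> p < N}"
  shows "bij_betw (\<lambda>g. \<Prod>p\<in>P. p ^ g p) (Pi\<^sub>E P (\<lambda>_. {..K})) (smooth_nats N K)"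
proof (rule bij_betwI[where g = "\<lambda>n. \<lambda>p\<in>P. multiplicity p n"])
  have P: "finite P" "\<And>p. p \<in> P \<Longrightarrow> prime p" by (auto simp: P_def)
  have mult: "multiplicity p (\<Prod>q\<in>P. q ^ g q) = g p" if "p \<in> P" for p g
    using multiplicity_prod_prime_powers[OF P(1), of p g] P(2) that by simp
  have pos: "(\<Prod>q\<in>P. q ^ g q) > 0" for g :: "nat \<Rightarrow> nat"
    by (intro prod_pos ballI zero_less_power prime_gt_0_nat P(2))
  have pf: "p \<in> P" if p: "p \<in> prime_factors (\<Prod>q\<in>P. q ^ g q)" for p and g :: "nat \<Rightarrow> nat"
  proof (rule ccontr)
    assume "p \<notin> P"
    moreover have "prime p" using p by auto
    ultimately have "multiplicity p (\<Prod>q\<in>P. q ^ g q) = 0"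
      using multiplicity_prod_prime_powers[OF P(1), of p g] P(2) by simp
    moreover have "multiplicity p (\<Prod>q\<in>P. q ^ g q) > 0" using p by (simp add: prime_factors_multiplicity)
    ultimately show False by simp
  qed
  show "(\<lambda>g. \<Prod>p\<in>P. p ^ g p) \<in> Pi\<^sub>E P (\<lambda>_. {..K}) \<rightarrow> smooth_nats N K"
  proof (rule Pi_I)
    fix g assume g: "g \<in> Pi\<^sub>E P (\<lambda>_. {..K})"
    have "p < N \<and> multiplicity p (\<Prod>q\<in>P. q ^ g q) \<le> K" if "p \<in> prime_factors (\<Prod>q\<in>P. q ^ g q)" for p
      using pf[OF that] mult[OF pf[OF that], of g] PiE_mem[OF g pf[OF that]] by (auto simp: P_def)
    thus "(\<Prod>p\<in>P. p ^ g p) \<in> smooth_nats N K" using pos by (simp add: smooth_nats_def)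
  qed
  show "(\<lambda>n. \<lambda>p\<in>P. multiplicity p n) \<in> smooth_nats N K \<rightarrow> Pi\<^sub>E P (\<lambda>_. {..K})"
  proof (rule Pi_I)
    fix n assume n: "n \<in> smooth_nats N K"
    have "multiplicity p n \<le> K" if "p \<in> P" for p
    proof (cases "p \<in> prime_factors n")
      case False
      hence "multiplicity p n = 0" using n P(2)[OF that] by (auto simp: prime_factors_multiplicity smooth_nats_def)
      thus ?thesis by simp
    qed (use n in \<open>auto simp: smooth_nats_def\<close>)
    thus "(\<lambda>p\<in>P. multiplicity p n) \<in> Pi\<^sub>E P (\<lambda>_. {..K})" by auto
  qed
  show "(\<lambda>p\<in>P. multiplicity p (\<Prod>p\<in>P. p ^ g p)) = g" if "g \<in> Pi\<^sub>E P (\<lambda>_. {..K})" for g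
  proof
    fix p
    show "(\<lambda>p\<in>P. multiplicity p (\<Prod>p\<in>P. p ^ g p)) p = g p"
      using mult[of p g] PiE_arb[OF that, of p] by (cases "p \<in> P") auto
  qed
  show "(\<Prod>p\<in>P. p ^ (\<lambda>p\<in>P. multiplicity p n) p) = n" if n: "n \<in> smooth_nats N K" for n
  proof -
    have n0: "n > 0" and sub: "prime_factors n \<subseteq> P" using n by (auto simp: smooth_nats_def P_def)
    have "(\<Prod>p\<in>P. p ^ (\<lambda>p\<in>P. multiplicity p n) p) = (\<Prod>p\<in>P. p ^ multiplicity p n)"
      by (intro prod.cong) auto
    also have "\<dots> = (\<Prod>p\<in>prime_factors n. p ^ multiplicity p n)"
    proof (rule prod.mono_neutral_right[OF P(1) sub], rule ballI)
      fix p assume "p \<in> P - prime_factors n"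
      hence "multiplicity p n = 0" using n0 P(2) by (auto simp: prime_factors_multiplicity)
      thus "p ^ multiplicity p n = 1" by simp
    qed
    also have "\<dots> = n" using prime_factorization_nat[of n] n0 by simp
    finally show ?thesis .
  qed
qed

lemma finite_smooth_nats: "finite (smooth_nats N K)"
proof -
  have "finite (Pi\<^sub>E {p. prime p \<and> p < N} (\<lambda>_. {..K}))" by (intro finite_PiE) auto
  thus ?thesis using bij_betw_finite[OF bij_betw_smooth_nats] by blast
qed

text \<open>The general semiring admits both applications: to the complex terms and to their real
  norms.\<close>

lemma sum_smooth_nats:
  fixes a :: "nat \<Rightarrow> 'a::comm_semiring_1" and b :: "nat \<Rightarrow> 'a"
  assumes a0: "a 0 = 1" and b1: "b 1 = 1" and b: "\<And>m n. m > 0 \<Longrightarrow> n > 0 \<Longrightarrow> b (m * n) = b m * b n"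
  shows "(\<Sum>n\<in>smooth_nats N K. mult_coeff a n * b n) = (\<Prod>p | prime p \<and> p < N. \<Sum>k\<le>K. a k * b p ^ k)"
proof -
  define P where "P = {p. prime p \<and> p < (N::nat)}"
  have P: "finite P" "\<And>p. p \<in> P \<Longrightarrow> prime p" by (auto simp: P_def)
  have bpow: "b (m ^ k) = b m ^ k" if "m > 0" for m k
    using that by (induction k) (auto simp: b1[unfolded One_nat_def] b)
  have bprod: "b (\<Prod>p\<in>S. f p) = (\<Prod>p\<in>S. b (f p))" if "finite S" "\<And>p. p \<in> S \<Longrightarrow> f p > 0" for S and f :: "nat \<Rightarrow> nat"
    using that
  proof (induction S rule: finite_induct)
    case empty
    show ?case by (simp only: prod.empty b1)
  next
    case (insert x F)
    have "(\<Prod>p\<in>F. f p) > 0" using insert.prems by (intro prod_pos) auto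
    moreover have "b (\<Prod>p\<in>F. f p) = (\<Prod>p\<in>F. b (f p))" using insert.prems by (intro insert.IH) auto
    ultimately show ?case using insert.hyps insert.prems by (simp add: b)
  qed
  have "(\<Sum>n\<in>smooth_nats N K. mult_coeff a n * b n) =
        (\<Sum>g\<in>Pi\<^sub>E P (\<lambda>_. {..K}). mult_coeff a (\<Prod>p\<in>P. p ^ g p) * b (\<Prod>p\<in>P. p ^ g p))"
    unfolding P_def by (rule sum.reindex_bij_betw[OF bij_betw_smooth_nats, symmetric])
  also have "\<dots> = (\<Sum>g\<in>Pi\<^sub>E P (\<lambda>_. {..K}). \<Prod>p\<in>P. a (g p) * b p ^ g p)"
  proof (rule sum.cong[OF refl])
    fix g assume "g \<in> Pi\<^sub>E P (\<lambda>_. {..K})"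
    define n where "n = (\<Prod>p\<in>P. p ^ g p)"
    have mult: "multiplicity p n = (if p \<in> P then g p else 0)" if "prime p" for p
      unfolding n_def using multiplicity_prod_prime_powers[OF P(1), of p g] P(2) that by simp
    have "mult_coeff a n = (\<Prod>p\<in>P. a (g p))"
    proof -
      have "prime_factors n \<subseteq> P"
      proof
        fix p assume "p \<in> prime_factors n"
        hence "prime p" "multiplicity p n > 0" by (auto simp: prime_factors_multiplicity)
        thus "p \<in> P" using mult[of p] by (cases "p \<in> P") auto
      qed
      hence "mult_coeff a n = (\<Prod>p\<in>P. a (multiplicity p n))"
        unfolding mult_coeff_def
      proof (rule prod.mono_neutral_left[OF P(1)], intro ballI)
        fix p assume p: "p \<in> P - prime_factors n"
        hence "multiplicity p n = 0" using P(2)[of p] by (auto simp: prime_factors_multiplicity)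
        thus "a (multiplicity p n) = 1" by (simp add: a0)
      qed
      also have "\<dots> = (\<Prod>p\<in>P. a (g p))" using mult P(2) by (intro prod.cong) auto
      finally show ?thesis .
    qed
    moreover have "b n = (\<Prod>p\<in>P. b p ^ g p)"
    proof -
      have "b n = (\<Prod>p\<in>P. b (p ^ g p))"
        unfolding n_def by (rule bprod[OF P(1)]) (intro zero_less_power prime_gt_0_nat P(2))
      thus ?thesis using bpow prime_gt_0_nat[OF P(2)] by simp
    qed
    ultimately show "mult_coeff a n * b n = (\<Prod>p\<in>P. a (g p) * b p ^ g p)" by (simp add: prod.distrib)
  qed
  also have "\<dots> = (\<Prod>p\<in>P. \<Sum>k\<le>K. a k * b p ^ k)"
    by (rule prod_sum_PiE[symmetric]) (use P in auto)
  finally show ?thesis by (simp add: P_def)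
qed

lemma norm_sum_diff_suminf_le:
  fixes f :: "nat \<Rightarrow> complex"
  assumes sm: "summable (\<lambda>n. norm (f n))" and W: "finite W" "{..<N} \<subseteq> W"
  shows "norm (suminf f - sum f W) \<le> (\<Sum>n. norm (f (n + N)))"
proof (rule Lim_norm_ubound[where f = "\<lambda>M. sum f {..<M} - sum f W"])
  show "(\<lambda>M. sum f {..<M} - sum f W) \<longlonglongrightarrow> suminf f - sum f W"
    by (intro tendsto_intros summable_LIMSEQ summable_norm_cancel[OF sm])
  obtain M0 where M0: "\<forall>w\<in>W. w < M0" using W(1) unfolding finite_nat_set_iff_bounded by blast
  show "eventually (\<lambda>M. norm (sum f {..<M} - sum f W) \<le> (\<Sum>n. norm (f (n + N)))) sequentially"
    using eventually_ge_at_top[of M0]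
  proof eventually_elim
    case (elim M)
    have sub: "W \<subseteq> {..<M}" using M0 elim by auto
    have "norm (sum f {..<M} - sum f W) = norm (sum f ({..<M} - W))"
      by (subst sum_diff[OF _ sub]) auto
    also have "\<dots> \<le> (\<Sum>n\<in>{..<M} - W. norm (f n))" by (rule norm_sum)
    also have "\<dots> \<le> (\<Sum>n\<in>{N..<N + M}. norm (f n))"
    proof (rule sum_mono2)
      show "{..<M} - W \<subseteq> {N..<N + M}"
      proof
        fix n assume n: "n \<in> {..<M} - W"
        hence "n \<notin> {..<N}" using W(2) by blast
        thus "n \<in> {N..<N + M}" using n by simp
      qed
    qed auto
    also have "\<dots> = (\<Sum>n<M. norm (f (n + N)))"
      by (rule sum.reindex_bij_witness[of _ "\<lambda>n. n + N" "\<lambda>n. n - N"]) auto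
    also have "\<dots> \<le> (\<Sum>n. norm (f (n + N)))"
      by (rule sum_le_suminf) (use sm in \<open>auto simp: summable_iff_shift[of "\<lambda>n. norm (f n)" N]\<close>)
    finally show ?case .
  qed
qed simp

text \<open>The norms summed over smooth numbers form a product with factors at most
  \<open>1 + B p \<le> exp (B p)\<close>, which gives absolute convergence. The truncated product
  over the primes up to \<open>N\<close> is then the sum over a set that contains all
  \<open>n \<le> N\<close>, and differs from the series by at most a tail.\<close>

lemma euler_product:
  fixes a :: "nat \<Rightarrow> complex" and s :: complex
  assumes a0: "a 0 = 1"
    and sm: "\<And>p. prime p \<Longrightarrow> summable (\<lambda>k. norm (a k) * (real p powr - Re s) ^ k)"
    and B: "summable B" "\<And>p. 0 \<le> B p"
      "\<And>p. prime p \<Longrightarrow> (\<Sum>k. norm (a (Suc k)) * (real p powr - Re s) ^ Suc k) \<le> B p"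
  shows "summable (\<lambda>n. norm (dirichlet_term (mult_coeff a) s n))"
    and "(\<lambda>N. \<Prod>p | prime p \<and> p < N. \<Sum>k. a k * (of_nat p powr - s) ^ k) \<longlonglongrightarrow> dirichlet_series (mult_coeff a) s"
proof -
  define b where "b = (\<lambda>n::nat. (of_nat n powr - s :: complex))"
  have nb: "norm (b n) = real n powr - Re s" for n
    unfolding b_def by (subst norm_powr_real_powr) auto
  have b1: "b 1 = 1" by (simp add: b_def)
  note b1' = b1[unfolded One_nat_def]
  have bm: "b (m * n) = b m * b n" for m n
    unfolding b_def of_nat_mult by (rule powr_times_real) auto
  have nmc: "norm (mult_coeff a n) = mult_coeff (\<lambda>k. norm (a k)) n" for n
    by (simp add: mult_coeff_def prod_norm)
  \<comment> \<open>The prime factors of \<open>n\<close> are at most \<open>n\<close>, and an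
    exponent \<open>k\<close> of \<open>p\<close> satisfies
    \<open>k < p ^ k \<le> n\<close>.\<close>
  have sub: "{1..N} \<subseteq> smooth_nats (Suc N) K" if "N \<le> K" for N K
  proof
    fix n assume n: "n \<in> {1..N}"
    have "p < Suc N \<and> multiplicity p n \<le> K" if "p \<in> prime_factors n" for p
    proof -
      have "prime p" "p dvd n" using that by auto
      hence "p \<le> n" using n by (auto intro: dvd_imp_le)
      moreover have "p ^ multiplicity p n \<le> n" using n by (intro dvd_imp_le multiplicity_dvd) auto
      moreover have "multiplicity p n < p ^ multiplicity p n"
        using prime_gt_Suc_0_nat[OF \<open>prime p\<close>] by (rule power_gt_expt)
      ultimately show ?thesis using n \<open>N \<le> K\<close> by auto
    qed
    thus "n \<in> smooth_nats (Suc N) K" using n by (auto simp: smooth_nats_def)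
  qed
  define A where "A = (\<lambda>n. dirichlet_term (mult_coeff a) s n)"
  have A: "A n = mult_coeff a (Suc n) * b (Suc n)" for n by (simp add: A_def dirichlet_term_def b_def)
  have bound: "(\<Sum>n<N. norm (A n)) \<le> exp (suminf B)" for N
  proof -
    have "(\<Sum>n<N. norm (A n)) = (\<Sum>n\<in>{1..N}. mult_coeff (\<lambda>k. norm (a k)) n * norm (b n))"
      by (rule sum.reindex_bij_witness[of _ "\<lambda>n. n - 1" Suc]) (auto simp: A norm_mult nmc)
    also have "\<dots> \<le> (\<Sum>n\<in>smooth_nats (Suc N) N. mult_coeff (\<lambda>k. norm (a k)) n * norm (b n))"
      by (rule sum_mono2[OF finite_smooth_nats sub]) (auto simp: mult_coeff_def intro!: mult_nonneg_nonneg prod_nonneg)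
    also have "\<dots> = (\<Prod>p | prime p \<and> p < Suc N. \<Sum>k\<le>N. norm (a k) * norm (b p) ^ k)"
      by (rule sum_smooth_nats) (auto simp: a0 b1' bm norm_mult)
    also have "\<dots> \<le> (\<Prod>p | prime p \<and> p < Suc N. exp (B p))"
    proof (rule prod_mono, intro conjI)
      fix p assume "p \<in> {p. prime p \<and> p < Suc N}"
      hence p: "prime p" by simp
      show "0 \<le> (\<Sum>k\<le>N. norm (a k) * norm (b p) ^ k)" by (intro sum_nonneg) auto
      have "(\<Sum>k\<le>N. norm (a k) * norm (b p) ^ k) \<le> (\<Sum>k. norm (a k) * norm (b p) ^ k)"
        by (rule sum_le_suminf) (use sm[OF p] in \<open>auto simp: nb\<close>)
      also have "\<dots> = 1 + (\<Sum>k. norm (a (Suc k)) * norm (b p) ^ Suc k)"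
        by (subst suminf_split_head) (use sm[OF p] in \<open>auto simp: nb a0\<close>)
      also have "\<dots> \<le> 1 + B p" using B(3)[OF p] by (simp add: nb)
      also have "\<dots> \<le> exp (B p)" by (rule exp_ge_add_one_self)
      finally show "(\<Sum>k\<le>N. norm (a k) * norm (b p) ^ k) \<le> exp (B p)" .
    qed
    also have "\<dots> = exp (\<Sum>p | prime p \<and> p < Suc N. B p)" by (simp add: exp_sum)
    also have "\<dots> \<le> exp (suminf B)"
      using B(1,2) by (auto intro!: sum_le_suminf)
    finally show ?thesis .
  qed
  show sA: "summable (\<lambda>n. norm (dirichlet_term (mult_coeff a) s n))"
    unfolding A_def[symmetric]
  proof (rule bounded_imp_summable)
    show "(\<Sum>k\<le>n. norm (A k)) \<le> exp (suminf B)" for n using bound[of "Suc n"] by (simp only: lessThan_Suc_atMost)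
  qed simp
  define D where "D = dirichlet_series (mult_coeff a) s"
  have D: "D = suminf A" by (simp add: D_def dirichlet_series_def A_def)
  have part: "norm (D - (\<Prod>p | prime p \<and> p < Suc N. \<Sum>k\<le>K. a k * b p ^ k)) \<le> (\<Sum>n. norm (A (n + N)))"
    if "N \<le> K" for N K
  proof -
    define W where "W = (\<lambda>n. n - 1) ` smooth_nats (Suc N) K"
    have inj: "inj_on (\<lambda>n. n - 1) (smooth_nats (Suc N) K)" by (auto simp: inj_on_def smooth_nats_def)
    have "sum A W = (\<Sum>n\<in>smooth_nats (Suc N) K. mult_coeff a n * b n)"
      unfolding W_def by (subst sum.reindex[OF inj]) (auto simp: A smooth_nats_def intro!: sum.cong)
    also have "\<dots> = (\<Prod>p | prime p \<and> p < Suc N. \<Sum>k\<le>K. a k * b p ^ k)"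
      by (rule sum_smooth_nats) (auto simp: a0 b1' bm)
    finally have eq: "(\<Prod>p | prime p \<and> p < Suc N. \<Sum>k\<le>K. a k * b p ^ k) = sum A W" by simp
    have "{..<N} \<subseteq> W"
    proof
      fix n assume "n \<in> {..<N}"
      hence "Suc n \<in> smooth_nats (Suc N) K" using sub[OF that] by auto
      thus "n \<in> W" unfolding W_def by (intro image_eqI[of _ _ "Suc n"]) auto
    qed
    thus ?thesis unfolding eq D using sA finite_smooth_nats
      by (intro norm_sum_diff_suminf_le) (auto simp: A_def W_def)
  qed
  \<comment> \<open>The error bound is uniform in \<open>K\<close>, so \<open>K\<close> can tend to
    infinity for fixed \<open>N\<close>; this reaches the full Euler factors.\<close>
  have lim: "norm (D - (\<Prod>p | prime p \<and> p < Suc N. \<Sum>k. a k * b p ^ k)) \<le> (\<Sum>n. norm (A (n + N)))" for N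
  proof (rule Lim_norm_ubound[where f = "\<lambda>K. D - (\<Prod>p | prime p \<and> p < Suc N. \<Sum>k\<le>K. a k * b p ^ k)"])
    have "(\<lambda>K. \<Sum>k\<le>K. a k * b p ^ k) \<longlonglongrightarrow> (\<Sum>k. a k * b p ^ k)" if "prime p" for p
      by (rule summable_LIMSEQ', rule summable_norm_cancel)
         (use sm[OF that] in \<open>simp add: norm_mult norm_power nb\<close>)
    thus "(\<lambda>K. D - (\<Prod>p | prime p \<and> p < Suc N. \<Sum>k\<le>K. a k * b p ^ k))
       \<longlonglongrightarrow> D - (\<Prod>p | prime p \<and> p < Suc N. \<Sum>k. a k * b p ^ k)"
      by (intro tendsto_intros) auto
    show "eventually (\<lambda>K. norm (D - (\<Prod>p | prime p \<and> p < Suc N. \<Sum>k\<le>K. a k * b p ^ k)) \<le> (\<Sum>n. norm (A (n + N)))) sequentially"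
      using eventually_ge_at_top[of N] by eventually_elim (rule part)
  qed simp
  have "(\<lambda>N. \<Sum>n. norm (A (n + N))) \<longlonglongrightarrow> 0"
    by (rule suminf_exist_split2) (use sA in \<open>simp add: A_def\<close>)
  hence "(\<lambda>N. D - (\<Prod>p | prime p \<and> p < Suc N. \<Sum>k. a k * b p ^ k)) \<longlonglongrightarrow> 0"
    by (rule Lim_null_comparison[rotated]) (use lim in auto)
  hence "(\<lambda>N. D - (D - (\<Prod>p | prime p \<and> p < Suc N. \<Sum>k. a k * b p ^ k))) \<longlonglongrightarrow> D - 0"
    by (intro tendsto_intros)
  hence "(\<lambda>N. \<Prod>p | prime p \<and> p < Suc N. \<Sum>k. a k * b p ^ k) \<longlonglongrightarrow> D" by simp
  thus "(\<lambda>N. \<Prod>p | prime p \<and> p < N. \<Sum>k. a k * (of_nat p powr - s) ^ k) \<longlonglongrightarrow> dirichlet_series (mult_coeff a) s"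
    unfolding D_def b_def by (rule LIMSEQ_imp_Suc)
qed

definition power_series :: "(nat \<Rightarrow> complex) \<Rightarrow> complex \<Rightarrow> complex" where
  "power_series a x = (\<Sum>k. a k * x ^ k)"

text \<open>Indexed by all natural numbers, with 1 off the primes, so as to be an infinite product
  in the sense of \<open>has_prod\<close>.\<close>

definition euler_factor :: "(complex \<Rightarrow> complex) \<Rightarrow> complex \<Rightarrow> nat \<Rightarrow> complex" where
  "euler_factor f s n = (if prime n then f (of_nat n powr - s) else 1)"

lemma norm_nat_powr: "norm (of_nat n powr - s :: complex) = real n powr - Re s"
  by (subst norm_powr_real_powr) auto

lemma norm_prime_powr_less_1:
  assumes "prime p" "Re s > 0" shows "norm (of_nat p powr - s :: complex) < 1"
proof -
  have "real p powr - Re s < real p powr 0" using assms prime_gt_1_nat[of p] by (intro powr_less_mono) auto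
  thus ?thesis using prime_gt_0_nat[OF assms(1)] by (simp add: norm_nat_powr)
qed

text \<open>Without coefficients of index 1 to \<open>M\<close>, an Euler factor differs from 1 by a
  multiple of \<open>x ^ Suc M\<close>, with one constant for all primes: the modulus of
  \<open>x\<close> is largest at the prime 2.\<close>

lemma euler_factor_bound:
  fixes s :: complex
  assumes a: "disc_coeffs a" and a0: "\<And>k. 0 < k \<Longrightarrow> k \<le> M \<Longrightarrow> a k = 0" and s: "Re s * real (Suc M) > 1"
  shows "\<exists>C. C \<ge> 0 \<and> (\<forall>p. prime p \<longrightarrow>
    summable (\<lambda>k. norm (a k) * (real p powr - Re s) ^ k) \<and>
    (\<Sum>k. norm (a (Suc k)) * (real p powr - Re s) ^ Suc k) \<le> C * real p powr - (Re s * real (Suc M)))"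
proof -
  have s0: "Re s > 0" using s by (metis less_trans zero_less_mult_pos2 zero_less_one of_nat_0_less_iff zero_less_Suc)
  define \<rho> where "\<rho> = 2 powr - Re s"
  have \<rho>: "0 < \<rho>" "\<rho> < 1" using s0 powr_less_mono[of "- Re s" 0 2] by (auto simp: \<rho>_def)
  have "summable (\<lambda>k. norm (a k) * \<rho> ^ k)" using a \<rho> unfolding disc_coeffs_def by (meson less_imp_le)
  hence "summable (\<lambda>k. norm (a (k + Suc M)) * \<rho> ^ (k + Suc M))" by (subst summable_iff_shift)
  hence "summable (\<lambda>k. norm (a (k + Suc M)) * \<rho> ^ (k + Suc M) * (1 / \<rho> ^ Suc M))" by (rule summable_mult2)
  hence smC: "summable (\<lambda>k. norm (a (k + Suc M)) * \<rho> ^ k)"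
    using \<rho> by (simp add: power_add field_simps)
  define C where "C = (\<Sum>k. norm (a (k + Suc M)) * \<rho> ^ k)"
  have C0: "C \<ge> 0" unfolding C_def using \<rho> by (intro suminf_nonneg smC) auto
  have "summable (\<lambda>k. norm (a k) * (real p powr - Re s) ^ k) \<and>
    (\<Sum>k. norm (a (Suc k)) * (real p powr - Re s) ^ Suc k) \<le> C * real p powr - (Re s * real (Suc M))" if p: "prime p" for p
  proof
    define x where "x = real p powr - Re s"
    have p2: "real p \<ge> 2" using prime_ge_2_nat[OF p] by simp
    have x: "0 \<le> x" "x \<le> \<rho>" using p2 s0 by (auto simp: x_def \<rho>_def intro!: powr_mono2')
    have x1: "x < 1" using x \<rho> by linarith
    show sm: "summable (\<lambda>k. norm (a k) * (real p powr - Re s) ^ k)"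
      using a x x1 unfolding disc_coeffs_def x_def by blast
    have sm1: "summable (\<lambda>k. norm (a (Suc k)) * x ^ Suc k)"
      using sm unfolding x_def by (subst summable_Suc_iff)
    have sm2: "summable (\<lambda>k. norm (a (k + Suc M)) * x ^ k)"
      by (rule summable_comparison_test'[OF smC, of 0]) (use x in \<open>auto intro!: mult_left_mono power_mono\<close>)
    have "(\<Sum>k. norm (a (Suc k)) * x ^ Suc k)
        = (\<Sum>k. norm (a (Suc (k + M))) * x ^ Suc (k + M)) + (\<Sum>k<M. norm (a (Suc k)) * x ^ Suc k)"
      by (rule suminf_split_initial_segment[OF sm1])
    also have "(\<Sum>k<M. norm (a (Suc k)) * x ^ Suc k) = 0" using a0 by (intro sum.neutral) auto
    also have "(\<Sum>k. norm (a (Suc (k + M))) * x ^ Suc (k + M)) = x ^ Suc M * (\<Sum>k. norm (a (k + Suc M)) * x ^ k)"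
      by (subst suminf_mult[OF sm2, symmetric]) (simp add: power_add mult_ac)
    also have "(\<Sum>k. norm (a (k + Suc M)) * x ^ k) \<le> C"
      unfolding C_def by (rule suminf_le[OF _ sm2 smC]) (use x in \<open>auto intro!: mult_left_mono power_mono\<close>)
    hence "x ^ Suc M * (\<Sum>k. norm (a (k + Suc M)) * x ^ k) + 0 \<le> C * x ^ Suc M"
      using x by (simp add: mult.commute[of C] mult_left_mono del: power_Suc)
    also have "x ^ Suc M = real p powr - (Re s * real (Suc M))"
      unfolding x_def using p2 by (subst powr_realpow[symmetric]) (auto simp: powr_powr simp del: of_nat_Suc)
    finally show "(\<Sum>k. norm (a (Suc k)) * (real p powr - Re s) ^ Suc k) \<le> C * real p powr - (Re s * real (Suc M))"
      unfolding x_def .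
  qed
  note bound = this
  show ?thesis by (intro exI[of _ C] conjI[OF C0] allI impI) (rule bound)
qed

text \<open>\<open>has_prod\<close> says more than that the partial products converge: the value
  vanishes only if some factor does. The zeros of the Dirichlet series are read off from
  this.\<close>

lemma euler_product_power_series:
  fixes s :: complex
  assumes a: "disc_coeffs a" "a 0 = 1" and aM: "\<And>k. 0 < k \<Longrightarrow> k \<le> M \<Longrightarrow> a k = 0" and s: "Re s * real (Suc M) > 1"
  shows "summable (\<lambda>n. norm (dirichlet_term (mult_coeff a) s n))"
    and "euler_factor (power_series a) s has_prod dirichlet_series (mult_coeff a) s"
proof -
  have s0: "Re s > 0" using s by (metis less_trans zero_less_mult_pos2 zero_less_one of_nat_0_less_iff zero_less_Suc)
  obtain C where C: "C \<ge> 0" and bd': "\<forall>p. prime p \<longrightarrow>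
    summable (\<lambda>k. norm (a k) * (real p powr - Re s) ^ k) \<and>
    (\<Sum>k. norm (a (Suc k)) * (real p powr - Re s) ^ Suc k) \<le> C * real p powr - (Re s * real (Suc M))"
    using euler_factor_bound[of a M s, OF a(1) _ s] aM by blast
  note bd = bd'[rule_format]
  have B: "summable (\<lambda>n. C * real n powr - (Re s * real (Suc M)))"
    using s by (intro summable_mult) (subst summable_real_powr_iff, simp)
  have B0: "0 \<le> C * real n powr - (Re s * real (Suc M))" for n using C by simp
  note ep = euler_product[of a s "\<lambda>n. C * real n powr - (Re s * real (Suc M))", OF a(2) _ B B0]
  show "summable (\<lambda>n. norm (dirichlet_term (mult_coeff a) s n))" by (rule ep(1)) (use bd in blast)+
  have lim: "(\<lambda>N. \<Prod>p | prime p \<and> p < N. power_series a (of_nat p powr - s)) \<longlonglongrightarrow> dirichlet_series (mult_coeff a) s"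
    unfolding power_series_def by (rule ep(2)) (use bd in blast)+
  have le: "norm (norm (euler_factor (power_series a) s n - 1)) \<le> C * real n powr - (Re s * real (Suc M))" for n
  proof (cases "prime n")
    case True
    define x where "x = (of_nat n powr - s :: complex)"
    have sm: "summable (\<lambda>k. norm (a k * x ^ k))" using bd[OF True] by (simp add: x_def norm_mult norm_power norm_nat_powr)
    have sm1: "summable (\<lambda>k. norm (a (Suc k) * x ^ Suc k))" using sm by (subst summable_Suc_iff)
    have "power_series a x - 1 = (\<Sum>k. a (Suc k) * x ^ Suc k)"
      unfolding power_series_def using suminf_split_head[OF summable_norm_cancel[OF sm]] a(2) by simp
    hence "norm (power_series a x - 1) \<le> (\<Sum>k. norm (a (Suc k) * x ^ Suc k))" using summable_norm[OF sm1] by simp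
    also have "\<dots> = (\<Sum>k. norm (a (Suc k)) * (real n powr - Re s) ^ Suc k)"
      by (simp only: norm_mult norm_power x_def norm_nat_powr)
    finally show ?thesis using bd[OF True] True by (simp add: euler_factor_def x_def)
  qed (use C in \<open>simp add: euler_factor_def\<close>)
  have "summable (\<lambda>n. norm (euler_factor (power_series a) s n - 1))"
    by (rule summable_comparison_test'[OF B, of 0]) (rule le)
  hence cp: "convergent_prod (euler_factor (power_series a) s)"
    by (intro abs_convergent_prod_imp_convergent_prod summable_imp_abs_convergent_prod)
  hence "(\<lambda>n. \<Prod>i\<le>n. euler_factor (power_series a) s i) \<longlonglongrightarrow> prodinf (euler_factor (power_series a) s)"
    by (rule convergent_prod_LIMSEQ)
  moreover have "(\<Prod>i\<le>n. euler_factor (power_series a) s i) = (\<Prod>p | prime p \<and> p < Suc n. power_series a (of_nat p powr - s))" for n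
  proof -
    have "{p. prime p \<and> p < Suc n} = {i \<in> {..n}. prime i}" by auto
    thus ?thesis unfolding euler_factor_def by (simp only: prod.inter_filter[OF finite_atMost])
  qed
  ultimately have "(\<lambda>n. \<Prod>p | prime p \<and> p < Suc n. power_series a (of_nat p powr - s)) \<longlonglongrightarrow> prodinf (euler_factor (power_series a) s)"
    by simp
  moreover have "(\<lambda>n. \<Prod>p | prime p \<and> p < Suc n. power_series a (of_nat p powr - s)) \<longlonglongrightarrow> dirichlet_series (mult_coeff a) s"
    using lim by (rule LIMSEQ_Suc)
  ultimately have "prodinf (euler_factor (power_series a) s) = dirichlet_series (mult_coeff a) s" by (rule LIMSEQ_unique)
  thus "euler_factor (power_series a) s has_prod dirichlet_series (mult_coeff a) s"
    using convergent_prod_has_prod[OF cp] by simp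
qed

lemma dirichlet_series_eq_0_iff:
  fixes s :: complex
  assumes "disc_coeffs a" "a 0 = 1" "\<And>k. 0 < k \<Longrightarrow> k \<le> M \<Longrightarrow> a k = 0" "Re s * real (Suc M) > 1"
  shows "dirichlet_series (mult_coeff a) s = 0 \<longleftrightarrow> (\<exists>p. prime p \<and> power_series a (of_nat p powr - s) = 0)"
proof -
  have "dirichlet_series (mult_coeff a) s = 0 \<longleftrightarrow> 0 \<in> range (euler_factor (power_series a) s)"
    by (rule has_prod_eq_0_iff[OF euler_product_power_series(2)[OF assms]])
  also have "\<dots> \<longleftrightarrow> (\<exists>p. prime p \<and> power_series a (of_nat p powr - s) = 0)"
  proof
    assume "0 \<in> range (euler_factor (power_series a) s)"
    then obtain p where "euler_factor (power_series a) s p = 0" by (metis rangeE)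
    thus "\<exists>p. prime p \<and> power_series a (of_nat p powr - s) = 0"
      unfolding euler_factor_def by (cases "prime p") auto
  next
    assume "\<exists>p. prime p \<and> power_series a (of_nat p powr - s) = 0"
    then obtain p where "euler_factor (power_series a) s p = 0" unfolding euler_factor_def by metis
    thus "0 \<in> range (euler_factor (power_series a) s)" by (metis rangeI)
  qed
  finally show ?thesis .
qed

lemma dirichlet_series_holomorphic:
  fixes a :: "nat \<Rightarrow> complex"
  assumes "\<And>s. Re s > c \<Longrightarrow> summable (\<lambda>n. norm (dirichlet_term a s n))"
  shows "dirichlet_series a holomorphic_on {s. Re s > c}"
  unfolding dirichlet_series_def[abs_def]
proof (rule holomorphic_suminf)
  show "open {s. Re s > c}" by (rule open_halfspace_Re_gt)
  show "(\<lambda>s. dirichlet_term a s n) holomorphic_on {s. Re s > c}" for n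
    unfolding dirichlet_term_def by (intro holomorphic_intros)
  fix x assume x: "x \<in> {s. Re s > c}"
  define d where "d = (Re x - c) / 2"
  have d: "d > 0" using x by (simp add: d_def)
  define s0 where "s0 = complex_of_real (Re x - d)"
  have s0: "Re s0 > c" using x by (simp add: s0_def d_def field_simps)
  show "\<exists>d>0. \<exists>M. summable M \<and> cball x d \<subseteq> {s. Re s > c} \<and> (\<forall>n. \<forall>z\<in>cball x d. norm (dirichlet_term a z n) \<le> M n)"
  proof (intro exI conjI allI ballI)
    show "summable (\<lambda>n. norm (dirichlet_term a s0 n))" by (rule assms[OF s0])
    show "cball x d \<subseteq> {s. Re s > c}" using Re_ge_on_cball[of _ x d] s0 by (force simp: s0_def)
    fix n z assume z: "z \<in> cball x d"
    have "real (Suc n) powr - Re z \<le> real (Suc n) powr - Re s0"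
      by (rule Suc_powr_mono) (use Re_ge_on_cball[OF z] in \<open>simp add: s0_def\<close>)
    thus "norm (dirichlet_term a z n) \<le> norm (dirichlet_term a s0 n)"
      unfolding dirichlet_term_def norm_mult norm_Suc_powr by (intro mult_left_mono) auto
  qed (rule d)
qed

lemma disc_coeffs_1: "disc_coeffs (\<lambda>_. 1)"
  unfolding disc_coeffs_def by (auto intro: summable_geometric)

lemma power_series_1: "norm x < 1 \<Longrightarrow> power_series (\<lambda>_. 1) x = 1 / (1 - x)"
  unfolding power_series_def mult_1 by (rule suminf_geometric)

lemma mult_coeff_1: "mult_coeff (\<lambda>_. 1) = (\<lambda>_. 1)"
  by (simp add: mult_coeff_def fun_eq_iff)

lemma riemann_zeta_has_prod:
  fixes s :: complex
  assumes n: "n > 0" and s: "Re s * real n > 1"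
  shows "euler_factor (\<lambda>x. 1 / (1 - x ^ n)) s has_prod riemann_zeta (of_nat n * s)"
proof -
  have s': "Re (of_nat n * s) > 1" using s by (simp add: mult.commute)
  have s0: "Re s > 0" using s n by (metis less_trans zero_less_mult_pos2 zero_less_one of_nat_0_less_iff)
  have "euler_factor (power_series (\<lambda>_. 1)) (of_nat n * s) has_prod dirichlet_series (mult_coeff (\<lambda>_. 1)) (of_nat n * s)"
    by (rule euler_product_power_series(2)[where M = 0]) (use s' disc_coeffs_1 in auto)
  moreover have "euler_factor (power_series (\<lambda>_. 1)) (of_nat n * s) m = euler_factor (\<lambda>x. 1 / (1 - x ^ n)) s m" for m
  proof (cases "prime m")
    case True
    have m0: "(of_nat m :: complex) \<noteq> 0" using prime_gt_0_nat[OF True] by simp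
    have eq: "of_nat m powr - (of_nat n * s) = (of_nat m powr - s :: complex) ^ n"
    proof -
      have "- (of_nat n * s) = of_nat n * (- s)" by simp
      thus ?thesis using m0 by (simp only: powr_def if_False exp_of_nat_mult mult.assoc)
    qed
    have "norm (of_nat m powr - (of_nat n * s) :: complex) < 1"
      by (rule norm_prime_powr_less_1[OF True]) (use s' in linarith)
    thus ?thesis using True by (simp add: euler_factor_def power_series_1 eq)
  qed (simp add: euler_factor_def)
  ultimately show ?thesis unfolding mult_coeff_1 riemann_zeta_eq_series[OF s', symmetric]
    by (simp cong: has_prod_cong)
qed

lemma riemann_zeta_nonzero: "Re s > 1 \<Longrightarrow> riemann_zeta s \<noteq> 0"
proof -
  assume s: "Re s > 1"
  have "riemann_zeta (of_nat 1 * s) = 0 \<longleftrightarrow> 0 \<in> range (euler_factor (\<lambda>x. 1 / (1 - x ^ 1)) s)"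
    by (rule has_prod_eq_0_iff[OF riemann_zeta_has_prod]) (use s in auto)
  moreover have "euler_factor (\<lambda>x. 1 / (1 - x ^ 1)) s n \<noteq> 0" for n
  proof (cases "prime n")
    case True
    have "norm (of_nat n powr - s :: complex) < 1" by (rule norm_prime_powr_less_1[OF True]) (use s in linarith)
    hence "of_nat n powr - s \<noteq> (1 :: complex)" by auto
    thus ?thesis using True by (simp add: euler_factor_def)
  qed (simp add: euler_factor_def)
  hence "0 \<notin> range (euler_factor (\<lambda>x. 1 / (1 - x ^ 1)) s)" by (metis rangeE)
  ultimately show ?thesis by simp
qed

text \<open>Only natural powers of the product for zeta are formed. For \<open>c \<ge> 0\<close> the
  power is multiplied to the product of \<open>B\<close>, for \<open>c < 0\<close> to that of
  \<open>A\<close>; in the second case \<open>riemann_zeta (of_nat n * s) \<noteq> 0\<close> lets it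
  be moved back.\<close>

lemma dirichlet_series_split_zeta:
  fixes s :: complex and c :: int
  assumes n: "n > 0" and s: "Re s * real n > 1"
    and A: "euler_factor f s has_prod A" and B: "euler_factor g s has_prod B"
    and eq: "\<And>x. norm x < 1 \<Longrightarrow> g x = f x * (1 - x ^ n) powi c"
  shows "A = riemann_zeta (of_nat n * s) powi c * B"
proof -
  have s0: "Re s > 0" using s n by (metis less_trans zero_less_mult_pos2 zero_less_one of_nat_0_less_iff)
  let ?Z = "riemann_zeta (of_nat n * s)" and ?h = "euler_factor (\<lambda>x. 1 / (1 - x ^ n)) s"
  have Z0: "?Z \<noteq> 0" by (rule riemann_zeta_nonzero) (use s in \<open>simp add: mult.commute\<close>)
  have h: "(\<lambda>i. ?h i ^ k) has_prod ?Z ^ k" for k by (rule has_prod_power[OF riemann_zeta_has_prod[OF n s]])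
  have nz: "1 - (of_nat p powr - s :: complex) ^ n \<noteq> 0" if "prime p" for p
  proof -
    have "norm (of_nat p powr - s :: complex) < 1" by (rule norm_prime_powr_less_1[OF that s0])
    hence "norm ((of_nat p powr - s :: complex) ^ n) < 1" using n by (simp add: norm_power power_less_one_iff)
    thus ?thesis by auto
  qed
  have geq: "euler_factor g s i = euler_factor f s i * inverse (?h i) powi c" for i
    using eq[OF norm_prime_powr_less_1[OF _ s0]] by (simp add: euler_factor_def)
  have h0: "?h i \<noteq> 0" for i using nz[of i] by (simp add: euler_factor_def)
  show ?thesis
  proof (cases "c \<ge> 0")
    case True
    have "(\<lambda>i. euler_factor g s i * ?h i ^ nat c) has_prod (B * ?Z ^ nat c)" by (rule has_prod_mult[OF B h])
    moreover have "euler_factor g s i * ?h i ^ nat c = euler_factor f s i" for i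
      unfolding geq using h0[of i] True by (simp add: power_int_def power_inverse field_simps)
    ultimately have "euler_factor f s has_prod (B * ?Z ^ nat c)" by simp
    hence "A = B * ?Z ^ nat c" by (rule has_prod_unique2[OF A])
    thus ?thesis using True by (simp add: power_int_def mult.commute)
  next
    case False
    have "(\<lambda>i. euler_factor f s i * ?h i ^ nat (- c)) has_prod (A * ?Z ^ nat (- c))" by (rule has_prod_mult[OF A h])
    moreover have "euler_factor f s i * ?h i ^ nat (- c) = euler_factor g s i" for i
      unfolding geq using False by (simp add: power_int_def)
    ultimately have "euler_factor g s has_prod (A * ?Z ^ nat (- c))" by simp
    hence "B = A * ?Z ^ nat (- c)" by (rule has_prod_unique2[OF B])
    thus ?thesis using False Z0 by (simp add: power_int_def power_inverse field_simps)
  qed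
qed

text \<open>Otherwise the sum of the reciprocals of the primes, and with it the harmonic series, would converge.\<close>

lemma not_primes_le_sqrt:
  fixes C :: real
  assumes C: "\<And>x::nat. real (card {p. prime p \<and> p \<le> x}) \<le> C * sqrt (real x)"
  shows False
proof -
  have C0: "C \<ge> 0" using C[of 1] by (auto intro: order_trans[rotated])
  define B where "B = (\<lambda>n::nat. if prime n then 1 / real n else 0)"
  define q where "q = 1 / sqrt 2"
  have q: "0 < q" "q < 1" by (auto simp: q_def)
  \<comment> \<open>The block from \<open>2 ^ K\<close> to \<open>2 ^ Suc K\<close> contains at most
    \<open>C * sqrt (2 ^ Suc K)\<close> primes, with reciprocals at most
    \<open>1 / 2 ^ K\<close>.\<close>
  have dyadic: "(\<Sum>n<2 ^ K. B n) \<le> (\<Sum>k<K. C * sqrt 2 * q ^ k)" for K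
  proof (induction K)
    case (Suc K)
    have "(\<Sum>n<2 ^ Suc K. B n) = (\<Sum>n<2 ^ K. B n) + (\<Sum>n\<in>{2 ^ K..<2 ^ Suc K}. B n)"
    proof -
      have eq: "{..<2 ^ Suc K} = {..<2 ^ K} \<union> {2 ^ K..<(2::nat) ^ Suc K}"
        by (rule ivl_disj_un_one(2)[symmetric]) simp
      show ?thesis unfolding eq by (rule sum.union_disjoint) auto
    qed
    also have "(\<Sum>n\<in>{2 ^ K..<2 ^ Suc K}. B n) \<le> (\<Sum>n\<in>{n \<in> {2 ^ K..<(2::nat) ^ Suc K}. prime n}. 1 / 2 ^ K)"
    proof -
      have "(\<Sum>n\<in>{2 ^ K..<2 ^ Suc K}. B n) = (\<Sum>n\<in>{n \<in> {2 ^ K..<(2::nat) ^ Suc K}. prime n}. 1 / real n)"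
        unfolding B_def by (rule sum.inter_filter[symmetric]) simp
      also have "\<dots> \<le> (\<Sum>n\<in>{n \<in> {2 ^ K..<(2::nat) ^ Suc K}. prime n}. 1 / 2 ^ K)"
      proof (rule sum_mono)
        fix n assume n: "n \<in> {n \<in> {2 ^ K..<(2::nat) ^ Suc K}. prime n}"
        hence "real (2 ^ K) \<le> real n" by (simp only: mem_Collect_eq atLeastLessThan_iff of_nat_le_iff)
        hence "(2::real) ^ K \<le> real n" by (simp only: of_nat_power of_nat_numeral)
        thus "1 / real n \<le> 1 / 2 ^ K" by (intro frac_le) auto
      qed
      finally show ?thesis .
    qed
    also have "\<dots> = real (card {n \<in> {2 ^ K..<(2::nat) ^ Suc K}. prime n}) / 2 ^ K" by simp
    also have "\<dots> \<le> (C * sqrt (real (2 ^ Suc K))) / 2 ^ K"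
    proof (rule divide_right_mono)
      have "card {n \<in> {2 ^ K..<(2::nat) ^ Suc K}. prime n} \<le> card {p. prime p \<and> p \<le> (2::nat) ^ Suc K}"
        by (rule card_mono) auto
      thus "real (card {n \<in> {2 ^ K..<(2::nat) ^ Suc K}. prime n}) \<le> C * sqrt (real (2 ^ Suc K))"
        using C[of "2 ^ Suc K"] by linarith
    qed simp
    also have "\<dots> = C * sqrt 2 * q ^ K"
    proof -
      have "sqrt (real (2 ^ Suc K)) = sqrt 2 * sqrt 2 ^ K" by (simp add: real_sqrt_mult real_sqrt_power)
      moreover have "(2::real) ^ K = sqrt 2 ^ K * sqrt 2 ^ K" by (simp flip: power_mult_distrib)
      ultimately show ?thesis by (simp add: q_def power_divide field_simps)
    qed
    finally show ?case using Suc.IH by simp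
  qed (simp add: B_def)
  have "summable B"
  proof (rule bounded_imp_summable)
    fix n
    have "n < 2 ^ n" by (rule less_exp)
    hence "{..n} \<subseteq> {..<2 ^ n}" by (meson atMost_iff lessThan_iff order_le_less_trans subsetI)
    hence "(\<Sum>k\<le>n. B k) \<le> (\<Sum>k<2 ^ n. B k)" by (intro sum_mono2) (auto simp: B_def)
    also have "\<dots> \<le> (\<Sum>k<n. C * sqrt 2 * q ^ k)" by (rule dyadic)
    also have "\<dots> \<le> (\<Sum>k. C * sqrt 2 * q ^ k)"
      using q C0 by (intro sum_le_suminf summable_mult summable_geometric) auto
    finally show "(\<Sum>k\<le>n. B k) \<le> (\<Sum>k. C * sqrt 2 * q ^ k)" .
  qed (simp add: B_def)
  \<comment> \<open>The factor 2 bounds \<open>1 / (1 - 1 / p)\<close>, so that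
    \<open>2 * B p\<close> dominates the Euler factor of zeta at 1 without its constant
    term.\<close>
  hence B2: "summable (\<lambda>n. 2 * B n)" by (rule summable_mult)
  have pw: "real p powr - Re 1 = 1 / real p" if "prime p" for p
    using prime_gt_0_nat[OF that] by (simp add: powr_minus divide_inverse)
  have "summable (\<lambda>n. norm (dirichlet_term (mult_coeff (\<lambda>_. 1)) 1 n))"
  proof (rule euler_product(1)[OF _ _ B2])
    fix p :: nat assume p: "prime p"
    have p2: "real p \<ge> 2" using prime_ge_2_nat[OF p] by simp
    have sm: "summable (\<lambda>k. (1 / real p) ^ k)" using p2 by (intro summable_geometric) simp
    show "summable (\<lambda>k. norm (1::complex) * (real p powr - Re 1) ^ k)" using sm by (simp only: pw[OF p] norm_one mult_1)
    have "(\<Sum>k. norm (1::complex) * (real p powr - Re 1) ^ Suc k) = (\<Sum>k. (1 / real p) * (1 / real p) ^ k)"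
      by (simp only: pw[OF p] norm_one mult_1 power_Suc)
    also have "\<dots> = (1 / real p) * (1 / (1 - 1 / real p))"
      using p2 by (subst suminf_mult[OF sm], subst suminf_geometric) auto
    also have "\<dots> \<le> (1 / real p) * 2"
    proof (rule mult_left_mono)
      have "1 / real p \<le> 1 / 2" using p2 by (intro divide_left_mono) auto
      hence "1 / (1 - 1 / real p) \<le> 1 / (1 / 2)" by (intro divide_left_mono) auto
      thus "1 / (1 - 1 / real p) \<le> 2" by simp
    qed simp
    also have "\<dots> = 2 * B p" using p by (simp add: B_def)
    finally show "(\<Sum>k. norm (1::complex) * (real p powr - Re 1) ^ Suc k) \<le> 2 * B p" .
  qed (auto simp: B_def)
  hence "summable (\<lambda>n. real (Suc n) powr - 1)"
    unfolding mult_coeff_1 dirichlet_term_def mult_1 norm_Suc_powr by simp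
  hence "summable (\<lambda>n. real n powr - 1)" by (subst (asm) summable_Suc_iff)
  thus False by (subst (asm) summable_real_powr_iff) simp
qed

subsection \<open>Zeros near the imaginary axis\<close>

text \<open>With \<open>\<alpha> = 1 / (2 * Suc B)\<close> in
  \<open>ln x \<le> x powr \<alpha> / \<alpha>\<close>, the power \<open>Suc B\<close> of the
  right-hand side contains exactly a square root of \<open>x\<close>.\<close>

lemma power_ln_le_sqrt:
  fixes x :: real assumes "x \<ge> 1"
  shows "(1 + ln x) ^ Suc B \<le> (1 + 2 * real (Suc B)) ^ Suc B * sqrt x"
proof -
  define \<alpha> where "\<alpha> = 1 / (2 * real (Suc B))"
  have \<alpha>: "\<alpha> > 0" by (simp add: \<alpha>_def)
  have "ln x \<le> x powr \<alpha> / \<alpha>" by (rule ln_powr_bound[OF assms \<alpha>])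
  moreover have "1 \<le> x powr \<alpha>" using assms \<alpha> by (simp add: ge_one_powr_ge_zero)
  ultimately have "1 + ln x \<le> (1 + 1 / \<alpha>) * x powr \<alpha>" by (simp add: distrib_right)
  hence "(1 + ln x) ^ Suc B \<le> ((1 + 1 / \<alpha>) * x powr \<alpha>) ^ Suc B" using assms by (intro power_mono) auto
  also have "\<dots> = (1 + 1 / \<alpha>) ^ Suc B * (x powr \<alpha>) ^ Suc B" by (rule power_mult_distrib)
  also have "(x powr \<alpha>) ^ Suc B = x powr (\<alpha> * real (Suc B))"
    using assms by (subst powr_realpow[symmetric]) (auto simp: powr_powr simp del: of_nat_Suc)
  also have "\<alpha> * real (Suc B) = 1 / 2" unfolding \<alpha>_def by (simp del: of_nat_Suc)
  also have "x powr (1 / 2) = sqrt x" using assms by (simp add: powr_half_sqrt)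
  also have "1 / \<alpha> = 2 * real (Suc B)" by (simp add: \<alpha>_def)
  finally show ?thesis .
qed

lemma zeta_entire_nonzero: assumes "Re w > 1" shows "zeta_entire w \<noteq> 0"
  using riemann_zeta_nonzero[OF assms] by (auto simp: zeta_entire(4))

text \<open>
  If for every large prime \<open>p\<close> the solution of \<open>p powr - s = x\<^sub>0\<close> nearest to \<open>\<i> * t\<close> were hit by a zero
  of some \<open>zeta (n * s)\<close>, then \<open>n\<close> would be logarithmic in \<open>p\<close>, so the number of primes up to \<open>x\<close>
  would be at most a power of \<open>ln x\<close>.
\<close>

lemma ex_prime_solution_avoiding_zeta_zeros:
  fixes x0 :: complex and t \<delta> :: real
  assumes x0: "x0 \<noteq> 0" "norm x0 < 1" and \<delta>: "\<delta> > 0"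
  shows "\<exists>p s. prime p \<and> of_nat p powr - s = x0 \<and> norm (s - \<i> * t) < \<delta> \<and> Re s > 0 \<and>
           (\<forall>n>0. zeta_entire (of_nat n * s) \<noteq> 0)"
proof (rule ccontr)
  assume contra: "\<not> ?thesis"
  define l where "l = - Ln x0"
  define b where "b = Re l"
  have b: "b > 0" using x0 by (simp add: b_def l_def ln_less_zero)
  \<comment> \<open>Among the solutions \<open>(l + 2 * pi * \<i> * k) / ln p\<close> of
    \<open>p powr - s = x0\<close>, this \<open>k\<close> brings the imaginary part next to
    \<open>t\<close>. All of them have the same real part \<open>b / ln p\<close>.\<close>
  define k where "k = (\<lambda>p::nat. round ((t * ln (real p) - Im l) / (2 * pi)))"
  define s where "s = (\<lambda>p::nat. (l + 2 * pi * \<i> * of_int (k p)) / of_real (ln (real p)))"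
  \<comment> \<open>The real part of \<open>s p\<close> is \<open>b / ln p\<close>, and its
    imaginary part deviates from \<open>t\<close> by at most \<open>2 * pi / ln p\<close>; from
    \<open>p0\<close> on their sum is below \<open>\<delta>\<close>.\<close>
  define p0 where "p0 = nat \<lceil>exp ((b + 2 * pi) / \<delta>)\<rceil> + 2"
  have lnp: "ln (real p) > 0" if "prime p" for p using prime_gt_1_nat[OF that] by simp
  have Re_s: "Re (s p) = b / ln (real p)" for p by (simp add: s_def b_def)
  have powr_s: "of_nat p powr - s p = x0" if p: "prime p" for p
  proof -
    have p0: "(of_nat p :: complex) \<noteq> 0" "real p > 0" using prime_gt_0_nat[OF p] by auto
    have L: "of_real (ln (real p)) \<noteq> (0 :: complex)" using lnp[OF p] by simp
    have "Ln (of_nat p) = of_real (ln (real p))" using prime_gt_0_nat[OF p] by (rule Ln_of_nat)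
    hence "of_nat p powr - s p = exp (- s p * of_real (ln (real p)))" by (simp only: powr_def p0 if_False)
    also have "- s p * of_real (ln (real p)) = - l - of_real (2 * of_int (k p) * pi) * \<i>"
      unfolding s_def minus_mult_left[symmetric] times_divide_eq_left nonzero_mult_div_cancel_right[OF L] by simp
    also have "exp \<dots> = exp (- l) / exp (of_real (2 * of_int (k p) * pi) * \<i>)" by (rule exp_diff)
    also have "exp (of_real (2 * of_int (k p) * pi) * \<i>) = (1 :: complex)" by (rule exp_integer_2pi) auto
    also have "exp (- l) = x0" using x0 by (simp add: l_def)
    finally show ?thesis by simp
  qed
  have close: "norm (s p - \<i> * t) < \<delta>" if p: "prime p" "p0 \<le> p" for p
  proof -
    have "exp ((b + 2 * pi) / \<delta>) < real p" using p(2) unfolding p0_def by linarith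
    hence "exp ((b + 2 * pi) / \<delta>) < exp (ln (real p))" using prime_gt_0_nat[OF p(1)] by simp
    hence "(b + 2 * pi) / \<delta> < ln (real p)" by (simp only: exp_less_cancel_iff)
    hence lnp': "(b + 2 * pi) / ln (real p) < \<delta>" using \<delta> lnp[OF p(1)] by (simp add: field_simps)
    have "norm (s p - \<i> * t) \<le> \<bar>Re (s p - \<i> * t)\<bar> + \<bar>Im (s p - \<i> * t)\<bar>" by (rule cmod_le)
    also have "\<bar>Re (s p - \<i> * t)\<bar> = b / ln (real p)" using b lnp[OF p(1)] by (simp add: Re_s)
    also have "\<bar>Im (s p - \<i> * t)\<bar> = \<bar>Im l + 2 * pi * of_int (k p) - t * ln (real p)\<bar> / ln (real p)"
    proof -
      have "Im (s p - \<i> * t) = (Im l + 2 * pi * of_int (k p) - t * ln (real p)) / ln (real p)"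
        using lnp[OF p(1)] by (simp add: s_def field_simps)
      thus ?thesis using lnp[OF p(1)] by (simp only: abs_divide abs_of_pos)
    qed
    also have "\<bar>Im l + 2 * pi * of_int (k p) - t * ln (real p)\<bar> \<le> 2 * pi"
    proof -
      define y where "y = (t * ln (real p) - Im l) / (2 * pi)"
      have "\<bar>of_int (round y) - y\<bar> \<le> 1/2" by (rule of_int_round_abs_le)
      hence "2 * pi * \<bar>of_int (k p) - y\<bar> \<le> 2 * pi * 1" unfolding k_def y_def by (intro mult_left_mono) auto
      moreover have "2 * pi * \<bar>of_int (k p) - y\<bar> = \<bar>2 * pi * (of_int (k p) - y)\<bar>" by (simp add: abs_mult)
      moreover have "2 * pi * (of_int (k p) - y) = Im l + 2 * pi * of_int (k p) - t * ln (real p)"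
        by (simp add: y_def field_simps)
      ultimately show ?thesis by simp
    qed
    hence "\<bar>Im l + 2 * pi * of_int (k p) - t * ln (real p)\<bar> / ln (real p) \<le> 2 * pi / ln (real p)"
      using lnp[OF p(1)] by (intro divide_right_mono) auto
    finally have "norm (s p - \<i> * t) \<le> b / ln (real p) + 2 * pi / ln (real p)" by simp
    thus ?thesis using lnp' by (simp add: add_divide_distrib)
  qed
  have "\<forall>p. prime p \<and> p0 \<le> p \<longrightarrow> (\<exists>n>0. zeta_entire (of_nat n * s p) = 0)"
  proof (intro allI impI)
    fix p assume p: "prime p \<and> p0 \<le> p"
    note p1 = p[THEN conjunct1] and p2 = p[THEN conjunct2]
    have R: "Re (s p) > 0" unfolding Re_s using b lnp[OF p1] by (rule divide_pos_pos)
    have "\<not> (\<forall>n>0. zeta_entire (of_nat n * s p) \<noteq> 0)"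
    proof
      assume "\<forall>n>0. zeta_entire (of_nat n * s p) \<noteq> 0"
      with p1 powr_s[OF p1] close[OF p1 p2] R
      have "prime p \<and> of_nat p powr - s p = x0 \<and> norm (s p - \<i> * t) < \<delta> \<and> Re (s p) > 0 \<and>
        (\<forall>n>0. zeta_entire (of_nat n * s p) \<noteq> 0)" by (intro conjI)
      hence "\<exists>p s. prime p \<and> of_nat p powr - s = x0 \<and> norm (s - \<i> * t) < \<delta> \<and> Re s > 0 \<and>
        (\<forall>n>0. zeta_entire (of_nat n * s) \<noteq> 0)" by (intro exI)
      with contra show False by (rule notE)
    qed
    thus "\<exists>n>0. zeta_entire (of_nat n * s p) = 0" by simp
  qed
  hence "\<exists>n. \<forall>p. prime p \<and> p0 \<le> p \<longrightarrow> n p > 0 \<and> zeta_entire (of_nat (n p) * s p) = 0"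
    by (intro choice) auto
  then obtain n where n: "\<And>p. prime p \<Longrightarrow> p0 \<le> p \<Longrightarrow> n p > 0 \<and> zeta_entire (of_nat (n p) * s p) = 0"
    by blast
  define w where "w = (\<lambda>p. of_nat (n p) * s p)"
  define T where "T = \<bar>t\<bar> + \<delta>"
  have T0: "T \<ge> 0" using \<delta> by (simp add: T_def)
  \<comment> \<open>Zeta has no zeros with real part above 1, and \<open>Re (w p)\<close> is
    \<open>n p * b / ln p\<close>. This limits \<open>n p\<close> to a multiple of
    \<open>ln p\<close>, and with it the height of the zero.\<close>
  have np: "real (n p) \<le> ln (real p) / b" "0 \<le> Re (w p)" "Re (w p) \<le> 1" "\<bar>Im (w p)\<bar> \<le> ln (real p) / b * T"
    if p: "prime p" "p0 \<le> p" for p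
  proof -
    have Rew: "Re (w p) = real (n p) * (b / ln (real p))" by (simp add: w_def Re_s)
    show R1: "Re (w p) \<le> 1" using zeta_entire_nonzero[of "w p"] n[OF p] unfolding w_def by force
    thus n1: "real (n p) \<le> ln (real p) / b" unfolding Rew using b lnp[OF p(1)] by (simp add: field_simps)
    show "0 \<le> Re (w p)" unfolding Rew using b lnp[OF p(1)] by simp
    have "\<bar>Im (s p)\<bar> \<le> T"
      using abs_Im_le_cmod[of "s p - \<i> * t"] close[OF p] by (simp add: T_def)
    hence "real (n p) * \<bar>Im (s p)\<bar> \<le> (ln (real p) / b) * T" using n1 b lnp[OF p(1)] by (intro mult_mono) auto
    thus "\<bar>Im (w p)\<bar> \<le> ln (real p) / b * T" by (simp add: w_def abs_mult)
  qed
  obtain C A where C0: "C \<ge> 0" and CA: "\<And>(N::nat) W. finite W \<Longrightarrow>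
     W \<subseteq> {w. 0 \<le> Re w \<and> Re w \<le> 1 \<and> \<bar>Im w\<bar> \<le> real N \<and> zeta_entire w = 0} \<Longrightarrow> real (card W) \<le> C * (1 + real N) ^ A"
    using card_zeta_zeros by blast
  define K where "K = 1 / b * (C * (2 + T / b) ^ A)"
  have K0: "K \<ge> 0" using b C0 T0 by (auto simp: K_def intro!: mult_nonneg_nonneg)
  have count: "real (card {p. prime p \<and> p \<le> x}) \<le> (real p0 + K) * (1 + ln (real x)) ^ Suc A" if x: "x \<ge> 1" for x :: nat
  proof -
    define S where "S = {p. prime p \<and> p0 \<le> p \<and> p \<le> x}"
    have finS: "finite S" by (rule finite_subset[of _ "{..x}"]) (auto simp: S_def)
    define y where "y = ln (real x)"
    have y0: "y \<ge> 0" using x by (simp add: y_def)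
    have lny: "ln (real p) \<le> y" if "p \<in> S" for p
      using that x prime_gt_0_nat[of p] by (auto simp: S_def y_def)
    define N where "N = nat \<lceil>y / b * T\<rceil>"
    have N: "real N \<le> y / b * T + 1" "y / b * T \<le> real N"
      using y0 b T0 by (auto simp: N_def intro!: of_nat_ceiling)
    have W: "real (card (w ` S)) \<le> C * (1 + real N) ^ A"
    proof (rule CA)
      show "w ` S \<subseteq> {w. 0 \<le> Re w \<and> Re w \<le> 1 \<and> \<bar>Im w\<bar> \<le> real N \<and> zeta_entire w = 0}"
      proof (rule image_subsetI, rule CollectI, intro conjI)
        fix p assume p: "p \<in> S"
        hence p': "prime p" "p0 \<le> p" by (auto simp: S_def)
        show "0 \<le> Re (w p)" "Re (w p) \<le> 1" by (rule np[OF p'])+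
        show "zeta_entire (w p) = 0" using n[OF p'] by (simp add: w_def)
        have "ln (real p) / b * T \<le> y / b * T" using lny[OF p] b T0 by (intro mult_right_mono divide_right_mono) auto
        thus "\<bar>Im (w p)\<bar> \<le> real N" using np(4)[OF p'] N(2) by linarith
      qed
    qed (use finS in simp)
    \<comment> \<open>The quotient of \<open>w p\<close> by \<open>n p\<close> is
      \<open>s p\<close>, whose real part \<open>b / ln p\<close> determines
      \<open>p\<close>.\<close>
    have inj: "inj_on (\<lambda>p. (n p, w p)) S"
    proof (rule inj_onI)
      fix p q assume pq: "p \<in> S" "q \<in> S" "(n p, w p) = (n q, w q)"
      hence p: "prime p" "p0 \<le> p" and q: "prime q" "p0 \<le> q" by (auto simp: S_def)
      have "n p = n q" "w p = w q" using pq(3) by auto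
      hence "of_nat (n p) * s p = of_nat (n p) * s q" by (simp only: w_def)
      hence "s p = s q" using n[OF p] by simp
      hence "b / ln (real p) = b / ln (real q)" by (simp only: Re_s[symmetric])
      hence "ln (real p) = ln (real q)" using b lnp[OF p(1)] lnp[OF q(1)] by (simp add: field_simps)
      thus "p = q" using prime_gt_0_nat[OF p(1)] prime_gt_0_nat[OF q(1)] by simp
    qed
    define m where "m = nat \<lfloor>y / b\<rfloor>"
    have m: "real m \<le> y / b" unfolding m_def using y0 b by (intro of_nat_floor) auto
    have "(\<lambda>p. (n p, w p)) ` S \<subseteq> {1..m} \<times> w ` S"
    proof (rule image_subsetI)
      fix p assume p: "p \<in> S"
      hence p': "prime p" "p0 \<le> p" by (auto simp: S_def)
      have "real (n p) \<le> y / b" using np(1)[OF p'] lny[OF p] b by (meson divide_right_mono less_imp_le order_trans)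
      hence "n p \<le> m" unfolding m_def by (simp add: le_nat_floor)
      thus "(n p, w p) \<in> {1..m} \<times> w ` S" using n[OF p'] p by auto
    qed
    hence "card S \<le> card ({1..m} \<times> w ` S)" using finS inj by (intro card_inj_on_le) auto
    hence "card S \<le> m * card (w ` S)" by (simp add: card_cartesian_product)
    hence "real (card S) \<le> real m * real (card (w ` S))" by (metis of_nat_le_iff of_nat_mult)
    also have "\<dots> \<le> (y / b) * (C * (1 + real N) ^ A)" using m W y0 b by (intro mult_mono) auto
    also have "\<dots> \<le> ((1 + y) / b) * (C * ((2 + T / b) * (1 + y)) ^ A)"
    proof (intro mult_mono mult_left_mono power_mono)
      have "1 + real N \<le> 2 + y * (T / b)" using N(1) by simp
      also have "\<dots> \<le> (2 + T / b) * (1 + y)"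
      proof -
        define u where "u = T / b"
        have "u \<ge> 0" using b T0 by (simp add: u_def)
        thus ?thesis unfolding u_def[symmetric] using y0 by (simp add: algebra_simps)
      qed
      finally show "1 + real N \<le> (2 + T / b) * (1 + y)" .
    qed (use y0 b C0 T0 in \<open>auto intro!: divide_right_mono mult_nonneg_nonneg\<close>)
    also have "\<dots> = K * (1 + y) ^ Suc A"
      by (simp only: K_def power_mult_distrib power_Suc divide_inverse mult_1) (simp only: mult_ac)
    finally have cS: "real (card S) \<le> K * (1 + y) ^ Suc A" .
    have "card {p. prime p \<and> p \<le> x} \<le> card ({..<p0} \<union> S)"
      by (rule card_mono) (use finS in \<open>auto simp: S_def\<close>)
    also have "\<dots> \<le> p0 + card S" using card_Un_le[of "{..<p0}" S] by simp
    finally have "real (card {p. prime p \<and> p \<le> x}) \<le> real p0 + real (card S)" by linarith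
    also have "\<dots> \<le> real p0 * (1 + y) ^ Suc A + K * (1 + y) ^ Suc A"
    proof -
      have "1 \<le> (1 + y) ^ Suc A" using y0 by (intro one_le_power) auto
      hence "real p0 * 1 \<le> real p0 * (1 + y) ^ Suc A" by (rule mult_left_mono) simp
      thus ?thesis using cS by simp
    qed
    finally show ?thesis unfolding y_def distrib_right .
  qed
  show False
  proof (rule not_primes_le_sqrt)
    fix x :: nat
    show "real (card {p. prime p \<and> p \<le> x}) \<le> ((real p0 + K) * (1 + 2 * real (Suc A)) ^ Suc A) * sqrt (real x)"
    proof (cases "x = 0")
      case True
      hence "{p::nat. prime p \<and> p \<le> x} = {}" by auto
      thus ?thesis using True by (simp only: card.empty) simp
    next
      case False
      have "real (card {p. prime p \<and> p \<le> x}) \<le> (real p0 + K) * (1 + ln (real x)) ^ Suc A" by (rule count) (use False in simp)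
      also have "\<dots> \<le> (real p0 + K) * ((1 + 2 * real (Suc A)) ^ Suc A * sqrt (real x))"
        using False K0 by (intro mult_left_mono power_ln_le_sqrt) auto
      finally show ?thesis by (simp only: mult.assoc)
    qed
  qed
qed

subsection \<open>Splitting off cyclotomic factors\<close>

text \<open>Integrality is carried along because the next coefficient becomes the exponent of a zeta
  factor.\<close>

definition int_coeffs :: "nat \<Rightarrow> (nat \<Rightarrow> complex) \<Rightarrow> bool" where
  "int_coeffs M a \<longleftrightarrow> disc_coeffs a \<and> (\<forall>k. a k \<in> \<int>) \<and> a 0 = 1 \<and> (\<forall>k. 0 < k \<longrightarrow> k \<le> M \<longrightarrow> a k = 0)"

text \<open>Series of the shape \<open>1 + e * x ^ n + \<dots>\<close>: under multiplication the
  \<open>e\<close> add up, so the exponent that cancels a given term can be read off.\<close>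

definition unit_fps :: "nat \<Rightarrow> complex \<Rightarrow> complex fps \<Rightarrow> bool" where
  "unit_fps n e \<psi> \<longleftrightarrow> (\<forall>k. fps_nth \<psi> k \<in> \<int>) \<and> fps_nth \<psi> 0 = 1 \<and>
     (\<forall>k. 0 < k \<longrightarrow> k < n \<longrightarrow> fps_nth \<psi> k = 0) \<and> fps_nth \<psi> n = e"

lemma unit_fps_mult:
  assumes n: "n > 0" and "unit_fps n e \<psi>" "unit_fps n e' \<phi>"
  shows "unit_fps n (e + e') (\<psi> * \<phi>)"
proof -
  have p: "\<And>k. fps_nth \<psi> k \<in> \<int>" "fps_nth \<psi> 0 = 1" "\<And>k. 0 < k \<Longrightarrow> k < n \<Longrightarrow> fps_nth \<psi> k = 0" "fps_nth \<psi> n = e"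
    and c: "\<And>k. fps_nth \<phi> k \<in> \<int>" "fps_nth \<phi> 0 = 1" "\<And>k. 0 < k \<Longrightarrow> k < n \<Longrightarrow> fps_nth \<phi> k = 0" "fps_nth \<phi> n = e'"
    using assms by (auto simp: unit_fps_def)
  have "fps_nth (\<psi> * \<phi>) k \<in> \<int>" for k
    unfolding fps_mult_nth by (intro Ints_sum Ints_mult p c)
  moreover have "fps_nth (\<psi> * \<phi>) 0 = 1" by (simp add: p c)
  moreover have "fps_nth (\<psi> * \<phi>) k = 0" if k: "0 < k" "k < n" for k
    unfolding fps_mult_nth
  proof (rule sum.neutral, rule ballI)
    fix i assume i: "i \<in> {0..k}"
    show "fps_nth \<psi> i * fps_nth \<phi> (k - i) = 0"
    proof (cases "i = 0")
      case True thus ?thesis using c(3)[OF k] by simp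
    next
      case False thus ?thesis using p(3)[of i] i k by simp
    qed
  qed
  moreover have "fps_nth (\<psi> * \<phi>) n = e + e'"
  proof -
    have "(\<Sum>i=0..n. fps_nth \<psi> i * fps_nth \<phi> (n - i)) = (\<Sum>i\<in>{0, n}. fps_nth \<psi> i * fps_nth \<phi> (n - i))"
      by (rule sum.mono_neutral_right) (use p(3) in auto)
    thus ?thesis using n p c by (simp add: fps_mult_nth add.commute)
  qed
  ultimately show ?thesis by (simp add: unit_fps_def)
qed

lemma unit_fps_power: "n > 0 \<Longrightarrow> unit_fps n e \<psi> \<Longrightarrow> unit_fps n (of_nat m * e) (\<psi> ^ m)"
proof (induction m)
  case 0
  thus ?case by (simp add: unit_fps_def)
next
  case (Suc m)
  show ?case using unit_fps_mult[OF Suc.prems(1,2) Suc.IH[OF Suc.prems]] by (simp add: algebra_simps)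
qed

lemma unit_fps_cyclotomic: "n > 0 \<Longrightarrow> unit_fps n (-1) (1 - fps_X ^ n)"
  by (auto simp: unit_fps_def)

lemma fps_nth_mult_cyclotomic:
  fixes \<psi> :: "complex fps"
  shows "fps_nth (\<psi> * (1 - fps_X ^ n)) k = fps_nth \<psi> k - (if k < n then 0 else fps_nth \<psi> (k - n))"
  by (simp add: algebra_simps fps_X_power_mult_right_nth)

lemma unit_fps_inverse_cyclotomic:
  assumes "n > 0" shows "unit_fps n 1 (inverse (1 - fps_X ^ n))"
proof -
  define \<iota> :: "complex fps" where "\<iota> = Abs_fps (\<lambda>k. if n dvd k then 1 else 0)"
  have "\<iota> * (1 - fps_X ^ n) = 1"
  proof (rule fps_ext)
    fix k
    show "fps_nth (\<iota> * (1 - fps_X ^ n)) k = fps_nth 1 k"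
    proof (cases "k < n")
      case True
      hence "n dvd k \<longleftrightarrow> k = 0" by (auto dest: dvd_imp_le)
      thus ?thesis unfolding fps_nth_mult_cyclotomic using True by (simp add: \<iota>_def)
    next
      case False
      hence "n dvd k - n \<longleftrightarrow> n dvd k" by (simp add: dvd_minus_self)
      moreover have "k \<noteq> 0" using False assms by simp
      ultimately show ?thesis unfolding fps_nth_mult_cyclotomic using False by (simp add: \<iota>_def)
    qed
  qed
  hence "inverse (1 - fps_X ^ n) = \<iota>"
    by (intro fps_inverse_unique) (simp add: mult.commute)
  moreover have "unit_fps n 1 \<iota>" using assms by (auto simp: unit_fps_def \<iota>_def dest: dvd_imp_le)
  ultimately show ?thesis by simp
qed

lemma holomorphic_imp_disc_coeffs:
  assumes f: "f holomorphic_on ball 0 1"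
  shows "disc_coeffs (fps_nth (fps_expansion f 0))"
    and "norm x < 1 \<Longrightarrow> power_series (fps_nth (fps_expansion f 0)) x = f x"
    and "f has_fps_expansion fps_expansion f 0"
proof -
  have sums: "(\<lambda>k. fps_nth (fps_expansion f 0) k * x ^ k) sums f x" if "norm x < 1" for x
    using holomorphic_power_series[OF f, of x] that by (simp add: fps_expansion_def)
  thus "norm x < 1 \<Longrightarrow> power_series (fps_nth (fps_expansion f 0)) x = f x"
    unfolding power_series_def by (simp add: sums_iff)
  show "disc_coeffs (fps_nth (fps_expansion f 0))"
    unfolding disc_coeffs_def
  proof (intro allI impI)
    fix r :: real assume r: "0 \<le> r" "r < 1"
    define r' where "r' = (r + 1) / 2"
    have r': "r < r'" "r' < 1" "0 \<le> r'" using r by (auto simp: r'_def)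
    have "summable (\<lambda>k. fps_nth (fps_expansion f 0) k * (of_real r') ^ k)"
      using sums[of "of_real r'"] r' by (auto simp: sums_iff)
    hence "summable (\<lambda>k. norm (fps_nth (fps_expansion f 0) k * (of_real r) ^ k))"
      by (rule powser_insidea) (use r r' in simp)
    thus "summable (\<lambda>k. norm (fps_nth (fps_expansion f 0) k) * r ^ k)"
      using r by (simp add: norm_mult norm_power)
  qed
  show "f has_fps_expansion fps_expansion f 0"
    by (rule has_fps_expansion_fps_expansion[OF _ _ f]) auto
qed

lemma power_series_holomorphic_ball: "disc_coeffs a \<Longrightarrow> power_series a holomorphic_on ball 0 1"
  unfolding power_series_def[abs_def] by (rule disc_coeffs_holomorphic)

lemma power_series_has_fps_expansion: "disc_coeffs a \<Longrightarrow> power_series a has_fps_expansion Abs_fps a"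
  unfolding power_series_def[abs_def] by (rule disc_coeffs_has_fps_expansion)

lemma one_minus_power_nonzero:
  fixes x :: complex assumes "norm x < 1" "n > 0" shows "1 - x ^ n \<noteq> 0"
proof -
  have "norm (x ^ n) < 1" using assms by (simp add: norm_power power_less_one_iff)
  thus ?thesis by auto
qed

text \<open>The exponent is the coefficient \<open>a (Suc M)\<close> itself, since
  \<open>(1 - x ^ n) powi c\<close> begins with \<open>1 - c * x ^ n\<close>. As
  \<open>1 - x ^ n\<close> does not vanish in the disc, the product stays holomorphic there for
  negative \<open>c\<close> too, and convergence in the disc is kept.\<close>

lemma int_coeffs_step:
  assumes a: "int_coeffs M a"
  shows "\<exists>b. int_coeffs (Suc M) b \<and> (\<exists>c::int. \<forall>x. norm x < 1 \<longrightarrow> power_series b x = power_series a x * (1 - x ^ Suc M) powi c)"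
proof -
  define n where "n = Suc M"
  have n: "n > 0" by (simp add: n_def)
  have a': "disc_coeffs a" "\<And>k. a k \<in> \<int>" "a 0 = 1" "\<And>k. 0 < k \<Longrightarrow> k \<le> M \<Longrightarrow> a k = 0"
    using a by (auto simp: int_coeffs_def)
  obtain c where c: "a n = of_int c" using a'(2)[of n] by (elim Ints_cases)
  define f where "f = (\<lambda>x. power_series a x * (1 - x ^ n) powi c)"
  have hol: "f holomorphic_on ball 0 1"
    unfolding f_def using power_series_holomorphic_ball[OF a'(1)] one_minus_power_nonzero[OF _ n]
    by (intro holomorphic_intros) auto
  define \<Psi> :: "complex fps" where "\<Psi> = (if c \<ge> 0 then (1 - fps_X ^ n) ^ nat c else inverse (1 - fps_X ^ n) ^ nat (- c))"
  have X: "(\<lambda>x::complex. 1 - x ^ n) has_fps_expansion (1 - fps_X ^ n)" by (intro fps_expansion_intros)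
  have "(\<lambda>x. (1 - x ^ n) powi c) has_fps_expansion \<Psi>"
  proof (cases "c \<ge> 0")
    case True
    thus ?thesis unfolding \<Psi>_def power_int_def using has_fps_expansion_power[OF X] by simp
  next
    case False
    have "(\<lambda>x::complex. inverse (1 - x ^ n)) has_fps_expansion inverse (1 - fps_X ^ n)"
      by (rule has_fps_expansion_inverse[OF X]) (use n in simp)
    from has_fps_expansion_power[OF this] show ?thesis unfolding \<Psi>_def power_int_def using False by simp
  qed
  hence "f has_fps_expansion Abs_fps a * \<Psi>"
    unfolding f_def by (intro has_fps_expansion_mult power_series_has_fps_expansion a'(1))
  hence eq: "fps_expansion f 0 = Abs_fps a * \<Psi>"
    by (rule fps_expansion_unique_complex[OF holomorphic_imp_disc_coeffs(3)[OF hol]])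
  have "unit_fps n (- of_int c) \<Psi>"
  proof (cases "c \<ge> 0")
    case True
    have "unit_fps n (of_nat (nat c) * -1) ((1 - fps_X ^ n) ^ nat c)"
      by (rule unit_fps_power[OF n unit_fps_cyclotomic[OF n]])
    thus ?thesis using True by (simp add: \<Psi>_def)
  next
    case False
    have "unit_fps n (of_nat (nat (- c)) * 1) (inverse (1 - fps_X ^ n) ^ nat (- c))"
      by (rule unit_fps_power[OF n unit_fps_inverse_cyclotomic[OF n]])
    thus ?thesis using False by (simp add: \<Psi>_def)
  qed
  moreover have "unit_fps n (of_int c) (Abs_fps a)" using a' c by (auto simp: unit_fps_def n_def)
  ultimately have u: "unit_fps n (of_int c + - of_int c) (Abs_fps a * \<Psi>)" by (intro unit_fps_mult n)
  have "int_coeffs (Suc M) (fps_nth (fps_expansion f 0))"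
  proof -
    have "fps_nth (fps_expansion f 0) k = 0" if "0 < k" "k \<le> Suc M" for k
      using u that unfolding eq unit_fps_def n_def by (cases "k = Suc M") auto
    thus ?thesis using u holomorphic_imp_disc_coeffs(1)[OF hol] unfolding int_coeffs_def eq unit_fps_def by blast
  qed
  moreover have "\<forall>x. norm x < 1 \<longrightarrow> power_series (fps_nth (fps_expansion f 0)) x = power_series a x * (1 - x ^ Suc M) powi c"
    using holomorphic_imp_disc_coeffs(2)[OF hol] by (simp add: f_def n_def)
  ultimately show ?thesis by blast
qed

text \<open>The exponents 2, 3, 3 come from \<open>1 + 2 x + 6 x^2 + 13 x^3\<close>: multiplied by
  \<open>(1 - x)^2\<close> the series begins with \<open>1 + 3 x^2 + 3 x^3\<close>, and
  \<open>(1 - x^2)^3\<close> and \<open>(1 - x^3)^3\<close> remove the two remaining terms.\<close>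

lemma ex_int_coeffs_start:
  "\<exists>a. int_coeffs 3 a \<and> (\<forall>x. norm x < 1 \<longrightarrow>
     power_series a x = pair_series x * (1 - x) ^ 2 * (1 - x ^ 2) ^ 3 * (1 - x ^ 3) ^ 3)"
proof -
  define N where "N = (\<lambda>k. of_nat (num_partition_pairs k) :: complex)"
  define f where "f = (\<lambda>x. pair_series x * (1 - x) ^ 2 * (1 - x ^ 2) ^ 3 * (1 - x ^ 3) ^ 3)"
  have ps: "pair_series = power_series N" by (simp add: fun_eq_iff pair_series_def power_series_def N_def)
  have N: "disc_coeffs N" unfolding N_def by (rule disc_coeffs_pairs)
  have hol: "f holomorphic_on ball 0 1"
    unfolding f_def ps using power_series_holomorphic_ball[OF N] by (intro holomorphic_intros)
  define P :: "complex fps" where "P = Abs_fps N * (1 - fps_X) ^ 2 * (1 - fps_X ^ 2) ^ 3 * (1 - fps_X ^ 3) ^ 3"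
  have "f has_fps_expansion P"
    unfolding f_def ps P_def by (intro fps_expansion_intros power_series_has_fps_expansion N)
  hence eq: "fps_expansion f 0 = P"
    by (rule fps_expansion_unique_complex[OF holomorphic_imp_disc_coeffs(3)[OF hol]])
  have N03: "N 0 = 1" "N (Suc 0) = 2" "N 1 = 2" "N 2 = 6" "N 3 = 13"
    using num_partition_pairs_0_3 by (auto simp: N_def)
  have P': "P = Abs_fps N * (1 - fps_X ^ 1) * (1 - fps_X ^ 1) * (1 - fps_X ^ 2) * (1 - fps_X ^ 2) * (1 - fps_X ^ 2)
      * (1 - fps_X ^ 3) * (1 - fps_X ^ 3) * (1 - fps_X ^ 3)"
    by (simp only: P_def power2_eq_square[of "1 - fps_X"] power3_eq_cube[of "1 - fps_X ^ 2"] power3_eq_cube[of "1 - fps_X ^ 3"] power_one_right mult.assoc)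
  have nth: "fps_nth P 0 = 1" "fps_nth P 1 = 0" "fps_nth P 2 = 0" "fps_nth P 3 = 0"
    unfolding P' by (simp_all add: fps_nth_mult_cyclotomic N03 del: One_nat_def power_one_right)
  have int: "fps_nth P k \<in> \<int>" for k
  proof -
    have "fps_nth (\<psi> * (1 - fps_X ^ n)) k \<in> \<int>" if "\<And>k. fps_nth \<psi> k \<in> \<int>" for \<psi> :: "complex fps" and n k
      unfolding fps_nth_mult_cyclotomic using that by auto
    moreover have "fps_nth (Abs_fps N) k \<in> \<int>" for k by (simp add: N_def)
    ultimately show ?thesis unfolding P' by metis
  qed
  have "fps_nth P k = 0" if "0 < k" "k \<le> 3" for k
  proof -
    have "k = 1 \<or> k = 2 \<or> k = 3" using that by auto
    thus ?thesis using nth by auto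
  qed
  hence "int_coeffs 3 (fps_nth (fps_expansion f 0))"
    using nth int holomorphic_imp_disc_coeffs(1)[OF hol] unfolding int_coeffs_def eq by blast
  moreover have "\<forall>x. norm x < 1 \<longrightarrow> power_series (fps_nth (fps_expansion f 0)) x = f x"
    using holomorphic_imp_disc_coeffs(2)[OF hol] by blast
  ultimately show ?thesis unfolding f_def by blast
qed

text \<open>Index \<open>4 + j\<close> is the first positive one at which \<open>a j\<close> may be
  nonzero. The signs and sizes of the exponents \<open>c j\<close> are left open; the continuation
  and the boundary argument work for all of them.\<close>

locale cyclotomic_factorisation =
  fixes a :: "nat \<Rightarrow> nat \<Rightarrow> complex" and c :: "nat \<Rightarrow> int"
  assumes ints: "int_coeffs (3 + j) (a j)"
    and step: "norm x < 1 \<Longrightarrow> power_series (a (Suc j)) x = power_series (a j) x * (1 - x ^ (4 + j)) powi c j"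
    and start: "norm x < 1 \<Longrightarrow> power_series (a 0) x = pair_series x * (1 - x) ^ 2 * (1 - x ^ 2) ^ 3 * (1 - x ^ 3) ^ 3"

lemma ex_cyclotomic_factorisation: "\<exists>a c. cyclotomic_factorisation a c"
proof -
  obtain a0 where a0: "int_coeffs 3 a0"
    "\<forall>x. norm x < 1 \<longrightarrow> power_series a0 x = pair_series x * (1 - x) ^ 2 * (1 - x ^ 2) ^ 3 * (1 - x ^ 3) ^ 3"
    using ex_int_coeffs_start by blast
  define P where "P = (\<lambda>j a. int_coeffs (3 + j) a \<and> (j = 0 \<longrightarrow> a = a0))"
  define Q where "Q = (\<lambda>j a b. \<exists>c::int. \<forall>x. norm x < 1 \<longrightarrow> power_series b x = power_series a x * (1 - x ^ (4 + j)) powi c)"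
  have "\<exists>f. \<forall>j. P j (f j) \<and> Q j (f j) (f (Suc j))"
  proof (rule dependent_nat_choice)
    show "\<exists>x. P 0 x" using a0 by (auto simp: P_def)
    fix x j assume "P j x"
    hence "int_coeffs (3 + j) x" by (simp add: P_def)
    from int_coeffs_step[OF this] show "\<exists>y. P (Suc j) y \<and> Q j x y" by (simp add: P_def Q_def)
  qed
  then obtain f where f: "\<And>j. P j (f j)" "\<And>j. Q j (f j) (f (Suc j))" by blast
  have "\<exists>c. \<forall>j x. norm x < 1 \<longrightarrow> power_series (f (Suc j)) x = power_series (f j) x * (1 - x ^ (4 + j)) powi c j"
    using f(2) unfolding Q_def by (intro choice allI)
  then obtain c where "\<And>j x. norm x < 1 \<Longrightarrow> power_series (f (Suc j)) x = power_series (f j) x * (1 - x ^ (4 + j)) powi c j"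
    by blast
  moreover have "f 0 = a0" "int_coeffs (3 + j) (f j)" for j using f(1)[of 0] f(1)[of j] by (auto simp: P_def)
  ultimately have "cyclotomic_factorisation f c" using a0(2) by unfold_locales auto
  thus ?thesis by blast
qed

subsection \<open>Continuation and natural boundary\<close>

text \<open>Supplies the series between \<open>pair_series\<close> and \<open>a 0\<close> when the
  first zeta factors are split off one at a time. This happens for \<open>Re s > 1\<close>, where no
  vanishing coefficients have to be tracked.\<close>

lemma ex_disc_coeffs_mult:
  assumes a: "disc_coeffs a" "a 0 = 1" and n: "n > 0"
  shows "\<exists>b. disc_coeffs b \<and> b 0 = 1 \<and> (\<forall>x. norm x < 1 \<longrightarrow> power_series b x = power_series a x * (1 - x ^ n) powi c)"
proof -
  define f where "f = (\<lambda>x. power_series a x * (1 - x ^ n) powi c)"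
  have hol: "f holomorphic_on ball 0 1"
    unfolding f_def using power_series_holomorphic_ball[OF a(1)] one_minus_power_nonzero[OF _ n]
    by (intro holomorphic_intros) auto
  have "fps_nth (fps_expansion f 0) 0 = 1" using a(2) by (simp add: fps_expansion_def f_def power_series_def zero_power[OF n])
  thus ?thesis using holomorphic_imp_disc_coeffs(1,2)[OF hol] unfolding f_def by blast
qed

lemma pair_series_nonzero_real:
  fixes y :: real assumes "0 < y" "y < 1" shows "pair_series (of_real y) \<noteq> 0"
proof -
  have "(\<lambda>k. of_nat (num_partition_pairs k) * complex_of_real y ^ k) sums pair_series (of_real y)"
    unfolding pair_series_def by (rule disc_coeffs_sums[OF disc_coeffs_pairs]) (use assms in simp)
  from sums_Re[OF this] have *: "(\<lambda>k. real (num_partition_pairs k) * y ^ k) sums Re (pair_series (of_real y))"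
    by (simp flip: of_real_power)
  have "1 \<le> Re (pair_series (of_real y))"
  proof (rule sums_le[OF _ sums_single[of 0 "\<lambda>_. 1"] *])
    fix k
    show "(if k = 0 then 1 else 0) \<le> real (num_partition_pairs k) * y ^ k"
      using assms num_partition_pairs_0_3 by (cases "k = 0") auto
  qed
  thus ?thesis by (metis not_one_le_zero zero_complex.sel(1))
qed

definition zeta_base :: "complex \<Rightarrow> complex" where
  "zeta_base s = riemann_zeta s ^ 2 * riemann_zeta (2 * s) ^ 3 * riemann_zeta (3 * s) ^ 3"

lemma zeta_base_nonzero: "Re s > 1 \<Longrightarrow> zeta_base s \<noteq> 0"
  unfolding zeta_base_def using riemann_zeta_nonzero[of s] riemann_zeta_nonzero[of "2 * s"] riemann_zeta_nonzero[of "3 * s"]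
  by simp

lemma riemann_zeta_scaled_meromorphic: "(\<lambda>s. riemann_zeta (k * s)) meromorphic_on S"
  by (rule meromorphic_on_compose[OF riemann_zeta_meromorphic]) (auto intro!: analytic_intros)

lemma riemann_zeta_scaled_tendsto:
  assumes "k * s \<noteq> 1" shows "((\<lambda>w. riemann_zeta (k * w)) \<longlongrightarrow> riemann_zeta (k * s)) (at s)"
proof -
  have "continuous_on (- {1}) riemann_zeta" by (rule holomorphic_on_imp_continuous_on[OF riemann_zeta_holomorphic])
  hence "isCont riemann_zeta (k * s)" using assms by (simp add: continuous_on_eq_continuous_at open_Compl)
  thus ?thesis by (rule isCont_tendsto_compose) (intro tendsto_intros)
qed

context cyclotomic_factorisation begin

lemma coeffs: "disc_coeffs (a j)" "a j 0 = 1" "0 < k \<Longrightarrow> k \<le> 3 + j \<Longrightarrow> a j k = 0"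
  using ints[of j] by (auto simp: int_coeffs_def)

lemma euler:
  assumes "Re s * real (4 + j) > 1"
  shows "summable (\<lambda>n. norm (dirichlet_term (mult_coeff (a j)) s n))"
    and "euler_factor (power_series (a j)) s has_prod dirichlet_series (mult_coeff (a j)) s"
    and "dirichlet_series (mult_coeff (a j)) s = 0 \<longleftrightarrow> (\<exists>p. prime p \<and> power_series (a j) (of_nat p powr - s) = 0)"
proof -
  have "Suc (3 + j) = 4 + j" by simp
  hence s: "Re s * real (Suc (3 + j)) > 1" using assms by (simp only:)
  show "summable (\<lambda>n. norm (dirichlet_term (mult_coeff (a j)) s n))"
    by (rule euler_product_power_series(1)[where M = "3 + j", OF coeffs(1,2) _ s]) (rule coeffs(3))
  show "euler_factor (power_series (a j)) s has_prod dirichlet_series (mult_coeff (a j)) s"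
    by (rule euler_product_power_series(2)[where M = "3 + j", OF coeffs(1,2) _ s]) (rule coeffs(3))
  show "dirichlet_series (mult_coeff (a j)) s = 0 \<longleftrightarrow> (\<exists>p. prime p \<and> power_series (a j) (of_nat p powr - s) = 0)"
    by (rule dirichlet_series_eq_0_iff[where M = "3 + j", OF coeffs(1,2) _ s]) (rule coeffs(3))
qed

lemma level_iff: "Re s > 1 / real (4 + j) \<longleftrightarrow> Re s * real (4 + j) > 1"
  by (rule pos_divide_less_eq) simp

lemma series_holomorphic: "dirichlet_series (mult_coeff (a j)) holomorphic_on {s. Re s > 1 / real (4 + j)}"
  by (rule dirichlet_series_holomorphic, rule euler(1)) (simp only: level_iff)

lemma series_tendsto:
  assumes "Re s * real (4 + j) > 1"
  shows "(dirichlet_series (mult_coeff (a j)) \<longlongrightarrow> dirichlet_series (mult_coeff (a j)) s) (at s)"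
proof -
  have "continuous_on {s. Re s > 1 / real (4 + j)} (dirichlet_series (mult_coeff (a j)))"
    by (rule holomorphic_on_imp_continuous_on[OF series_holomorphic])
  hence "\<forall>s\<in>{s. Re s > 1 / real (4 + j)}. isCont (dirichlet_series (mult_coeff (a j))) s"
    by (simp only: continuous_on_eq_continuous_at[OF open_halfspace_Re_gt])
  hence "isCont (dirichlet_series (mult_coeff (a j))) s" by (rule bspec) (simp only: mem_Collect_eq level_iff assms)
  thus ?thesis by (simp only: isCont_def)
qed

lemma level_mono:
  assumes "Re s * real (4 + J) > 1" "J \<le> K" shows "Re s * real (4 + K) > 1"
proof -
  have "Re s > 0" using assms(1) by (metis less_trans zero_less_mult_pos2 zero_less_one of_nat_0_less_iff zero_less_numeral add_pos_nonneg le0)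
  hence "Re s * real (4 + J) \<le> Re s * real (4 + K)" using assms(2) by (intro mult_left_mono) auto
  thus ?thesis using assms(1) by linarith
qed

lemma level_ceiling:
  assumes "Re s > 0" shows "Re s * real (4 + nat \<lceil>1 / Re s\<rceil>) > 1"
proof -
  have "1 / Re s < real (4 + nat \<lceil>1 / Re s\<rceil>)" by linarith
  hence "Re s * (1 / Re s) < Re s * real (4 + nat \<lceil>1 / Re s\<rceil>)" using assms by (rule mult_strict_left_mono)
  thus ?thesis using assms by simp
qed

text \<open>The representation of \<open>Z\<close> on \<open>Re s > 1 / (4 + J)\<close>, with
  \<open>J\<close> zeta powers split off beyond the base.\<close>

definition zprod :: "nat \<Rightarrow> complex \<Rightarrow> complex" where
  "zprod J s = zeta_base s * (\<Prod>j<J. riemann_zeta (of_nat (4 + j) * s) powi c j) * dirichlet_series (mult_coeff (a J)) s"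

text \<open>The level depends on the point: \<open>nat \<lceil>1 / Re s\<rceil>\<close> is large
  enough for the Dirichlet series to converge absolutely at \<open>s\<close>.\<close>

definition continuation :: "complex \<Rightarrow> complex" where
  "continuation s = zprod (nat \<lceil>1 / Re s\<rceil>) s"

text \<open>Where level \<open>J\<close> converges, \<open>Re ((4 + J) * s) > 1\<close>, and the
  zeta factor being split off has neither pole nor zero. The two levels therefore agree at every
  such point, and not only outside a sparse set.\<close>

lemma zprod_Suc:
  assumes s: "Re s * real (4 + J) > 1" shows "zprod J s = zprod (Suc J) s"
proof -
  have s': "Re s * real (4 + Suc J) > 1" by (rule level_mono[OF s]) simp
  have "dirichlet_series (mult_coeff (a J)) s =
      riemann_zeta (of_nat (4 + J) * s) powi c J * dirichlet_series (mult_coeff (a (Suc J))) s"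
    by (rule dirichlet_series_split_zeta[OF _ s euler(2)[OF s] euler(2)[OF s'] step]) auto
  thus ?thesis unfolding zprod_def prod.lessThan_Suc by (simp only: mult_ac)
qed

lemma zprod_le: "J \<le> K \<Longrightarrow> Re s * real (4 + J) > 1 \<Longrightarrow> zprod J s = zprod K s"
proof (induction K rule: dec_induct)
  case (step K)
  have "Re s * real (4 + K) > 1" using step.prems step.hyps(1) by (rule level_mono)
  thus ?case using step.IH[OF step.prems] zprod_Suc by simp
qed simp

lemma continuation_eq:
  assumes "Re s * real (4 + J) > 1" shows "continuation s = zprod J s"
proof -
  have "Re s > 0" using assms by (metis less_trans zero_less_mult_pos2 zero_less_one of_nat_0_less_iff zero_less_numeral add_pos_nonneg le0)
  note l = level_ceiling[OF this]
  show ?thesis unfolding continuation_def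
  proof (cases "J \<le> nat \<lceil>1 / Re s\<rceil>")
    case True
    thus "zprod (nat \<lceil>1 / Re s\<rceil>) s = zprod J s" using zprod_le[OF _ assms] by metis
  next
    case False
    thus "zprod (nat \<lceil>1 / Re s\<rceil>) s = zprod J s" by (intro zprod_le l) linarith
  qed
qed

lemma continuation_eq_base:
  assumes "Re s > 1/4" shows "continuation s = zeta_base s * dirichlet_series (mult_coeff (a 0)) s"
proof -
  have "continuation s = zprod 0 s" by (rule continuation_eq) (use assms in simp)
  thus ?thesis by (simp add: zprod_def)
qed

text \<open>The level jumps with \<open>Re s\<close>, but the one chosen at \<open>s\<close>
  converges in a whole neighbourhood and represents the function there, by independence of the
  level.\<close>

lemma continuation_meromorphic: "continuation meromorphic_on {s. Re s > 0}"
proof (subst meromorphic_on_meromorphic_at, rule ballI)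
  fix s assume "s \<in> {s. Re s > 0}"
  hence s: "Re s > 0" by simp
  define J where "J = nat \<lceil>1 / Re s\<rceil>"
  define U where "U = {s. Re s > 1 / real (4 + J)}"
  have sU: "s \<in> U" unfolding U_def mem_Collect_eq level_iff J_def by (rule level_ceiling[OF s])
  have U: "open U" unfolding U_def by (rule open_halfspace_Re_gt)
  have "dirichlet_series (mult_coeff (a J)) analytic_on U"
    using series_holomorphic[of J] U by (simp only: U_def analytic_on_open)
  hence D: "dirichlet_series (mult_coeff (a J)) meromorphic_on U" by (rule analytic_on_imp_meromorphic_on)
  have "zprod J meromorphic_on U" unfolding zprod_def[abs_def] zeta_base_def[abs_def]
    by (intro meromorphic_intros riemann_zeta_scaled_meromorphic D meromorphic_on_subset[OF riemann_zeta_meromorphic]) auto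
  hence "zprod J meromorphic_on {s}" by (rule meromorphic_on_subset) (use sU in simp)
  moreover have "eventually (\<lambda>w. continuation w = zprod J w) (at s)"
    using eventually_at_in_open'[OF U sU]
    by eventually_elim (simp only: U_def mem_Collect_eq level_iff continuation_eq)
  ultimately show "continuation meromorphic_on {s}"
    by (subst meromorphic_on_cong[where g = "zprod J", OF _ refl]) auto
qed

lemma series_nonzero_real:
  fixes x :: real assumes x: "x > 1/4" shows "dirichlet_series (mult_coeff (a 0)) (of_real x) \<noteq> 0"
proof
  assume "dirichlet_series (mult_coeff (a 0)) (of_real x) = 0"
  moreover have "Re (of_real x) * real (4 + 0) > 1" using x by simp
  ultimately obtain p where p: "prime p" "power_series (a 0) (of_nat p powr - of_real x) = 0"
    using euler(3) by blast
  define y where "y = real p powr - x"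
  have eq: "of_nat p powr - of_real x = complex_of_real y"
    unfolding y_def using powr_of_real[of "real p" "- x"] by simp
  have "norm (complex_of_real y) < 1" unfolding eq[symmetric] by (rule norm_prime_powr_less_1[OF p(1)]) (use x in simp)
  moreover from this have n: "1 - complex_of_real y ^ n \<noteq> 0" if "n > 0" for n using that by (rule one_minus_power_nonzero)
  ultimately have "pair_series (of_real y) = 0"
    using p(2) start[of "of_real y"] n[of 1] n[of 2] n[of 3] unfolding eq by simp
  moreover have "0 < y" "y < 1" using prime_gt_0_nat[OF p(1)] \<open>norm (complex_of_real y) < 1\<close> by (auto simp: y_def)
  ultimately show False using pair_series_nonzero_real by blast
qed

lemma subgroup_class_series:
  assumes s: "Re s > 1"
  defines "A \<equiv> (\<lambda>n. of_nat (subgroup_class_sum n) :: complex)"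
  shows "summable (dirichlet_term A s)"
    and "dirichlet_series A s = zeta_base s * dirichlet_series (mult_coeff (a 0)) s"
proof -
  define N where "N = (\<lambda>k. of_nat (num_partition_pairs k) :: complex)"
  have "dirichlet_term A s n = dirichlet_term (mult_coeff N) s n" for n
    unfolding dirichlet_term_def A_def mult_coeff_def N_def subgroup_class_sum_eq_prod[OF zero_less_Suc] of_nat_prod ..
  hence AN: "dirichlet_term A s = dirichlet_term (mult_coeff N) s" by (rule ext)
  hence AN': "dirichlet_series A s = dirichlet_series (mult_coeff N) s" by (simp only: dirichlet_series_def)
  have N: "disc_coeffs N" "N 0 = 1"
    using disc_coeffs_pairs num_partition_pairs_0_3 by (auto simp: N_def)
  have ps: "power_series N x = pair_series x" for x by (simp add: power_series_def pair_series_def N_def)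
  have s1: "Re s * real (Suc 0) > 1" using s by simp
  have E: "summable (\<lambda>n. norm (dirichlet_term (mult_coeff b) s n))"
    "euler_factor (power_series b) s has_prod dirichlet_series (mult_coeff b) s"
    if "disc_coeffs b" "b 0 = 1" for b
    using euler_product_power_series[where M = 0, OF that _ s1] by auto
  show "summable (dirichlet_term A s)" unfolding AN by (rule summable_norm_cancel[OF E(1)[OF N]])
  obtain b1 where b1: "disc_coeffs b1" "b1 0 = 1"
    "\<And>x. norm x < 1 \<Longrightarrow> power_series b1 x = power_series N x * (1 - x ^ 1) powi 2"
    using ex_disc_coeffs_mult[OF N zero_less_one] by blast
  obtain b2 where b2: "disc_coeffs b2" "b2 0 = 1"
    "\<And>x. norm x < 1 \<Longrightarrow> power_series b2 x = power_series b1 x * (1 - x ^ 2) powi 3"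
    using ex_disc_coeffs_mult[OF b1(1,2) zero_less_numeral] by blast
  have st: "power_series (a 0) x = power_series b2 x * (1 - x ^ 3) powi 3" if "norm x < 1" for x
    using start[OF that] b2(3)[OF that] b1(3)[OF that] by (simp add: ps)
  have e0: "euler_factor (power_series (a 0)) s has_prod dirichlet_series (mult_coeff (a 0)) s"
    by (rule euler(2)) (use s in simp)
  have "dirichlet_series (mult_coeff N) s = riemann_zeta (of_nat 1 * s) powi 2 * dirichlet_series (mult_coeff b1) s"
    by (rule dirichlet_series_split_zeta[OF _ _ E(2)[OF N] E(2)[OF b1(1,2)] b1(3)]) (use s in auto)
  also have "dirichlet_series (mult_coeff b1) s = riemann_zeta (of_nat 2 * s) powi 3 * dirichlet_series (mult_coeff b2) s"
    by (rule dirichlet_series_split_zeta[OF _ _ E(2)[OF b1(1,2)] E(2)[OF b2(1,2)] b2(3)]) (use s in auto)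
  also have "dirichlet_series (mult_coeff b2) s = riemann_zeta (of_nat 3 * s) powi 3 * dirichlet_series (mult_coeff (a 0)) s"
    by (rule dirichlet_series_split_zeta[OF _ _ E(2)[OF b2(1,2)] e0 st]) (use s in auto)
  finally show "dirichlet_series A s = zeta_base s * dirichlet_series (mult_coeff (a 0)) s"
    unfolding AN' zeta_base_def by (simp add: mult_ac)
qed

text \<open>Every level multiplies by a further factor, so a zero of \<open>pair_series\<close>
  survives. It makes the Dirichlet series of level \<open>j\<close> vanish wherever some
  \<open>p powr - s\<close> equals it.\<close>

lemma power_series_zero:
  assumes "norm x < 1" "pair_series x = 0" shows "power_series (a j) x = 0"
  using assms by (induction j) (simp_all add: start step)

text \<open>A meromorphic function on the connected half-plane that vanishes near one point vanishes
  near 2 as well, but there every factor is nonzero.\<close>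

lemma continuation_not_eventually_0:
  assumes w0: "Re w0 > 0" shows "\<not> eventually (\<lambda>w. continuation w = 0) (at w0)"
proof
  assume ev: "eventually (\<lambda>w. continuation w = 0) (at w0)"
  let ?D = "{s. Re s > 0}"
  have D: "open ?D" "connected ?D"
    by (rule open_halfspace_Re_gt) (intro convex_connected convex_halfspace_Re_gt)
  have "eventually (\<lambda>w. continuation w = 0) (cosparse ?D) \<or> eventually (\<lambda>w. continuation w \<noteq> 0) (cosparse ?D)"
    by (rule meromorphic_imp_constant_or_avoid[OF continuation_meromorphic D])
  thus False
  proof
    assume "eventually (\<lambda>w. continuation w \<noteq> 0) (cosparse ?D)"
    hence "eventually (\<lambda>w. continuation w \<noteq> 0) (at w0)" using w0 by (simp add: eventually_cosparse_open_eq[OF D(1)])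
    with ev have "eventually (\<lambda>w. False) (at w0)" by eventually_elim simp
    thus False by simp
  next
    assume "eventually (\<lambda>w. continuation w = 0) (cosparse ?D)"
    hence "eventually (\<lambda>w. continuation w = 0) (at 2)" by (simp add: eventually_cosparse_open_eq[OF D(1)])
    moreover have "eventually (\<lambda>w. dirichlet_series (mult_coeff (a 0)) w \<noteq> 0) (at 2)"
    proof (rule tendsto_imp_eventually_ne)
      show "(dirichlet_series (mult_coeff (a 0)) \<longlongrightarrow> dirichlet_series (mult_coeff (a 0)) 2) (at 2)"
        by (rule series_tendsto) simp
      show "dirichlet_series (mult_coeff (a 0)) 2 \<noteq> 0" using series_nonzero_real[of 2] by simp
    qed
    moreover have "eventually (\<lambda>w. w \<in> {s. Re s > 1}) (at (2::complex))"
      by (rule eventually_at_in_open'[OF open_halfspace_Re_gt]) simp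
    ultimately have "eventually (\<lambda>w. False) (at (2::complex))"
      by eventually_elim (auto simp: continuation_eq_base zeta_base_nonzero)
    thus False by simp
  qed
qed

text \<open>Bounding the distance by \<open>\<bar>t\<bar>\<close> too keeps \<open>s\<close> off the
  real axis, hence away from the poles \<open>1 / n\<close> of the zeta factors. With the zeros of
  zeta avoided as well, each zeta factor has a finite nonzero limit whatever the sign of its
  exponent, and the zero of the Dirichlet series remains.\<close>

lemma ex_zero_of_continuation:
  fixes t \<delta> :: real assumes t: "t \<noteq> 0" and \<delta>: "\<delta> > 0"
  shows "\<exists>s J. Re s > 0 \<and> norm (s - \<i> * t) < \<delta> \<and> (continuation \<longlongrightarrow> 0) (at s)"
proof -
  obtain x0 where x0: "norm x0 < 1" "pair_series x0 = 0" using pair_series_has_zero by blast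
  have "pair_series 0 = 1" using num_partition_pairs_0_3 by (simp add: pair_series_def)
  hence "x0 \<noteq> 0" using x0(2) by auto
  moreover have "min \<delta> \<bar>t\<bar> > 0" using t \<delta> by simp
  ultimately obtain p s where p: "prime p" "of_nat p powr - s = x0" and close: "norm (s - \<i> * t) < min \<delta> \<bar>t\<bar>"
    and s: "Re s > 0" and nz: "\<And>n. n > 0 \<Longrightarrow> zeta_entire (of_nat n * s) \<noteq> 0"
    using ex_prime_solution_avoiding_zeta_zeros[of x0 "min \<delta> \<bar>t\<bar>" t] x0(1) by blast
  have "\<bar>Im s - t\<bar> < \<bar>t\<bar>" using abs_Im_le_cmod[of "s - \<i> * t"] close by simp
  hence Im: "Im s \<noteq> 0" by auto
  have n1: "of_nat n * s \<noteq> 1" for n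
  proof
    assume eq: "of_nat n * s = 1"
    from arg_cong[OF eq, of Im] Im have "n = 0" by simp
    thus False using eq by simp
  qed
  have zt: "((\<lambda>w. riemann_zeta (of_nat n * w)) \<longlongrightarrow> riemann_zeta (of_nat n * s)) (at s)" for n
    by (rule riemann_zeta_scaled_tendsto[OF n1])
  have znz: "riemann_zeta (of_nat n * s) \<noteq> 0" if "n > 0" for n
    using nz[OF that] n1[of n] by (simp add: zeta_entire(4))
  define J where "J = nat \<lceil>1 / Re s\<rceil>"
  define U where "U = {s. Re s > 1 / real (4 + J)}"
  have l: "Re s * real (4 + J) > 1" unfolding J_def by (rule level_ceiling[OF s])
  have U: "open U" unfolding U_def by (rule open_halfspace_Re_gt)
  have sU: "s \<in> U" unfolding U_def mem_Collect_eq level_iff by (rule l)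
  have "dirichlet_series (mult_coeff (a J)) s = 0"
    unfolding euler(3)[OF l] using p power_series_zero[OF x0] by blast
  hence Dt: "(dirichlet_series (mult_coeff (a J)) \<longlongrightarrow> 0) (at s)"
    using series_tendsto[OF l] by simp
  have "(zprod J \<longlongrightarrow> (riemann_zeta (of_nat 1 * s) ^ 2 * riemann_zeta (of_nat 2 * s) ^ 3 * riemann_zeta (of_nat 3 * s) ^ 3)
      * (\<Prod>j<J. riemann_zeta (of_nat (4 + j) * s) powi c j) * 0) (at s)"
    unfolding zprod_def[abs_def] zeta_base_def
    using zt[of 1] zt[of 2] zt[of 3]
    by (intro tendsto_mult tendsto_power tendsto_prod tendsto_power_int zt znz Dt) simp_all
  hence "(zprod J \<longlongrightarrow> 0) (at s)" by simp
  moreover have "eventually (\<lambda>w. zprod J w = continuation w) (at s)"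
    using eventually_at_in_open'[OF U sU]
    by eventually_elim (simp only: U_def mem_Collect_eq level_iff continuation_eq)
  ultimately have "(continuation \<longlongrightarrow> 0) (at s)" by (rule Lim_transform_eventually)
  thus ?thesis using s close by auto
qed

text \<open>In a punctured neighbourhood of a boundary point, a meromorphic \<open>h\<close> either
  vanishes identically or has no zeros. The first would make \<open>continuation\<close> vanish on
  an open set, the second contradicts the zeros that accumulate at the point.\<close>

lemma natural_boundary_continuation: "natural_boundary continuation {s. Re s > 0} {s. Re s = 0}"
  unfolding natural_boundary_def
proof (intro conjI ballI notI)
  show "continuation meromorphic_on {s. Re s > 0}" by (rule continuation_meromorphic)
  have "frontier {s. inner (1 :: complex) s > 0} = {s. inner (1 :: complex) s = 0}"
    by (rule frontier_halfspace_gt) simp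
  thus "{s. Re s = 0} \<subseteq> frontier {s. Re s > 0}" by (simp add: inner_complex_def)
next
  fix z :: complex
  let ?D = "{s. Re s > 0}"
  assume "z \<in> {s. Re s = 0}"
    and "\<exists>U h. open U \<and> z \<in> U \<and> h meromorphic_on U \<and> (\<forall>\<^sub>\<approx>w\<in>U \<inter> ?D. h w = continuation w)"
  then obtain U h where z: "Re z = 0" and U: "open U" "z \<in> U" and h: "h meromorphic_on U"
    and eq: "\<forall>\<^sub>\<approx>w\<in>U \<inter> ?D. h w = continuation w" by blast
  have oUD: "open (U \<inter> ?D)" using U(1) open_halfspace_Re_gt by blast
  have eq': "eventually (\<lambda>w. h w = continuation w) (at w)" if "w \<in> U" "Re w > 0" for w
    using eq that unfolding eventually_cosparse_open_eq[OF oUD] by blast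
  obtain e where e: "e > 0" "ball z e \<subseteq> U" using U openE by blast
  \<comment> \<open>Zeros are supplied only near points of nonzero height, so the origin is replaced
    by a nearby point of the axis that still lies in \<open>U\<close>.\<close>
  define t where "t = (if Im z = 0 then e / 2 else Im z)"
  have t: "t \<noteq> 0" using e(1) by (auto simp: t_def)
  have "z = \<i> * of_real (Im z)" using z by (simp add: complex_eq_iff)
  hence "dist z (\<i> * of_real t) = norm (\<i> * of_real (Im z) - \<i> * of_real t)" by (simp only: dist_norm)
  also have "\<dots> = \<bar>Im z - t\<bar>" by (simp add: norm_mult flip: right_diff_distrib of_real_diff)
  also have "\<dots> < e" using e(1) by (simp add: t_def)
  finally have zU: "\<i> * of_real t \<in> U" using e(2) by auto
  define z' where "z' = \<i> * complex_of_real t"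
  have "h meromorphic_on {z'}" by (rule meromorphic_on_subset[OF h]) (use zU in \<open>simp add: z'_def\<close>)
  hence iso: "isolated_singularity_at h z'" "not_essential h z'" by (auto simp: meromorphic_at_iff)
  have inU: "eventually (\<lambda>w. w \<in> U) (at z')" by (rule eventually_at_in_open'[OF U(1)]) (use zU in \<open>simp add: z'_def\<close>)
  show False
  proof (cases "frequently (\<lambda>w. h w = 0) (at z')")
    case True
    have "eventually (\<lambda>w. h w = 0) (at z')" by (rule not_essential_frequently_0_imp_eventually_0[OF iso True])
    with inU have "eventually (\<lambda>w. h w = 0 \<and> w \<in> U) (at z')" by eventually_elim simp
    then obtain r where r: "r > 0" "\<And>w. w \<noteq> z' \<Longrightarrow> dist w z' < r \<Longrightarrow> h w = 0 \<and> w \<in> U"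
      by (auto simp: eventually_at)
    \<comment> \<open>A step to the right leads into the half-plane, where \<open>h\<close> and the
      continuation agree near \<open>w0\<close>.\<close>
    define w0 where "w0 = z' + of_real (r / 2)"
    have w0: "w0 \<in> ball z' r - {z'}" "Re w0 > 0" using r(1) by (auto simp: w0_def z'_def dist_norm)
    have "eventually (\<lambda>w. w \<in> ball z' r - {z'}) (at w0)" by (rule eventually_at_in_open'[OF _ w0(1)]) auto
    moreover have "eventually (\<lambda>w. h w = continuation w) (at w0)"
      using w0 r(2)[of w0] by (intro eq') (auto simp: dist_commute)
    ultimately have "eventually (\<lambda>w. continuation w = 0) (at w0)"
    proof eventually_elim
      case (elim w)
      thus ?case using r(2)[of w] by (auto simp: dist_commute)
    qed
    thus False using continuation_not_eventually_0[OF w0(2)] by blast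
  next
    case False
    hence "eventually (\<lambda>w. h w \<noteq> 0) (at z')" by (simp add: not_frequently)
    with inU have "eventually (\<lambda>w. h w \<noteq> 0 \<and> w \<in> U) (at z')" by eventually_elim simp
    then obtain r where r: "r > 0" "\<And>w. w \<noteq> z' \<Longrightarrow> dist w z' < r \<Longrightarrow> h w \<noteq> 0 \<and> w \<in> U"
      by (auto simp: eventually_at)
    obtain r' where r': "r' > 0" "h analytic_on ball z' r' - {z'}"
      using iso(1) by (auto simp: isolated_singularity_at_def)
    obtain s where s: "Re s > 0" "norm (s - z') < min r r'" "(continuation \<longlongrightarrow> 0) (at s)"
      using ex_zero_of_continuation[OF t, of "min r r'"] r(1) r'(1) unfolding z'_def by auto
    have sz: "s \<noteq> z'" using s(1) by (auto simp: z'_def)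
    have hs: "h s \<noteq> 0" "s \<in> U" using r(2)[OF sz] s(2) by (auto simp: dist_norm)
    have "h analytic_on {s}" by (rule analytic_on_subset[OF r'(2)]) (use s(2) sz in \<open>auto simp: dist_norm norm_minus_commute\<close>)
    hence "(h \<longlongrightarrow> h s) (at s)" using analytic_at_imp_isCont isCont_def by blast
    \<comment> \<open>Agreement is known only in a punctured neighbourhood of \<open>s\<close>,
      which is why the zero was stated as a limit; analyticity of \<open>h\<close> at
      \<open>s\<close> turns it into a value.\<close>
    moreover have "(h \<longlongrightarrow> 0) (at s)"
    proof (rule Lim_transform_eventually[OF s(3)])
      show "eventually (\<lambda>w. continuation w = h w) (at s)" using eq'[OF hs(2) s(1)] by eventually_elim simp
    qed
    ultimately have "h s = 0" by (rule LIM_unique)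
    thus False using hs(1) by blast
  qed
qed

end

theorem theorem4:
  defines "A \<equiv> (\<lambda>n. of_nat (subgroup_class_sum n) :: complex)"
  shows "\<exists>(g :: nat \<Rightarrow> complex) (Z :: complex \<Rightarrow> complex).
    (\<forall>s. Re s > 1/4 \<longrightarrow> summable (\<lambda>n. norm (dirichlet_term g s n))) \<and>
    (\<forall>x::real. x > 1/4 \<longrightarrow> dirichlet_series g (of_real x) \<noteq> 0) \<and>
    (\<forall>s. Re s > 1 \<longrightarrow> summable (dirichlet_term A s) \<and>
       dirichlet_series A s =
         riemann_zeta s ^ 2 * riemann_zeta (2 * s) ^ 3 * riemann_zeta (3 * s) ^ 3
           * dirichlet_series g s) \<and>
    (\<forall>s. Re s > 1 \<longrightarrow> Z s = dirichlet_series A s) \<and>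
    (\<forall>s. Re s > 1/4 \<and> s \<notin> {1, 1/2, 1/3} \<longrightarrow>
       Z s = riemann_zeta s ^ 2 * riemann_zeta (2 * s) ^ 3 * riemann_zeta (3 * s) ^ 3
           * dirichlet_series g s) \<and>
    Z meromorphic_on {s. Re s > 0} \<and>
    natural_boundary Z {s. Re s > 0} {s. Re s = 0}"
proof -
  obtain a c where "cyclotomic_factorisation a c" using ex_cyclotomic_factorisation by blast
  then interpret cyclotomic_factorisation a c .
  show ?thesis
  proof (intro exI conjI allI impI)
    fix s assume "Re s > 1/4"
    thus "summable (\<lambda>n. norm (dirichlet_term (mult_coeff (a 0)) s n))" by (intro euler(1)) simp
  next
    fix x :: real assume "x > 1/4"
    thus "dirichlet_series (mult_coeff (a 0)) (of_real x) \<noteq> 0" by (rule series_nonzero_real)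
  next
    fix s assume s: "Re s > 1"
    show "summable (dirichlet_term A s)" unfolding A_def by (rule subgroup_class_series(1)[OF s])
    show eq: "dirichlet_series A s =
        riemann_zeta s ^ 2 * riemann_zeta (2 * s) ^ 3 * riemann_zeta (3 * s) ^ 3 * dirichlet_series (mult_coeff (a 0)) s"
      unfolding A_def zeta_base_def[symmetric] by (rule subgroup_class_series(2)[OF s])
    show "continuation s = dirichlet_series A s"
      unfolding eq zeta_base_def[symmetric] by (rule continuation_eq_base) (use s in simp)
  next
    fix s :: complex assume "Re s > 1/4 \<and> s \<notin> {1, 1/2, 1/3}"
    thus "continuation s =
        riemann_zeta s ^ 2 * riemann_zeta (2 * s) ^ 3 * riemann_zeta (3 * s) ^ 3 * dirichlet_series (mult_coeff (a 0)) s"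
      unfolding zeta_base_def[symmetric] by (intro continuation_eq_base) simp
  next
    show "continuation meromorphic_on {s. Re s > 0}" by (rule continuation_meromorphic)
    show "natural_boundary continuation {s. Re s > 0} {s. Re s = 0}" by (rule natural_boundary_continuation)
  qed
qed


end
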